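(* Let $\Omega\subset\mathbb{H}$ be a circular domain and let $f,g\in\mathcal{SEM}(\Omega)\setminus\mathcal{SEM}_{\mathbb{R}}(\Omega)$ be such that $f_{0}=-g_{0}$ and $f_{v}^{s}=g_{v}^{s}$. Let $\mathcal{S}_{f,g}(\chi)=f*\chi+\chi*g$ for $\chi\in\mathcal{SEM}(\Omega)$. Then $$\ker(\mathcal{S}_{f,g})=\{f*h+h*g^{c}\,:\,h\in\mathcal{SEM}(\Omega)\}.$$ Moreover, it is possible to find a basis of $\ker(\mathcal{S}_{f,g})$ over $\mathcal{SEM}_{\mathbb{R}}(\Omega)$ consisting of $*$-invertible elements.
   Context: $\mathbb{H}$ denotes the quaternions, $q^c$ the quaternionic conjugate, $\mathbb{S}=\{q\in\mathbb{H}: q^2=-1\}$, and $\mathbb{C}_I=\mathbb{R}+I\mathbb{R}$ for $I\in\mathbb{S}$. For $q=x+Iy$ put $\mathbb{S}_q=\{x+Jy: J\in\mathbb{S}\}$. A domain (connected open set) $\Omega\subset\mathbb{H}$ is circular if $\mathbb{S}_q\subset\Omega$ for all $q\in\Omega$. A function $f$ on a circular open set $\Omega$ is slice regular ($f\in\mathcal{SR}(\Omega)$) if $f(x+Iy)=F_1(x,y)+IF_2(x,y)$ for all $x+Iy\in\Omega$ ($x,y\in\mathbb{R}$, $I\in\mathbb{S}$), with $\mathbb{H}$-valued $F_1$ even in $y$ and $F_2$ odd in $y$, and each restriction $f|_{\Omega\cap\mathbb{C}_I}$ is real differentiable with $\frac12(\partial_x+I\partial_y)f|_{\Omega\cap\mathbb{C}_I}\equiv0$.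 The $*$-product is $(f*g)(q)=0$ if $f(q)=0$ and $(f*g)(q)=f(q)\,g(f(q)^{-1}qf(q))$ otherwise. $f$ is slice preserving if $f(\Omega\cap\mathbb{C}_I)\subset\mathbb{C}_I$ for every $I\in\mathbb{S}$. A function $f$ is slice semi-regular on $\Omega$ ($f\in\mathcal{SEM}(\Omega)$) if there is a circular open $\widetilde\Omega\subseteq\Omega$ with $f\in\mathcal{SR}(\widetilde\Omega)$ and each point of $\Omega\setminus\widetilde\Omega$ is a pole or a removable singularity; i.e. $\Omega\setminus\widetilde\Omega$ consists of isolated real points and isolated spheres $\mathbb{S}_p$, near each of which $\Delta_p^m f$ extends slice regularly for some integer $m\ge0$, where $\Delta_p(q)=q^2-2\mathrm{Re}(p)q+|p|^2$. Functions agreeing where both are defined are identified. $\mathcal{SEM}_{\mathbb{R}}(\Omega)$ is the subset of slice preserving elements; it is a field and the center of the algebra $(\mathcal{SEM}(\Omega),+,* )$, which is a 4-dimensional vector space over it: for an orthonormal basis $(1,I,J,K)$ of $\mathbb{H}$, each $f$ is uniquely $f_0+f_1I+f_2J+f_3K$ with $f_\ell\in\mathcal{SEM}_{\mathbb{R}}(\Omega)$. Set $f^c=f_0-(f_1I+f_2J+f_3K)$, $f^s=f*f^c=f_0^2+f_1^2+f_2^2+f_3^2$, $f_0=(f+f^c)/2$, $f_v=f-f_0$, so $f_v^s=(f_v)^s=f_1^2+f_2^2+f_3^2$. $f$ is $*$-invertible iff $f^s\not\equiv0$, with $f^{-*}=(f^s)^{-1}f^c$. *)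

theory Defs
  imports "HOL-Analysis.Analysis" "HOL-Algebra.Embedded_Algebras"
begin

section \<open>Quaternions\<close>

datatype quat = Quat (qRe: real) (qIm1: real) (qIm2: real) (qIm3: real)

lemma quat_eq_iff:
  "p = q \<longleftrightarrow> qRe p = qRe q \<and> qIm1 p = qIm1 q \<and> qIm2 p = qIm2 q \<and> qIm3 p = qIm3 q"
  by (cases p; cases q) simp

instantiation quat :: "{ring_1, real_vector, inverse}"
begin

definition zero_quat_def: "0 = Quat 0 0 0 0"
definition one_quat_def: "1 = Quat 1 0 0 0"
definition plus_quat_def:
  "p + q = Quat (qRe p + qRe q) (qIm1 p + qIm1 q) (qIm2 p + qIm2 q) (qIm3 p + qIm3 q)"
definition uminus_quat_def:
  "- p = Quat (- qRe p) (- qIm1 p) (- qIm2 p) (- qIm3 p)"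
definition minus_quat_def:
  "p - q = Quat (qRe p - qRe q) (qIm1 p - qIm1 q) (qIm2 p - qIm2 q) (qIm3 p - qIm3 q)"
definition times_quat_def:
  "p * q = Quat
     (qRe p * qRe q - qIm1 p * qIm1 q - qIm2 p * qIm2 q - qIm3 p * qIm3 q)
     (qRe p * qIm1 q + qIm1 p * qRe q + qIm2 p * qIm3 q - qIm3 p * qIm2 q)
     (qRe p * qIm2 q - qIm1 p * qIm3 q + qIm2 p * qRe q + qIm3 p * qIm1 q)
     (qRe p * qIm3 q + qIm1 p * qIm2 q - qIm2 p * qIm1 q + qIm3 p * qRe q)"
definition scaleR_quat_def:
  "r *\<^sub>R p = Quat (r * qRe p) (r * qIm1 p) (r * qIm2 p) (r * qIm3 p)"
definition inverse_quat_def: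
  "inverse p =
     inverse ((qRe p)\<^sup>2 + (qIm1 p)\<^sup>2 + (qIm2 p)\<^sup>2 + (qIm3 p)\<^sup>2)
       *\<^sub>R Quat (qRe p) (- qIm1 p) (- qIm2 p) (- qIm3 p)"
definition divide_quat_def: "(p :: quat) div q = p * inverse q"

instance
  by standard
    (simp_all add: zero_quat_def one_quat_def plus_quat_def uminus_quat_def minus_quat_def
      times_quat_def scaleR_quat_def quat_eq_iff algebra_simps)

end

lemma quat_sel_simps [simp]:
  "qRe 0 = 0" "qIm1 0 = 0" "qIm2 0 = 0" "qIm3 0 = 0"
  "qRe 1 = 1" "qIm1 1 = 0" "qIm2 1 = 0" "qIm3 1 = 0"
  "qRe (p + q) = qRe p + qRe q" "qIm1 (p + q) = qIm1 p + qIm1 q"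
  "qIm2 (p + q) = qIm2 p + qIm2 q" "qIm3 (p + q) = qIm3 p + qIm3 q"
  "qRe (- p) = - qRe p" "qIm1 (- p) = - qIm1 p"
  "qIm2 (- p) = - qIm2 p" "qIm3 (- p) = - qIm3 p"
  "qRe (p - q) = qRe p - qRe q" "qIm1 (p - q) = qIm1 p - qIm1 q"
  "qIm2 (p - q) = qIm2 p - qIm2 q" "qIm3 (p - q) = qIm3 p - qIm3 q"
  "qRe (r *\<^sub>R p) = r * qRe p" "qIm1 (r *\<^sub>R p) = r * qIm1 p"
  "qIm2 (r *\<^sub>R p) = r * qIm2 p" "qIm3 (r *\<^sub>R p) = r * qIm3 p"
  by (simp_all add: zero_quat_def one_quat_def plus_quat_def uminus_quat_def minus_quat_def
      scaleR_quat_def)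

instantiation quat :: "{real_normed_div_algebra, real_inner}"
begin

definition inner_quat_def:
  "p \<bullet> q = qRe p * qRe q + qIm1 p * qIm1 q + qIm2 p * qIm2 q + qIm3 p * qIm3 q"
definition norm_quat_def:
  "norm p = sqrt ((qRe p)\<^sup>2 + (qIm1 p)\<^sup>2 + (qIm2 p)\<^sup>2 + (qIm3 p)\<^sup>2)"
definition sgn_quat_def: "sgn (p :: quat) = p /\<^sub>R norm p"
definition dist_quat_def: "dist (p :: quat) q = norm (p - q)"
definition uniformity_quat_def:
  "(uniformity :: (quat \<times> quat) filter) = (INF e\<in>{0<..}. principal {(p, q). dist p q < e})"
definition open_quat_def:
  "open (U :: quat set) \<longleftrightarrow> (\<forall>p\<in>U. eventually (\<lambda>(p', q). p' = p \<longrightarrow> q \<in> U) uniformity)"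

instance
proof
  fix p q s :: quat and r :: real and U :: "quat set"
  have sumsq_0: "a\<^sup>2 + b\<^sup>2 + c\<^sup>2 + d\<^sup>2 = 0 \<longleftrightarrow> a = 0 \<and> b = 0 \<and> c = 0 \<and> d = 0" for a b c d :: real
    by (simp add: add_nonneg_eq_0_iff)
  show scale_l: "r *\<^sub>R p * q = r *\<^sub>R (p * q)" and scale_r: "p * r *\<^sub>R q = r *\<^sub>R (p * q)"
    by (simp_all add: times_quat_def quat_eq_iff algebra_simps)
  {
    assume "p \<noteq> 0"
    then have nz: "(qRe p)\<^sup>2 + (qIm1 p)\<^sup>2 + (qIm2 p)\<^sup>2 + (qIm3 p)\<^sup>2 \<noteq> 0"
      unfolding sumsq_0 by (simp add: quat_eq_iff)
    let ?c = "Quat (qRe p) (- qIm1 p) (- qIm2 p) (- qIm3 p)"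
    let ?n = "(qRe p)\<^sup>2 + (qIm1 p)\<^sup>2 + (qIm2 p)\<^sup>2 + (qIm3 p)\<^sup>2"
    have "?c * p = ?n *\<^sub>R 1" "p * ?c = ?n *\<^sub>R 1"
      by (simp_all add: times_quat_def quat_eq_iff power2_eq_square algebra_simps)
    moreover have "(a *\<^sub>R x) * y = a *\<^sub>R (x * y)" "x * (a *\<^sub>R y) = a *\<^sub>R (x * y)"
      for a :: real and x y :: quat
      by (simp_all add: times_quat_def quat_eq_iff algebra_simps)
    ultimately show "inverse p * p = 1" "p * inverse p = 1"
      using nz by (simp_all add: inverse_quat_def)
  }
  show "p div q = p * inverse q"
    by (rule divide_quat_def)
  show "inverse (0 :: quat) = 0"
    by (simp add: inverse_quat_def)
  show "(norm p = 0) = (p = 0)"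
    by (simp only: norm_quat_def real_sqrt_eq_0_iff sumsq_0) (simp add: quat_eq_iff)
  show "norm (r *\<^sub>R p) = \<bar>r\<bar> * norm p"
    by (simp add: norm_quat_def power_mult_distrib distrib_left [symmetric] real_sqrt_mult)
  show "norm (p * q) = norm p * norm q"
    unfolding norm_quat_def real_sqrt_mult [symmetric]
    by (rule arg_cong [where f = sqrt]) (simp add: times_quat_def power2_eq_square algebra_simps)
  show "norm (p + q) \<le> norm p + norm q"
  proof -
    have "norm (x :: quat) = norm ((qRe x, qIm1 x), (qIm2 x, qIm3 x))" for x
      by (simp add: norm_quat_def norm_Pair)
    then show ?thesis
      using norm_triangle_ineq
        [of "((qRe p, qIm1 p), (qIm2 p, qIm3 p))" "((qRe q, qIm1 q), (qIm2 q, qIm3 q))"]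
      by simp
  qed
  show "p \<bullet> q = q \<bullet> p" "(p + q) \<bullet> s = p \<bullet> s + q \<bullet> s" "(r *\<^sub>R p) \<bullet> q = r * (p \<bullet> q)" "0 \<le> p \<bullet> p"
    by (simp_all add: inner_quat_def algebra_simps)
  show "(p \<bullet> p = 0) = (p = 0)"
    by (simp only: inner_quat_def power2_eq_square [symmetric] sumsq_0) (simp add: quat_eq_iff)
  show "norm p = sqrt (p \<bullet> p)"
    by (simp add: norm_quat_def inner_quat_def power2_eq_square)
qed (rule sgn_quat_def dist_quat_def open_quat_def uniformity_quat_def)+

end

definition q_i :: quat where "q_i = Quat 0 1 0 0"
definition q_j :: quat where "q_j = Quat 0 0 1 0"
definition q_k :: quat where "q_k = Quat 0 0 0 1"

definition imag_units :: "quat set" where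
  "imag_units = {q. q\<^sup>2 = -1}"

definition slice :: "quat \<Rightarrow> quat set" where
  "slice I = {of_real x + I * of_real y | x y. True}"

definition qsphere :: "quat \<Rightarrow> quat set" where
  "qsphere q = {of_real x + J * of_real y | x y I J.
     I \<in> imag_units \<and> J \<in> imag_units \<and> q = of_real x + I * of_real y}"

definition circular :: "quat set \<Rightarrow> bool" where
  "circular U \<longleftrightarrow> (\<forall>q\<in>U. qsphere q \<subseteq> U)"

definition circular_domain :: "quat set \<Rightarrow> bool" where
  "circular_domain U \<longleftrightarrow> open U \<and> connected U \<and> circular U"


section \<open>Slice regular functions\<close>

definition slice_regular_on :: "quat set \<Rightarrow> (quat \<Rightarrow> quat) \<Rightarrow> bool" where
  "slice_regular_on U f \<longleftrightarrow>
     (\<exists>F1 F2 :: real \<Rightarrow> real \<Rightarrow> quat.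
        (\<forall>x y. F1 x (- y) = F1 x y) \<and> (\<forall>x y. F2 x (- y) = - F2 x y) \<and>
        (\<forall>x y. \<forall>I\<in>imag_units. of_real x + I * of_real y \<in> U \<longrightarrow>
           f (of_real x + I * of_real y) = F1 x y + I * F2 x y)) \<and>
     (\<forall>I\<in>imag_units. \<forall>x y. of_real x + I * of_real y \<in> U \<longrightarrow>
        (\<exists>D. ((\<lambda>(s, t). f (of_real s + I * of_real t)) has_derivative D) (at (x, y)) \<and>
             (1/2) *\<^sub>R (D (1, 0) + I * D (0, 1)) = 0))"

definition slice_preserving_on :: "quat set \<Rightarrow> (quat \<Rightarrow> quat) \<Rightarrow> bool" where
  "slice_preserving_on U f \<longleftrightarrow> (\<forall>I\<in>imag_units. f ` (U \<inter> slice I) \<subseteq> slice I)"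

definition star :: "(quat \<Rightarrow> quat) \<Rightarrow> (quat \<Rightarrow> quat) \<Rightarrow> quat \<Rightarrow> quat" where
  "star f g q = (if f q = 0 then 0 else f q * g (inverse (f q) * q * f q))"

definition qDelta :: "quat \<Rightarrow> quat \<Rightarrow> quat" where
  "qDelta p q = q\<^sup>2 - of_real (2 * qRe p) * q + of_real ((norm p)\<^sup>2)"


section \<open>Slice semi-regular functions\<close>

text \<open>A semi-regular function is represented by a pair \<open>(U, f)\<close> where \<open>f\<close> is slice regular
  on \<open>U\<close>; the values of \<open>f\<close> off \<open>U\<close> are irrelevant. The exponent \<open>m = 0\<close> below is
  the case of a removable singularity, and \<open>W - qsphere p \<subseteq> U\<close> says that the singular sphere
  (or real point) is isolated.\<close>

definition semireg :: "quat set \<Rightarrow> (quat set \<times> (quat \<Rightarrow> quat)) set" where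
  "semireg \<Omega> = {(U, f).
     U \<subseteq> \<Omega> \<and> open U \<and> circular U \<and> slice_regular_on U f \<and>
     (\<forall>p\<in>\<Omega> - U. \<exists>W g. \<exists>m::nat.
        p \<in> W \<and> W \<subseteq> \<Omega> \<and> open W \<and> circular W \<and> W - qsphere p \<subseteq> U \<and>
        slice_regular_on W g \<and> (\<forall>q\<in>W - qsphere p. g q = qDelta p q ^ m * f q))}"

definition sem_rel ::
    "quat set \<Rightarrow> ((quat set \<times> (quat \<Rightarrow> quat)) \<times> (quat set \<times> (quat \<Rightarrow> quat))) set" where
  "sem_rel \<Omega> = {((U, f), (V, g)).
     (U, f) \<in> semireg \<Omega> \<and> (V, g) \<in> semireg \<Omega> \<and> (\<forall>q\<in>U \<inter> V. f q = g q)}"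

type_synonym sem = "(quat set \<times> (quat \<Rightarrow> quat)) set"

definition sem_const :: "quat set \<Rightarrow> quat \<Rightarrow> sem" where
  "sem_const \<Omega> c = sem_rel \<Omega> `` {(\<Omega>, \<lambda>_. c)}"

definition SEM :: "quat set \<Rightarrow> sem ring" where
  "SEM \<Omega> = \<lparr>
     carrier = semireg \<Omega> // sem_rel \<Omega>,
     mult = (\<lambda>F G. \<Union>(U, f)\<in>F. \<Union>(V, g)\<in>G. sem_rel \<Omega> `` {(U \<inter> V, star f g)}),
     one = sem_const \<Omega> 1,
     zero = sem_const \<Omega> 0,
     add = (\<lambda>F G. \<Union>(U, f)\<in>F. \<Union>(V, g)\<in>G. sem_rel \<Omega> `` {(U \<inter> V, \<lambda>q. f q + g q)}) \<rparr>"

text \<open>Whether a class is slice preserving does not depend on the representative: the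
  domains of regularity are dense and each \<open>slice I\<close> is closed.\<close>

definition SEM_real :: "quat set \<Rightarrow> sem set" where
  "SEM_real \<Omega> = {F \<in> carrier (SEM \<Omega>). \<exists>(U, f)\<in>F. slice_preserving_on U f}"

definition sem_vec_comb :: "quat set \<Rightarrow> sem \<Rightarrow> sem \<Rightarrow> sem \<Rightarrow> sem" where
  "sem_vec_comb \<Omega> F1 F2 F3 =
     F1 \<otimes>\<^bsub>SEM \<Omega>\<^esub> sem_const \<Omega> q_i \<oplus>\<^bsub>SEM \<Omega>\<^esub> F2 \<otimes>\<^bsub>SEM \<Omega>\<^esub> sem_const \<Omega> q_j
       \<oplus>\<^bsub>SEM \<Omega>\<^esub> F3 \<otimes>\<^bsub>SEM \<Omega>\<^esub> sem_const \<Omega> q_k"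

text \<open>The components of \<open>F\<close> over the slice preserving functions are unique, and the
  conjugate does not depend on the choice of the orthonormal basis, here \<open>(1, q_i, q_j, q_k)\<close>.\<close>

definition sem_conj :: "quat set \<Rightarrow> sem \<Rightarrow> sem" where
  "sem_conj \<Omega> F = (THE G. \<exists>F0\<in>SEM_real \<Omega>. \<exists>F1\<in>SEM_real \<Omega>. \<exists>F2\<in>SEM_real \<Omega>. \<exists>F3\<in>SEM_real \<Omega>.
     F = F0 \<oplus>\<^bsub>SEM \<Omega>\<^esub> sem_vec_comb \<Omega> F1 F2 F3 \<and> G = F0 \<ominus>\<^bsub>SEM \<Omega>\<^esub> sem_vec_comb \<Omega> F1 F2 F3)"

definition sem_symm :: "quat set \<Rightarrow> sem \<Rightarrow> sem" where
  "sem_symm \<Omega> F = F \<otimes>\<^bsub>SEM \<Omega>\<^esub> sem_conj \<Omega> F"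

definition sem_real_part :: "quat set \<Rightarrow> sem \<Rightarrow> sem" where
  "sem_real_part \<Omega> F = sem_const \<Omega> (1/2) \<otimes>\<^bsub>SEM \<Omega>\<^esub> (F \<oplus>\<^bsub>SEM \<Omega>\<^esub> sem_conj \<Omega> F)"

definition sem_vec_part :: "quat set \<Rightarrow> sem \<Rightarrow> sem" where
  "sem_vec_part \<Omega> F = F \<ominus>\<^bsub>SEM \<Omega>\<^esub> sem_real_part \<Omega> F"

definition sylvester :: "quat set \<Rightarrow> sem \<Rightarrow> sem \<Rightarrow> sem \<Rightarrow> sem" where
  "sylvester \<Omega> F G X = F \<otimes>\<^bsub>SEM \<Omega>\<^esub> X \<oplus>\<^bsub>SEM \<Omega>\<^esub> X \<otimes>\<^bsub>SEM \<Omega>\<^esub> G"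

end

theory Submission
  imports Defs "HOL-Complex_Analysis.Complex_Analysis"
begin

text \<open>
  The idea is that \<^term>\<open>SEM \<Omega>\<close>, for nonempty \<open>\<Omega>\<close>, is a quaternion algebra over a field, and that
  the statement is true for every quaternion algebra over a field of characteristic 0.

  A slice function is \<open>f(x + Iy) = F1(x, y) + I F2(x, y)\<close>; splitting \<open>F1\<close> and \<open>F2\<close> along
  \<open>1, i, j, k\<close> turns it into four complex functions on the planar trace \<open>{x + iy. x + Iy \<in> \<Omega>}\<close>,
  that is, into one function with values in the complexified quaternions, its stem function.
  Under this translation the \<open>*\<close>-product becomes the pointwise product of stem functions
  (\<open>star_slice_pt\<close>), slice regularity becomes holomorphy of the four components
  (\<open>slice_regular_on_iff\<close>), and a pole of order \<open>m\<close> in the sense of \<open>\<Delta>\<^sub>p\<^sup>m\<close> becomes an ordinary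
  pole, so that semi-regular means that the components are meromorphic (\<open>semireg_iff\<close>). All
  components commute with complex conjugation, and slice preserving means that only the first
  one is present.

  To compute with these functions without reference to \<open>\<Omega>\<close>, they are replaced by their Laurent
  expansions at one base point. By the identity theorem no information is lost, even if \<open>\<Omega>\<close> does
  not meet the real axis and its planar trace has two halves, since each half determines the
  other by conjugation (\<open>germ_eq_iff\<close>). Thus equality of semi-regular functions is equality of
  germs, and \<^term>\<open>SEM \<Omega>\<close> is isomorphic to the quaternions with coefficients in a subfield of the
  field of formal Laurent series, the slice preserving functions being the scalars. All ring
  axioms are inherited from there.

  It remains to solve \<open>f x + x g = 0\<close> in a quaternion algebra, when \<open>f\<^sub>0 = - g\<^sub>0\<close> and the vector
  parts \<open>a\<close>, \<open>b\<close> of \<open>f\<close>, \<open>g\<close> are nonzero and have the same norm \<open>N\<close>; the equation reads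
  \<open>a x + x b = 0\<close>. Because \<open>a\<^sup>2 = b\<^sup>2 = - N\<close>, every \<open>u = a h + h b\<close> satisfies \<open>a u = u b\<close>, and
  some such \<open>u\<close> is invertible, even if \<open>N = 0\<close>, because otherwise all products of a coordinate
  of \<open>a\<close> with one of \<open>b\<close> would vanish (\<open>zero_if_intertwiners_singular\<close>). Substituting \<open>x = y u\<close>
  leads to \<open>a y + y a = 0\<close>, whose solutions are the vectors \<open>y\<close> orthogonal to \<open>a\<close>. These are
  exactly the commutators \<open>a v - v a\<close>, which gives the description of the kernel as an image,
  and they form a plane on which the norm form is not identically 0, which therefore has a basis
  of invertible elements (\<open>anisotropic_plane_basis\<close>).
\<close>

section \<open>Quaternion algebras over a commutative ring\<close>

text \<open>The quaternions over \<^typ>\<open>real\<close> of the theory of slice functions are a type of their own.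
  Here the coefficients are arbitrary, because stem functions have values in the quaternions
  over \<^typ>\<open>complex\<close> and their germs are quaternions over \<^typ>\<open>complex fls\<close>; both have zero divisors.\<close>

datatype 'a hq = Hq (h0: 'a) (h1: 'a) (h2: 'a) (h3: 'a)

lemma hq_eq_iff: "p = q \<longleftrightarrow> h0 p = h0 q \<and> h1 p = h1 q \<and> h2 p = h2 q \<and> h3 p = h3 q"
  by (cases p; cases q) simp

instantiation hq :: (comm_ring_1) ring_1
begin

definition zero_hq_def: "0 = Hq 0 0 0 0"
definition one_hq_def: "1 = Hq 1 0 0 0"
definition plus_hq_def: "p + q = Hq (h0 p + h0 q) (h1 p + h1 q) (h2 p + h2 q) (h3 p + h3 q)"
definition uminus_hq_def: "- p = Hq (- h0 p) (- h1 p) (- h2 p) (- h3 p)"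
definition minus_hq_def: "p - q = Hq (h0 p - h0 q) (h1 p - h1 q) (h2 p - h2 q) (h3 p - h3 q)"
definition times_hq_def:
  "p * q = Hq
     (h0 p * h0 q - h1 p * h1 q - h2 p * h2 q - h3 p * h3 q)
     (h0 p * h1 q + h1 p * h0 q + h2 p * h3 q - h3 p * h2 q)
     (h0 p * h2 q - h1 p * h3 q + h2 p * h0 q + h3 p * h1 q)
     (h0 p * h3 q + h1 p * h2 q - h2 p * h1 q + h3 p * h0 q)"

instance
  by standard
    (simp_all add: zero_hq_def one_hq_def plus_hq_def uminus_hq_def minus_hq_def
      times_hq_def hq_eq_iff algebra_simps)

end

lemma hq_sel_simps [simp]:
  "h0 0 = 0" "h1 0 = 0" "h2 0 = 0" "h3 0 = 0"
  "h0 1 = 1" "h1 1 = 0" "h2 1 = 0" "h3 1 = 0"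
  "h0 (p + q) = h0 p + h0 q" "h1 (p + q) = h1 p + h1 q"
  "h2 (p + q) = h2 p + h2 q" "h3 (p + q) = h3 p + h3 q"
  "h0 (- p) = - h0 p" "h1 (- p) = - h1 p" "h2 (- p) = - h2 p" "h3 (- p) = - h3 p"
  "h0 (p - q) = h0 p - h0 q" "h1 (p - q) = h1 p - h1 q"
  "h2 (p - q) = h2 p - h2 q" "h3 (p - q) = h3 p - h3 q"
  by (simp_all add: zero_hq_def one_hq_def plus_hq_def uminus_hq_def minus_hq_def)

lemma hq_times_sel:
  "h0 (p * q) = h0 p * h0 q - h1 p * h1 q - h2 p * h2 q - h3 p * h3 q"
  "h1 (p * q) = h0 p * h1 q + h1 p * h0 q + h2 p * h3 q - h3 p * h2 q"
  "h2 (p * q) = h0 p * h2 q - h1 p * h3 q + h2 p * h0 q + h3 p * h1 q"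
  "h3 (p * q) = h0 p * h3 q + h1 p * h2 q - h2 p * h1 q + h3 p * h0 q"
  by (simp_all add: times_hq_def)

definition hq_scalar :: "'a::comm_ring_1 \<Rightarrow> 'a hq" where
  "hq_scalar c = Hq c 0 0 0"

definition hq_conj :: "'a::comm_ring_1 hq \<Rightarrow> 'a hq" where
  "hq_conj p = Hq (h0 p) (- h1 p) (- h2 p) (- h3 p)"

definition hq_vec :: "'a::comm_ring_1 hq \<Rightarrow> 'a hq" where
  "hq_vec p = Hq 0 (h1 p) (h2 p) (h3 p)"

definition hq_norm :: "'a::comm_ring_1 hq \<Rightarrow> 'a" where
  "hq_norm p = h0 p ^ 2 + h1 p ^ 2 + h2 p ^ 2 + h3 p ^ 2"

definition hq_dot :: "'a::comm_ring_1 hq \<Rightarrow> 'a hq \<Rightarrow> 'a" where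
  "hq_dot p q = h1 p * h1 q + h2 p * h2 q + h3 p * h3 q"

lemma hq_scalar_sel [simp]: "h0 (hq_scalar c) = c" "h1 (hq_scalar c) = 0" "h2 (hq_scalar c) = 0"
  "h3 (hq_scalar c) = 0"
  by (simp_all add: hq_scalar_def)

lemma hq_conj_sel [simp]:
  "h0 (hq_conj p) = h0 p" "h1 (hq_conj p) = - h1 p" "h2 (hq_conj p) = - h2 p" "h3 (hq_conj p) = -
    h3 p"
  by (simp_all add: hq_conj_def)

lemma hq_vec_sel [simp]: "h0 (hq_vec p) = 0" "h1 (hq_vec p) = h1 p" "h2 (hq_vec p) = h2 p" "h3
  (hq_vec p) = h3 p"
  by (simp_all add: hq_vec_def)

lemma hq_times_hq_conj: "p * hq_conj p = hq_scalar (hq_norm p)" "hq_conj p * p = hq_scalar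
  (hq_norm p)"
  by (simp_all add: hq_eq_iff hq_times_sel hq_norm_def power2_eq_square algebra_simps)

lemma hq_norm_mult: "hq_norm (p * q) = hq_norm p * hq_norm q"
  by (simp add: hq_norm_def hq_times_sel power2_eq_square algebra_simps)

lemma hq_scalar_mult [simp]: "hq_scalar (c * d) = hq_scalar c * hq_scalar d" "hq_scalar 1 = 1"
  by (simp_all add: hq_eq_iff hq_times_sel)

lemma hq_scalar_commute: "hq_scalar c * p = p * hq_scalar c"
  by (simp add: hq_eq_iff hq_times_sel mult.commute)

text \<open>Over a field in which \<open>-1\<close> is a sum of two squares the algebra is not a division algebra,
  so being invertible means having nonzero norm.\<close>

definition hq_inv :: "'a::field hq \<Rightarrow> 'a hq" where
  "hq_inv p = hq_conj p * hq_scalar (inverse (hq_norm p))"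

lemma hq_inv:
  assumes "hq_norm p \<noteq> 0"
  shows "p * hq_inv p = 1" "hq_inv p * p = 1"
proof -
  show "p * hq_inv p = 1"
    using assms
    by (simp add: hq_inv_def hq_times_hq_conj mult.assoc [symmetric] flip: hq_scalar_mult(1))
  show "hq_inv p * p = 1"
    using assms unfolding hq_inv_def hq_scalar_commute [symmetric]
    by (simp add: mult.assoc hq_times_hq_conj flip: hq_scalar_mult(1))
qed

section \<open>The Sylvester equation over a quaternion algebra\<close>

text \<open>Write \<open>N\<close> for the common norm of \<open>a\<close> and \<open>b\<close>. Then the norm of \<open>a h + h b\<close> is
  \<open>2 (N |h|\<^sup>2 + a \<cdot> (h b h\<^sup>c))\<close>, and \<open>h b h\<^sup>c\<close> is \<open>b\<close> under the Euler-Rodrigues matrix of \<open>h\<close>.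
  The four basis vectors for \<open>h\<close> give \<open>N = 0\<close> and \<open>a\<^sub>m b\<^sub>m = 0\<close>; the sums of two of them isolate
  the mixed products \<open>a\<^sub>m b\<^sub>n\<close>.\<close>

lemma zero_if_intertwiners_singular:
  fixes a b :: "'a::field_char_0 hq"
  assumes "h0 a = 0" "h0 b = 0" "hq_norm a = hq_norm b"
    and "\<And>h. h0 h \<in> {0,1} \<Longrightarrow> h1 h \<in> {0,1} \<Longrightarrow> h2 h \<in> {0,1} \<Longrightarrow> h3 h \<in> {0,1} \<Longrightarrow>
           hq_norm (a * h + h * b) = 0"
  shows "a = 0 \<or> b = 0"
proof -
  obtain a1 a2 a3 where a: "a = Hq 0 a1 a2 a3" using assms(1) by (cases a) auto
  obtain b1 b2 b3 where b: "b = Hq 0 b1 b2 b3" using assms(2) by (cases b) auto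
  define N where "N = a1^2 + a2^2 + a3^2"
  have N': "b1^2 + b2^2 + b3^2 = N" using assms(3) by (simp add: a b hq_norm_def N_def)
  have z: "hq_norm (a * Hq x y z w + Hq x y z w * b) = 0"
    if "x \<in> {0,1}" "y \<in> {0,1}" "z \<in> {0,1}" "w \<in> {0,1}" for x y z w
    using assms(4) [of "Hq x y z w"] that by simp
  \<comment> \<open>The Euler-Rodrigues formula for \<open>h = x + y i + z j + w k\<close>.\<close>
  have gen: "hq_norm (a * Hq x y z w + Hq x y z w * b) =
     2 * N * (x^2+y^2+z^2+w^2)
     + 2 * ((x^2+y^2-z^2-w^2) * a1 * b1 + (x^2-y^2+z^2-w^2) * a2 * b2 + (x^2-y^2-z^2+w^2) * a3 * b3
     + 2 * (y*z - x*w) * a1 * b2 + 2 * (y*z + x*w) * a2 * b1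
     + 2 * (y*w + x*z) * a1 * b3 + 2 * (y*w - x*z) * a3 * b1
     + 2 * (z*w - x*y) * a2 * b3 + 2 * (z*w + x*y) * a3 * b2)" for x y z w
  proof -
    have "hq_norm (a * Hq x y z w + Hq x y z w * b) =
     (N + (b1^2 + b2^2 + b3^2)) * (x^2+y^2+z^2+w^2)
     + 2 * ((x^2+y^2-z^2-w^2) * a1 * b1 + (x^2-y^2+z^2-w^2) * a2 * b2 + (x^2-y^2-z^2+w^2) * a3 * b3
     + 2 * (y*z - x*w) * a1 * b2 + 2 * (y*z + x*w) * a2 * b1
     + 2 * (y*w + x*z) * a1 * b3 + 2 * (y*w - x*z) * a3 * b1
     + 2 * (z*w - x*y) * a2 * b3 + 2 * (z*w + x*y) * a3 * b2)"
      by (simp add: N_def a b hq_norm_def hq_times_sel power2_eq_square algebra_simps)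
    then show ?thesis by (simp only: N' mult_2 [symmetric])
  qed
  have e: "2 * N + 2 * (a1 * b1 + a2 * b2 + a3 * b3) = 0" 
    "2 * N + 2 * (a1 * b1 - a2 * b2 - a3 * b3) = 0" 
    "2 * N + 2 * (a2 * b2 - a1 * b1 - a3 * b3) = 0" 
    "2 * N + 2 * (a3 * b3 - a1 * b1 - a2 * b2) = 0"
    using z[of 1 0 0 0] z[of 0 1 0 0] z[of 0 0 1 0] z[of 0 0 0 1]
    unfolding gen by (simp_all add: algebra_simps)

  have "8 * N = (2 * N + 2 * (a1 * b1 + a2 * b2 + a3 * b3)) + (2 * N + 2 * (a1 * b1 - a2 * b2 - a3
    * b3))
      + (2 * N + 2 * (a2 * b2 - a1 * b1 - a3 * b3)) + (2 * N + 2 * (a3 * b3 - a1 * b1 - a2 * b2))"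
    by (simp add: algebra_simps)
  hence N0: "N = 0" unfolding e by simp
  have "4 * (a1 * b1) = (2 * N + 2 * (a1 * b1 + a2 * b2 + a3 * b3)) + (2 * N + 2 * (a1 * b1 - a2 *
    b2 - a3 * b3))"
       "4 * (a2 * b2) = (2 * N + 2 * (a1 * b1 + a2 * b2 + a3 * b3)) + (2 * N + 2 * (a2 * b2 - a1 *
         b1 - a3 * b3))"
       "4 * (a3 * b3) = (2 * N + 2 * (a1 * b1 + a2 * b2 + a3 * b3)) + (2 * N + 2 * (a3 * b3 - a1 *
         b1 - a2 * b2))"
    by (simp_all add: N0 algebra_simps)
  hence d: "a1 * b1 = 0" "a2 * b2 = 0" "a3 * b3 = 0" unfolding e by simp_all
  have gen0: "hq_norm (a * Hq x y z w + Hq x y z w * b) =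
     4 * ((y*z - x*w) * (a1 * b2) + (y*z + x*w) * (a2 * b1) + (y*w + x*z) * (a1 * b3)
        + (y*w - x*z) * (a3 * b1) + (z*w - x*y) * (a2 * b3) + (z*w + x*y) * (a3 * b2))" for x y z w
    unfolding gen N0 by (simp only: mult.assoc d) (simp add: algebra_simps)
  have cross: "p = 0" "q = 0" if "p + q = 0" "q - p = 0" for p q :: 'a
    using that by (simp_all add: eq_neg_iff_add_eq_0)
  have "a1 * b2 = 0" "a2 * b1 = 0"
    by (rule cross[of "a1 * b2" "a2 * b1"]; use z[of 0 1 1 0] z[of 1 0 0 1] in \<open>simp add: gen0\<close>)+
  moreover have "a3 * b1 = 0" "a1 * b3 = 0"
    by (rule cross[of "a3 * b1" "a1 * b3"]; use z[of 0 1 0 1] z[of 1 0 1 0] in \<open>simp add: gen0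
      add.commute\<close>)+
  moreover have "a2 * b3 = 0" "a3 * b2 = 0" 
    by (rule cross[of "a2 * b3" "a3 * b2"]; use z[of 0 0 1 1] z[of 1 1 0 0] in \<open>simp add: gen0\<close>)+
  ultimately show ?thesis using d by (auto simp: hq_eq_iff a b)
qed

locale subfield_set =
  fixes K :: "'a::field_char_0 set"
  assumes zero_K: "0 \<in> K" and one_K: "1 \<in> K"
    and add_K: "x \<in> K \<Longrightarrow> y \<in> K \<Longrightarrow> x + y \<in> K"
    and uminus_K: "x \<in> K \<Longrightarrow> - x \<in> K"
    and mult_K: "x \<in> K \<Longrightarrow> y \<in> K \<Longrightarrow> x * y \<in> K"
    and inverse_K: "x \<in> K \<Longrightarrow> inverse x \<in> K"
begin

lemma diff_K: "x \<in> K \<Longrightarrow> y \<in> K \<Longrightarrow> x - y \<in> K"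
  using add_K [OF _ uminus_K] by fastforce

lemma divide_K: "x \<in> K \<Longrightarrow> y \<in> K \<Longrightarrow> x / y \<in> K"
  by (simp add: divide_inverse mult_K inverse_K)

lemmas K_closed = zero_K one_K add_K uminus_K mult_K inverse_K diff_K divide_K

definition K_quats :: "'a hq set" where
  "K_quats = {p. h0 p \<in> K \<and> h1 p \<in> K \<and> h2 p \<in> K \<and> h3 p \<in> K}"

lemma K_quats_closed:
  "p \<in> K_quats \<Longrightarrow> q \<in> K_quats \<Longrightarrow> p + q \<in> K_quats" "p \<in> K_quats \<Longrightarrow> q \<in> K_quats \<Longrightarrow> p - q \<in> K_quats"
  "p \<in> K_quats \<Longrightarrow> - p \<in> K_quats" "p \<in> K_quats \<Longrightarrow> q \<in> K_quats \<Longrightarrow> p * q \<in> K_quats"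
  "0 \<in> K_quats" "1 \<in> K_quats" "p \<in> K_quats \<Longrightarrow> hq_conj p \<in> K_quats" "p \<in> K_quats \<Longrightarrow> hq_vec p \<in> K_quats"
  "c \<in> K \<Longrightarrow> hq_scalar c \<in> K_quats"
  by (auto simp: K_quats_def hq_times_sel K_closed)

lemma hq_norm_K: "p \<in> K_quats \<Longrightarrow> hq_norm p \<in> K"
  by (auto simp: K_quats_def hq_norm_def power2_eq_square K_closed)

lemma hq_inv_K: "p \<in> K_quats \<Longrightarrow> hq_inv p \<in> K_quats"
  by (simp add: hq_inv_def K_quats_closed hq_norm_K inverse_K)

text \<open>Since \<open>a\<^sup>2 = b\<^sup>2\<close> is a scalar, \<open>a (a h + h b) = (a h + h b) b\<close> for every \<open>h\<close>, so it
  suffices that some \<open>a h + h b\<close> is invertible.\<close>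

lemma exists_invertible_intertwiner:
  assumes "a \<in> K_quats" "b \<in> K_quats" "h0 a = 0" "h0 b = 0" "a \<noteq> 0" "b \<noteq> 0" "hq_norm a = hq_norm b"
  obtains u where "u \<in> K_quats" "hq_norm u \<noteq> 0" "a * u = u * b"
proof -
  obtain h where h: "hq_norm (a * h + h * b) \<noteq> 0"
      "h0 h \<in> {0,1}" "h1 h \<in> {0,1}" "h2 h \<in> {0,1}" "h3 h \<in> {0,1}"
    using zero_if_intertwiners_singular [of a b] assms by blast
  have hK: "h \<in> K_quats" using h(2-5) by (auto simp: K_quats_def K_closed)
  have sq: "p * p = - hq_scalar (hq_norm p)" if "h0 p = 0" for p :: "'a hq"
    using that by (simp add: hq_eq_iff hq_times_sel hq_norm_def power2_eq_square)
  have "a * (a * h + h * b) = a * a * h + a * h * b"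
    by (simp add: algebra_simps)
  also have "\<dots> = h * (b * b) + a * h * b"
    using sq [OF assms(3)] sq [OF assms(4)] assms(7) by (simp add: hq_scalar_commute)
  also have "\<dots> = (a * h + h * b) * b"
    by (simp add: algebra_simps)
  finally show ?thesis
    using that [of "a * h + h * b"] h(1) hK assms(1,2) by (simp add: K_quats_closed)
qed

text \<open>The plane orthogonal to \<open>(a1, a2, a3)\<close>, if \<open>a1 \<noteq> 0\<close>, is spanned by \<open>(-a2, a1, 0)\<close> and
  \<open>(-a3, 0, a1)\<close>. The norm form does not vanish identically on it: if both vectors have norm 0,
  then \<open>a2\<^sup>2 = a3\<^sup>2 = - a1\<^sup>2\<close>, so their inner product \<open>a2 a3\<close> is not 0. In characteristic 0 a
  binary quadratic form that is not identically 0 has a basis of vectors on which it does not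
  vanish; here one can be found among the two vectors, their sum and their difference.\<close>

lemma anisotropic_plane_basis_coords:
  assumes K: "a1 \<in> K" "a2 \<in> K" "a3 \<in> K" and a1: "a1 \<noteq> 0"
  obtains p1 p2 p3 r1 r2 r3 where
    "p1 \<in> K" "p2 \<in> K" "p3 \<in> K" "r1 \<in> K" "r2 \<in> K" "r3 \<in> K"
    "a1 * p1 + a2 * p2 + a3 * p3 = 0" "a1 * r1 + a2 * r2 + a3 * r3 = 0"
    "p1^2 + p2^2 + p3^2 \<noteq> 0" "r1^2 + r2^2 + r3^2 \<noteq> 0"
    "\<And>s t. s * p1 + t * r1 = 0 \<Longrightarrow> s * p2 + t * r2 = 0 \<Longrightarrow> s * p3 + t * r3 = 0 \<Longrightarrow> s = 0 \<and> t = 0"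
    "\<And>w1 w2 w3. w1 \<in> K \<Longrightarrow> w2 \<in> K \<Longrightarrow> w3 \<in> K \<Longrightarrow> a1 * w1 + a2 * w2 + a3 * w3 = 0 \<Longrightarrow>
       \<exists>s\<in>K. \<exists>t\<in>K. w1 = s * p1 + t * r1 \<and> w2 = s * p2 + t * r2 \<and> w3 = s * p3 + t * r3"
proof -
  \<comment> \<open>The pair \<open>(p, r)\<close> stands for the vector \<open>(- (p a2 + r a3), p a1, r a1)\<close> orthogonal to
    \<open>(a1, a2, a3)\<close>; the conditions say that the two vectors are independent and have nonzero
    norm.\<close>
  define ok where "ok = (\<lambda>p r p' r'. p \<in> K \<and> r \<in> K \<and> p' \<in> K \<and> r' \<in> K \<and> p * r' - r * p' \<noteq> 0 \<and>
     (p * a2 + r * a3)^2 + (p^2 + r^2) * a1^2 \<noteq> 0 \<and> (p' * a2 + r' * a3)^2 + (p'^2 + r'^2) * a1^2 \<noteq>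
       0)"
  have ex: "\<exists>p r p' r'. ok p r p' r'"
  proof (cases "a2^2 + a1^2 = 0")
    case True
    then have a2: "a2^2 = - (a1^2)" by (simp add: eq_neg_iff_add_eq_0)
    show ?thesis
    proof (cases "a3^2 + a1^2 = 0")
      case True
      then have a3: "a3^2 = - (a1^2)" by (simp add: eq_neg_iff_add_eq_0)
      have "ok 1 1 1 (-1)"
        unfolding ok_def using a1 a2 a3 
        by (auto simp: K_closed power2_sum power2_diff)
      then show ?thesis by blast
    next
      case False
      have "ok 0 1 1 0 \<or> ok 0 1 1 1 \<or> ok 0 1 1 (-1)"
      proof (rule ccontr)
        assume *: "\<not> ?thesis"
        have n: "(a2 + a3)^2 + (1 + 1) * a1^2 = 0" "(a2 - a3)^2 + (1 + 1) * a1^2 = 0"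
          using * False True by (auto simp: ok_def K_closed power2_commute)
        have e: "2 * (a3^2 + a1^2) = ((a2 + a3)^2 + (1 + 1) * a1^2) + ((a2 - a3)^2 + (1 + 1) *
          a1^2) - 2 * (a2^2 + a1^2)"
          by (simp add: power2_sum power2_diff algebra_simps)
        have "2 * (a3^2 + a1^2) = 0" by (simp only: e n True) simp
        then show False by (simp only: mult_eq_0_iff False) simp
      qed
      then show ?thesis by blast
    qed
  next
    case False
    have "ok 1 0 0 1 \<or> ok 1 0 1 1 \<or> ok 1 0 (-1) 1"
    proof (rule ccontr)
      assume *: "\<not> ?thesis"
      have n: "(a2 + a3)^2 + (1 + 1) * a1^2 = 0" "(a2 - a3)^2 + (1 + 1) * a1^2 = 0" "a3^2 + a1^2 =
        0"
        using * False by (auto simp: ok_def K_closed power2_commute)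
      have e: "2 * (a2^2 + a1^2) = ((a2 + a3)^2 + (1 + 1) * a1^2) + ((a2 - a3)^2 + (1 + 1) * a1^2)
        - 2 * (a3^2 + a1^2)"
        by (simp add: power2_sum power2_diff algebra_simps)
      have "2 * (a2^2 + a1^2) = 0" by (simp only: e n) simp
      then show False by (simp only: mult_eq_0_iff False) simp
    qed
    then show ?thesis by blast
  qed
  then obtain p r p' r' where ok: "ok p r p' r'" by blast
  define d where "d = p * r' - r * p'"
  have d: "d \<noteq> 0" and K': "p \<in> K" "r \<in> K" "p' \<in> K" "r' \<in> K" "d \<in> K"
    using ok by (auto simp: ok_def d_def K_closed)
  show ?thesis
  proof (rule that [of "- (p * a2 + r * a3)" "p * a1" "r * a1" "- (p' * a2 + r' * a3)" "p' * a1"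
    "r' * a1"])
    fix s t
    assume "s * (p * a1) + t * (p' * a1) = 0" "s * (r * a1) + t * (r' * a1) = 0"
    then have st: "s * p + t * p' = 0" "s * r + t * r' = 0"
    proof -
      have "(s * p + t * p') * a1 = s * (p * a1) + t * (p' * a1)" "(s * r + t * r') * a1 = s * (r
        * a1) + t * (r' * a1)"
        by (simp_all add: distrib_right mult.assoc)
      with \<open>s * (p * a1) + t * (p' * a1) = 0\<close> \<open>s * (r * a1) + t * (r' * a1) = 0\<close> a1
      show "s * p + t * p' = 0" "s * r + t * r' = 0" by simp_all
    qed
    have "s * d = (s * p + t * p') * r' - (s * r + t * r') * p'"
         "t * d = (s * r + t * r') * p - (s * p + t * p') * r"
      by (simp_all add: d_def algebra_simps)
    then show "s = 0 \<and> t = 0" using d unfolding st by simp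
  next
    fix w1 w2 w3 
    assume w: "w1 \<in> K" "w2 \<in> K" "w3 \<in> K" "a1 * w1 + a2 * w2 + a3 * w3 = 0"
    \<comment> \<open>Cramer's rule for the second and third coordinates; the first one follows from
      orthogonality.\<close>
    define s where "s = (w2 * r' - w3 * p') / (d * a1)"
    define t where "t = (w3 * p - w2 * r) / (d * a1)"
    have sa: "s * a1 = (w2 * r' - w3 * p') / d" "t * a1 = (w3 * p - w2 * r) / d"
      using a1 by (simp_all add: s_def t_def)
    have w23: "w2 = s * (p * a1) + t * (p' * a1)" "w3 = s * (r * a1) + t * (r' * a1)"
    proof -
      have "s * (p * a1) + t * (p' * a1) = (s * a1) * p + (t * a1) * p'"
        by (simp only: mult_ac)
      also have "\<dots> = ((w2 * r' - w3 * p') * p + (w3 * p - w2 * r) * p') / d"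
        unfolding sa by (simp add: add_divide_distrib)
      also have "(w2 * r' - w3 * p') * p + (w3 * p - w2 * r) * p' = w2 * d"
        by (simp add: d_def algebra_simps)
      finally show "w2 = s * (p * a1) + t * (p' * a1)" using d by simp
      have "s * (r * a1) + t * (r' * a1) = (s * a1) * r + (t * a1) * r'"
        by (simp only: mult_ac)
      also have "\<dots> = ((w2 * r' - w3 * p') * r + (w3 * p - w2 * r) * r') / d"
        unfolding sa by (simp add: add_divide_distrib)
      also have "(w2 * r' - w3 * p') * r + (w3 * p - w2 * r) * r' = w3 * d"
        by (simp add: d_def algebra_simps)
      finally show "w3 = s * (r * a1) + t * (r' * a1)" using d by simp
    qed
    have w1: "w1 = s * - (p * a2 + r * a3) + t * - (p' * a2 + r' * a3)"
    proof -
      have "a1 * w1 = - (a2 * w2 + a3 * w3)"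
        using w(4) by (simp only: eq_neg_iff_add_eq_0 add.assoc)
      also have "\<dots> = a1 * (s * - (p * a2 + r * a3) + t * - (p' * a2 + r' * a3))"
        unfolding w23 by (simp add: algebra_simps)
      finally show ?thesis using a1 by simp
    qed
    have st: "s \<in> K" "t \<in> K"
      using K' K w by (auto simp: s_def t_def K_closed)
    show "\<exists>s\<in>K. \<exists>t\<in>K. w1 = s * - (p * a2 + r * a3) + t * - (p' * a2 + r' * a3) \<and>
       w2 = s * (p * a1) + t * (p' * a1) \<and> w3 = s * (r * a1) + t * (r' * a1)"
      using w1 w23 st by blast
  next
    have "(- (x * a2 + y * a3))^2 + (x * a1)^2 + (y * a1)^2 = (x * a2 + y * a3)^2 + (x^2 + y^2) *
      a1^2" for x y
      by (simp only: power2_minus power_mult_distrib distrib_right add.assoc)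
    then show "(- (p * a2 + r * a3))^2 + (p * a1)^2 + (r * a1)^2 \<noteq> 0"
      "(- (p' * a2 + r' * a3))^2 + (p' * a1)^2 + (r' * a1)^2 \<noteq> 0"
      using ok by (simp_all only: ok_def) blast+
  next
    show "a1 * - (p * a2 + r * a3) + a2 * (p * a1) + a3 * (r * a1) = 0"
      "a1 * - (p' * a2 + r' * a3) + a2 * (p' * a1) + a3 * (r' * a1) = 0"
      by (simp_all add: algebra_simps)
  qed (simp_all only: K K' K_closed)
qed

text \<open>Some coordinate of \<open>a\<close> is nonzero, and a cyclic permutation of the coordinates makes it
  the first one.\<close>

lemma anisotropic_plane_basis:
  assumes "a \<in> K_quats" "h0 a = 0" "a \<noteq> 0"
  obtains p r where "p \<in> K_quats" "r \<in> K_quats" "h0 p = 0" "h0 r = 0" "hq_dot a p = 0" "hq_dot a r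
    = 0"
    "hq_norm p \<noteq> 0" "hq_norm r \<noteq> 0"
    "\<And>s t. hq_scalar s * p + hq_scalar t * r = 0 \<Longrightarrow> s = 0 \<and> t = 0"
    "\<And>w. w \<in> K_quats \<Longrightarrow> h0 w = 0 \<Longrightarrow> hq_dot a w = 0 \<Longrightarrow> \<exists>s\<in>K. \<exists>t\<in>K. w = hq_scalar s * p + hq_scalar t *
      r"
proof -
  have K: "h1 a \<in> K" "h2 a \<in> K" "h3 a \<in> K" using assms(1) by (auto simp: K_quats_def)
  consider "h1 a \<noteq> 0" | "h2 a \<noteq> 0" | "h3 a \<noteq> 0" using assms(2,3) by (auto simp: hq_eq_iff)
  then show ?thesis
  proof cases
    case 1
    show ?thesis
    proof (rule anisotropic_plane_basis_coords [OF K 1])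
      fix p1 p2 p3 r1 r2 r3
      assume *: "p1 \<in> K" "p2 \<in> K" "p3 \<in> K" "r1 \<in> K" "r2 \<in> K" "r3 \<in> K"
          "h1 a * p1 + h2 a * p2 + h3 a * p3 = 0" "h1 a * r1 + h2 a * r2 + h3 a * r3 = 0"
          "p1^2 + p2^2 + p3^2 \<noteq> 0" "r1^2 + r2^2 + r3^2 \<noteq> 0"
        and indep: "\<And>s t. s * p1 + t * r1 = 0 \<Longrightarrow> s * p2 + t * r2 = 0 \<Longrightarrow> s * p3 + t * r3 = 0 \<Longrightarrow>
          s = 0 \<and> t = 0"
        and span: "\<And>w1 w2 w3. w1 \<in> K \<Longrightarrow> w2 \<in> K \<Longrightarrow> w3 \<in> K \<Longrightarrow>
          h1 a * w1 + h2 a * w2 + h3 a * w3 = 0 \<Longrightarrow>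
          \<exists>s\<in>K. \<exists>t\<in>K. w1 = s * p1 + t * r1 \<and> w2 = s * p2 + t * r2 \<and> w3 = s * p3 + t * r3"
      show ?thesis
      proof (rule that [of "Hq 0 p1 p2 p3" "Hq 0 r1 r2 r3"])
        show "\<exists>s\<in>K. \<exists>t\<in>K. w = hq_scalar s * Hq 0 p1 p2 p3 + hq_scalar t * Hq 0 r1 r2 r3"
          if "w \<in> K_quats" "h0 w = 0" "hq_dot a w = 0" for w
        proof -
          have "h1 w \<in> K" "h2 w \<in> K" "h3 w \<in> K" "h1 a * h1 w + h2 a * h2 w + h3 a * h3 w = 0"
            using that by (simp_all add: K_quats_def hq_dot_def)
          then obtain s t where "s \<in> K" "t \<in> K" "h1 w = s * p1 + t * r1" "h2 w = s * p2 + t * r2"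
            "h3 w = s * p3 + t * r3"
            using span [of "h1 w" "h2 w" "h3 w"] by (auto simp only: add_ac)
          then show ?thesis
            using that(2) by (intro bexI [of _ s] bexI [of _ t]) (simp_all add: hq_eq_iff
              hq_times_sel)
        qed
        show "s = 0 \<and> t = 0" if "hq_scalar s * Hq 0 p1 p2 p3 + hq_scalar t * Hq 0 r1 r2 r3 = 0"
          for s t
          by (rule indep) (use that in \<open>simp_all add: hq_eq_iff hq_times_sel\<close>)
      qed (use * in \<open>simp_all add: K_quats_def hq_dot_def hq_norm_def zero_K add_ac\<close>)
    qed
  next
    case 2
    show ?thesis
    proof (rule anisotropic_plane_basis_coords [OF K(2,3,1) 2])
      fix p1 p2 p3 r1 r2 r3
      assume *: "p1 \<in> K" "p2 \<in> K" "p3 \<in> K" "r1 \<in> K" "r2 \<in> K" "r3 \<in> K"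
          "h2 a * p1 + h3 a * p2 + h1 a * p3 = 0" "h2 a * r1 + h3 a * r2 + h1 a * r3 = 0"
          "p1^2 + p2^2 + p3^2 \<noteq> 0" "r1^2 + r2^2 + r3^2 \<noteq> 0"
        and indep: "\<And>s t. s * p1 + t * r1 = 0 \<Longrightarrow> s * p2 + t * r2 = 0 \<Longrightarrow> s * p3 + t * r3 = 0 \<Longrightarrow>
          s = 0 \<and> t = 0"
        and span: "\<And>w1 w2 w3. w1 \<in> K \<Longrightarrow> w2 \<in> K \<Longrightarrow> w3 \<in> K \<Longrightarrow>
          h2 a * w1 + h3 a * w2 + h1 a * w3 = 0 \<Longrightarrow>
          \<exists>s\<in>K. \<exists>t\<in>K. w1 = s * p1 + t * r1 \<and> w2 = s * p2 + t * r2 \<and> w3 = s * p3 + t * r3"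
      show ?thesis
      proof (rule that [of "Hq 0 p3 p1 p2" "Hq 0 r3 r1 r2"])
        show "\<exists>s\<in>K. \<exists>t\<in>K. w = hq_scalar s * Hq 0 p3 p1 p2 + hq_scalar t * Hq 0 r3 r1 r2"
          if "w \<in> K_quats" "h0 w = 0" "hq_dot a w = 0" for w
        proof -
          have "h1 w \<in> K" "h2 w \<in> K" "h3 w \<in> K" "h1 a * h1 w + h2 a * h2 w + h3 a * h3 w = 0"
            using that by (simp_all add: K_quats_def hq_dot_def)
          then obtain s t where "s \<in> K" "t \<in> K" "h2 w = s * p1 + t * r1" "h3 w = s * p2 + t * r2"
            "h1 w = s * p3 + t * r3"
            using span [of "h2 w" "h3 w" "h1 w"] by (auto simp only: add_ac)
          then show ?thesis
            using that(2) by (intro bexI [of _ s] bexI [of _ t]) (simp_all add: hq_eq_iff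
              hq_times_sel)
        qed
        show "s = 0 \<and> t = 0" if "hq_scalar s * Hq 0 p3 p1 p2 + hq_scalar t * Hq 0 r3 r1 r2 = 0"
          for s t
          by (rule indep) (use that in \<open>simp_all add: hq_eq_iff hq_times_sel\<close>)
      qed (use * in \<open>simp_all add: K_quats_def hq_dot_def hq_norm_def zero_K add_ac\<close>)
    qed
  next
    case 3
    show ?thesis
    proof (rule anisotropic_plane_basis_coords [OF K(3,1,2) 3])
      fix p1 p2 p3 r1 r2 r3
      assume *: "p1 \<in> K" "p2 \<in> K" "p3 \<in> K" "r1 \<in> K" "r2 \<in> K" "r3 \<in> K"
          "h3 a * p1 + h1 a * p2 + h2 a * p3 = 0" "h3 a * r1 + h1 a * r2 + h2 a * r3 = 0"
          "p1^2 + p2^2 + p3^2 \<noteq> 0" "r1^2 + r2^2 + r3^2 \<noteq> 0"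
        and indep: "\<And>s t. s * p1 + t * r1 = 0 \<Longrightarrow> s * p2 + t * r2 = 0 \<Longrightarrow> s * p3 + t * r3 = 0 \<Longrightarrow>
          s = 0 \<and> t = 0"
        and span: "\<And>w1 w2 w3. w1 \<in> K \<Longrightarrow> w2 \<in> K \<Longrightarrow> w3 \<in> K \<Longrightarrow>
          h3 a * w1 + h1 a * w2 + h2 a * w3 = 0 \<Longrightarrow>
          \<exists>s\<in>K. \<exists>t\<in>K. w1 = s * p1 + t * r1 \<and> w2 = s * p2 + t * r2 \<and> w3 = s * p3 + t * r3"
      show ?thesis
      proof (rule that [of "Hq 0 p2 p3 p1" "Hq 0 r2 r3 r1"])
        show "\<exists>s\<in>K. \<exists>t\<in>K. w = hq_scalar s * Hq 0 p2 p3 p1 + hq_scalar t * Hq 0 r2 r3 r1"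
          if "w \<in> K_quats" "h0 w = 0" "hq_dot a w = 0" for w
        proof -
          have "h1 w \<in> K" "h2 w \<in> K" "h3 w \<in> K" "h1 a * h1 w + h2 a * h2 w + h3 a * h3 w = 0"
            using that by (simp_all add: K_quats_def hq_dot_def)
          then obtain s t where "s \<in> K" "t \<in> K" "h3 w = s * p1 + t * r1" "h1 w = s * p2 + t * r2"
            "h2 w = s * p3 + t * r3"
            using span [of "h3 w" "h1 w" "h2 w"] by (auto simp only: add_ac)
          then show ?thesis
            using that(2) by (intro bexI [of _ s] bexI [of _ t]) (simp_all add: hq_eq_iff
              hq_times_sel)
        qed
        show "s = 0 \<and> t = 0" if "hq_scalar s * Hq 0 p2 p3 p1 + hq_scalar t * Hq 0 r2 r3 r1 = 0"
          for s t
          by (rule indep) (use that in \<open>simp_all add: hq_eq_iff hq_times_sel\<close>)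
      qed (use * in \<open>simp_all add: K_quats_def hq_dot_def hq_norm_def zero_K add_ac\<close>)
    qed
  qed
qed

text \<open>Adding a multiple of \<open>a\<close> to \<open>v\<close> does not change \<open>a \<times> v\<close>, so if \<open>a1 \<noteq> 0\<close> the equation
  \<open>2 (a \<times> v) = w\<close> may be solved with \<open>v = (0, x, y)\<close>. The last two coordinates determine \<open>x\<close> and
  \<open>y\<close>, and the first one then holds by orthogonality.\<close>

lemma cross_product_solution:
  assumes K: "a1 \<in> K" "w2 \<in> K" "w3 \<in> K" and "a1 \<noteq> 0" "a1 * w1 + a2 * w2 + a3 * w3 = 0"
  obtains x y where "x \<in> K" "y \<in> K"
    "2 * (a2 * y - a3 * x) = w1" "2 * (a1 * x) = w3" "2 * (a1 * y) = - w2"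
proof
  define x where "x = w3 / (2 * a1)"
  define y where "y = - (w2 / (2 * a1))"
  have "2 \<in> K" using add_K [OF one_K one_K] by simp
  then show "x \<in> K" "y \<in> K" using K by (simp_all add: x_def y_def K_closed)
  show x: "2 * (a1 * x) = w3" and y: "2 * (a1 * y) = - w2"
    using assms(4) by (simp_all add: x_def y_def)
  have "a1 * (2 * (a2 * y - a3 * x)) = a2 * (2 * (a1 * y)) - a3 * (2 * (a1 * x))"
    by (simp add: algebra_simps)
  also have "\<dots> = - (a2 * w2 + a3 * w3)"
    unfolding x y by simp
  also have "\<dots> = a1 * w1"
    using assms(5) by (simp only: neg_eq_iff_add_eq_0 add_ac)
  finally show "2 * (a2 * y - a3 * x) = w1" using assms(4) by simp
qed

text \<open>The commutator of \<open>a\<close> and \<open>v\<close> is twice their cross product, and \<open>a \<times> v = w\<close> is solvable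
  whenever \<open>w\<close> is orthogonal to \<open>a \<noteq> 0\<close>, even if \<open>a\<close> is isotropic.\<close>

lemma orthogonal_is_commutator:
  assumes "a \<in> K_quats" "h0 a = 0" "a \<noteq> 0" "w \<in> K_quats" "h0 w = 0" "hq_dot a w = 0"
  obtains v where "v \<in> K_quats" "a * v - v * a = w"
proof -
  have K: "h1 a \<in> K" "h2 a \<in> K" "h3 a \<in> K" "h1 w \<in> K" "h2 w \<in> K" "h3 w \<in> K" "2 \<in> K"
    using assms(1,4) add_K [OF one_K one_K] by (auto simp: K_quats_def)
  have dot: "h1 a * h1 w + h2 a * h2 w + h3 a * h3 w = 0" "h2 a * h2 w + h3 a * h3 w + h1 a * h1 w
    = 0"
     "h3 a * h3 w + h1 a * h1 w + h2 a * h2 w = 0" using assms(6) by (simp_all add: hq_dot_def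
       add_ac)
  have comm: "a * v - v * a = Hq 0 (2 * (h2 a * h3 v - h3 a * h2 v)) (2 * (h3 a * h1 v - h1 a * h3
    v))
      (2 * (h1 a * h2 v - h2 a * h1 v))" for v
    by (simp add: hq_eq_iff hq_times_sel algebra_simps)
  consider "h1 a \<noteq> 0" | "h2 a \<noteq> 0" | "h3 a \<noteq> 0" using assms(2,3) by (auto simp: hq_eq_iff)
  then show ?thesis
  proof cases
    case 1
    obtain x y where "x \<in> K" "y \<in> K" and
      "2 * (h2 a * y - h3 a * x) = h1 w" "2 * (h1 a * x) = h3 w" "2 * (h1 a * y) = - h2 w"
      using cross_product_solution [OF K(1,5,6) 1 dot(1)] .
    then show ?thesis
      using assms(5) by (intro that [of "Hq 0 0 x y"]) (simp_all add: comm K_quats_def zero_K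
        hq_eq_iff)
  next
    case 2
    obtain x y where "x \<in> K" "y \<in> K" and
      "2 * (h3 a * y - h1 a * x) = h2 w" "2 * (h2 a * x) = h1 w" "2 * (h2 a * y) = - h3 w"
      using cross_product_solution [OF K(2,6,4) 2 dot(2)] .
    then show ?thesis
      using assms(5) by (intro that [of "Hq 0 y 0 x"]) (simp_all add: comm K_quats_def zero_K
        hq_eq_iff)
  next
    case 3
    obtain x y where "x \<in> K" "y \<in> K" and
      "2 * (h1 a * y - h2 a * x) = h3 w" "2 * (h3 a * x) = h2 w" "2 * (h3 a * y) = - h1 w"
      using cross_product_solution [OF K(3,4,5) 3 dot(3)] .
    then show ?thesis
      using assms(5) by (intro that [of "Hq 0 x y 0"]) (simp_all add: comm K_quats_def zero_K
        hq_eq_iff)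
  qed
qed

text \<open>The scalar part of the anticommutator is \<open>- 2 (a \<cdot> x)\<close>, its vector part is \<open>2 x\<^sub>0 a\<close>.\<close>

lemma anticommutator_zero_iff:
  fixes a x :: "'a hq"
  assumes "h0 a = 0" "a \<noteq> 0"
  shows "a * x + x * a = 0 \<longleftrightarrow> h0 x = 0 \<and> hq_dot a x = 0"
proof -
  have "a * x + x * a = Hq (- (2 * hq_dot a x)) (2 * h0 x * h1 a) (2 * h0 x * h2 a) (2 * h0 x * h3
    a)"
    using assms(1) by (simp add: hq_eq_iff hq_times_sel hq_dot_def algebra_simps)
  then show ?thesis
    using assms by (auto simp: hq_eq_iff)
qed

text \<open>The scalar parts of \<open>f\<close> and \<open>g\<close> cancel, so only their vector parts \<open>a\<close> and \<open>b\<close> matter.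
  With an invertible \<open>u\<close> such that \<open>a u = u b\<close> and \<open>x = y u\<close>, the equation \<open>a x + x b = 0\<close>
  becomes \<open>(a y + y a) u = 0\<close>, and the elements \<open>a h - h b\<close> become \<open>(a v - v a) u\<close>.\<close>

theorem sylvester_kernel:
  assumes f: "f \<in> K_quats" "hq_vec f \<noteq> 0" and g: "g \<in> K_quats" "hq_vec g \<noteq> 0"
    and "h0 f = - h0 g" and "hq_norm (hq_vec f) = hq_norm (hq_vec g)"
  shows "{x \<in> K_quats. f * x + x * g = 0} = {f * h + h * hq_conj g | h. h \<in> K_quats}"
    and "\<exists>u1\<in>K_quats. \<exists>u2\<in>K_quats. hq_norm u1 \<noteq> 0 \<and> hq_norm u2 \<noteq> 0 \<and>
           (\<forall>s t. hq_scalar s * u1 + hq_scalar t * u2 = 0 \<longrightarrow> s = 0 \<and> t = 0) \<and>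
           {x \<in> K_quats. f * x + x * g = 0} = {hq_scalar s * u1 + hq_scalar t * u2 | s t. s \<in> K \<and>
             t \<in> K}"
proof -
  define a b where "a = hq_vec f" and "b = hq_vec g"
  have a: "a \<in> K_quats" "h0 a = 0" "a \<noteq> 0" and b: "b \<in> K_quats" "h0 b = 0" "b \<noteq> 0" 
    using f g by (simp_all add: a_def b_def K_quats_closed)
  obtain u where u: "u \<in> K_quats" "hq_norm u \<noteq> 0" "a * u = u * b"
    using exists_invertible_intertwiner [of a b] a b assms(6) unfolding a_def b_def by blast
  note inv = hq_inv [OF u(2)]
  have red: "f * x + x * g = a * x + x * b" "f * x + x * hq_conj g = a * x - x * b" for x
    using assms(5) by (simp_all add: a_def b_def hq_eq_iff hq_times_sel algebra_simps)
  have conj: "a * (x * u) + (x * u) * b = (a * x + x * a) * u" "a * (x * u) - (x * u) * b = (a * x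
    - x * a) * u" for x
  proof -
    have "(x * u) * b = x * a * u" by (simp add: mult.assoc u(3))
    then show "a * (x * u) + (x * u) * b = (a * x + x * a) * u" "a * (x * u) - (x * u) * b = (a *
      x - x * a) * u"
      by (simp_all add: algebra_simps)
  qed
  have cancel: "x * hq_inv u * u = x" "x * u * hq_inv u = x" for x
    by (simp_all add: mult.assoc inv)
  have ker: "{x \<in> K_quats. f * x + x * g = 0} = {y * u | y. y \<in> K_quats \<and> h0 y = 0 \<and> hq_dot a y =
    0}" (is "?L = ?R")
  proof (intro equalityI subsetI)
    fix x assume x: "x \<in> ?L"
    define y where "y = x * hq_inv u"
    have "y \<in> K_quats" using x u by (simp add: y_def K_quats_closed hq_inv_K)
    have xy: "x = y * u" by (simp add: y_def cancel)
    have "f * x + x * g = 0" using x by simp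
    then have "(a * y + y * a) * u = 0" unfolding red xy conj .
    then have "a * y + y * a = 0" using cancel(2) by (metis mult_zero_left)
    then show "x \<in> ?R" using xy \<open>y \<in> K_quats\<close> by (auto simp: anticommutator_zero_iff a)
  next
    fix x assume "x \<in> ?R"
    then obtain y where y: "x = y * u" "y \<in> K_quats" "h0 y = 0" "hq_dot a y = 0" by blast
    then show "x \<in> ?L"
      using u(1) anticommutator_zero_iff [OF a(2,3), of y] by (simp add: red conj K_quats_closed)
  qed
  show "{x \<in> K_quats. f * x + x * g = 0} = {f * h + h * hq_conj g | h. h \<in> K_quats}"
  proof (intro equalityI subsetI)
    fix x assume "x \<in> {x \<in> K_quats. f * x + x * g = 0}"
    then obtain y where y: "x = y * u" "y \<in> K_quats" "h0 y = 0" "hq_dot a y = 0" unfolding ker by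
      blast
    obtain v where v: "v \<in> K_quats" "a * v - v * a = y"
      using orthogonal_is_commutator [OF a y(2-4)] .
    have "x = f * (v * u) + (v * u) * hq_conj g" unfolding red conj v(2) y(1) ..
    then show "x \<in> {f * h + h * hq_conj g | h. h \<in> K_quats}" using v(1) u(1) K_quats_closed(4) by
      blast
  next
    fix x assume "x \<in> {f * h + h * hq_conj g | h. h \<in> K_quats}"
    then obtain h where h: "h \<in> K_quats" "x = f * h + h * hq_conj g" by blast
    define v where "v = h * hq_inv u"
    have v: "h = v * u" by (simp add: v_def cancel)
    have "x = (a * v - v * a) * u" using h(2) unfolding red v conj .
    moreover have "a * v - v * a \<in> K_quats" using h(1) u a by (simp add: v_def K_quats_closed
      hq_inv_K)
    moreover have "h0 (a * v - v * a) = 0" "hq_dot a (a * v - v * a) = 0"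
      by (simp_all add: hq_dot_def hq_times_sel algebra_simps)
    ultimately show "x \<in> {x \<in> K_quats. f * x + x * g = 0}" unfolding ker by blast
  qed
  obtain p r where pr: "p \<in> K_quats" "r \<in> K_quats" "h0 p = 0" "h0 r = 0" "hq_dot a p = 0" "hq_dot
    a r = 0"
    "hq_norm p \<noteq> 0" "hq_norm r \<noteq> 0"
    "\<And>s t. hq_scalar s * p + hq_scalar t * r = 0 \<Longrightarrow> s = 0 \<and> t = 0"
    "\<And>w. w \<in> K_quats \<Longrightarrow> h0 w = 0 \<Longrightarrow> hq_dot a w = 0 \<Longrightarrow> \<exists>s\<in>K. \<exists>t\<in>K. w = hq_scalar s * p + hq_scalar t *
      r"
    using anisotropic_plane_basis [OF a] by blast
  have lin: "hq_scalar s * (p * u) + hq_scalar t * (r * u) = (hq_scalar s * p + hq_scalar t * r) *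
    u" for s t
    by (simp add: algebra_simps)
  show "\<exists>u1\<in>K_quats. \<exists>u2\<in>K_quats. hq_norm u1 \<noteq> 0 \<and> hq_norm u2 \<noteq> 0 \<and>
           (\<forall>s t. hq_scalar s * u1 + hq_scalar t * u2 = 0 \<longrightarrow> s = 0 \<and> t = 0) \<and>
           {x \<in> K_quats. f * x + x * g = 0} = {hq_scalar s * u1 + hq_scalar t * u2 | s t. s \<in> K \<and>
             t \<in> K}"
  proof -
    have norms: "hq_norm (p * u) \<noteq> 0" "hq_norm (r * u) \<noteq> 0" using pr u by (simp_all add:
      hq_norm_mult)
    have mem: "p * u \<in> K_quats" "r * u \<in> K_quats" using pr u by (simp_all add: K_quats_closed)
    have indep: "s = 0 \<and> t = 0" if "hq_scalar s * (p * u) + hq_scalar t * (r * u) = 0" for s t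
    proof (rule pr(9))
      show "hq_scalar s * p + hq_scalar t * r = 0" using that unfolding lin using cancel(2) by
        (metis mult_zero_left)
    qed
    have dot: "hq_dot a (hq_scalar s * p + hq_scalar t * r) = s * hq_dot a p + t * hq_dot a r" for
      s t
      by (simp add: hq_dot_def hq_times_sel algebra_simps)
    have "{y. y \<in> K_quats \<and> h0 y = 0 \<and> hq_dot a y = 0} = {hq_scalar s * p + hq_scalar t * r | s t.
      s \<in> K \<and> t \<in> K}" (is "?L = ?R")
    proof
      show "?L \<subseteq> ?R" using pr(10) by blast
      show "?R \<subseteq> ?L"
        using pr(1-6) by (auto simp: dot K_quats_closed) (simp_all add: hq_times_sel)
    qed
    moreover have "{y * u | y. y \<in> K_quats \<and> h0 y = 0 \<and> hq_dot a y = 0} =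
        (\<lambda>y. y * u) ` {y. y \<in> K_quats \<and> h0 y = 0 \<and> hq_dot a y = 0}" by blast
    moreover have "{(hq_scalar s * p + hq_scalar t * r) * u | s t. s \<in> K \<and> t \<in> K} =
        (\<lambda>y. y * u) ` {hq_scalar s * p + hq_scalar t * r | s t. s \<in> K \<and> t \<in> K}" by blast
    ultimately have "{x \<in> K_quats. f * x + x * g = 0} = {hq_scalar s * (p * u) + hq_scalar t * (r
      * u) | s t. s \<in> K \<and> t \<in> K}"
      unfolding ker lin by simp
    then show ?thesis using norms mem indep by blast
  qed
qed

end

section \<open>Rings isomorphic to a quaternion algebra\<close>

text \<open>Quaternions are a ring by their type class, so a bijection that respects the operations is
  enough to derive the ring axioms for \<open>R\<close>.\<close>

locale hq_model = subfield_set K for K :: "'a::field_char_0 set" +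
  fixes R :: "'r ring" (structure) and elt :: "'a hq \<Rightarrow> 'r"
  assumes carrier_eq: "carrier R = elt ` K_quats"
    and inj: "inj_on elt K_quats"
    and mult_elt: "a \<in> K_quats \<Longrightarrow> b \<in> K_quats \<Longrightarrow> elt a \<otimes> elt b = elt (a * b)"
    and add_elt: "a \<in> K_quats \<Longrightarrow> b \<in> K_quats \<Longrightarrow> elt a \<oplus> elt b = elt (a + b)"
    and one_elt: "\<one> = elt 1" and zero_elt: "\<zero> = elt 0"
begin

lemma elt_eq_iff: "a \<in> K_quats \<Longrightarrow> b \<in> K_quats \<Longrightarrow> elt a = elt b \<longleftrightarrow> a = b"
  using inj by (auto simp: inj_on_def)

lemma elt_carrier [simp]: "a \<in> K_quats \<Longrightarrow> elt a \<in> carrier R"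
  by (simp add: carrier_eq)

lemma ring_R: "ring R"
proof (rule ringI)
  show "abelian_group R"
  proof (rule abelian_groupI)
    fix x assume "x \<in> carrier R"
    then obtain a where a: "x = elt a" "a \<in> K_quats" by (auto simp: carrier_eq)
    then show "\<exists>y\<in>carrier R. y \<oplus> x = \<zero>"
      by (intro bexI [of _ "elt (- a)"]) (simp_all add: add_elt zero_elt K_quats_closed)
  qed (auto simp: carrier_eq add_elt zero_elt K_quats_closed add_ac)
  show "monoid R"
    by (rule monoidI) (auto simp: carrier_eq mult_elt one_elt K_quats_closed mult.assoc)
qed (auto simp: carrier_eq add_elt mult_elt K_quats_closed algebra_simps)

sublocale ring R by (rule ring_R)

lemma uminus_elt: "a \<in> K_quats \<Longrightarrow> \<ominus> elt a = elt (- a)"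
  by (rule minus_equality) (simp_all add: add_elt zero_elt K_quats_closed)

lemma minus_elt: "a \<in> K_quats \<Longrightarrow> b \<in> K_quats \<Longrightarrow> elt a \<ominus> elt b = elt (a - b)"
  by (simp add: a_minus_def uminus_elt add_elt K_quats_closed)

lemma elt_Units:
  assumes "a \<in> K_quats" "hq_norm a \<noteq> 0"
  shows "elt a \<in> Units R"
  unfolding Units_def
  using assms hq_inv [OF assms(2)] hq_inv_K [OF assms(1)]
  by (auto simp: mult_elt one_elt K_quats_closed intro!: bexI [of _ "elt (hq_inv a)"])

lemma Span_two:
  assumes "u1 \<in> K_quats" "u2 \<in> K_quats"
  shows "Span (elt ` hq_scalar ` K) [elt u1, elt u2] = elt ` {hq_scalar s * u1 + hq_scalar t * u2
    | s t. s \<in> K \<and> t \<in> K}"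
    "Span (elt ` hq_scalar ` K) [elt u2] = elt ` {hq_scalar t * u2 | t. t \<in> K}"
proof -
  show 1: "Span (elt ` hq_scalar ` K) [elt u2] = elt ` {hq_scalar t * u2 | t. t \<in> K}"
  proof (intro equalityI subsetI)
    fix x assume "x \<in> Span (elt ` hq_scalar ` K) [elt u2]"
    then obtain t where "t \<in> K" "x = elt (hq_scalar t) \<otimes> elt u2 \<oplus> \<zero>"
      by (auto simp: line_extension_mem_iff)
    then have "t \<in> K" "x = elt (hq_scalar t * u2)" using assms by (simp_all add: mult_elt zero_elt
      add_elt K_quats_closed)
    then show "x \<in> elt ` {hq_scalar t * u2 | t. t \<in> K}" by blast
  next
    fix x assume "x \<in> elt ` {hq_scalar t * u2 | t. t \<in> K}"
    then obtain t where t: "t \<in> K" "x = elt (hq_scalar t * u2)" by blast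
    then have "x = elt (hq_scalar t) \<otimes> elt u2 \<oplus> \<zero>" using assms by (simp add: mult_elt zero_elt
      add_elt K_quats_closed)
    then show "x \<in> Span (elt ` hq_scalar ` K) [elt u2]" using t(1) by (auto simp:
      line_extension_mem_iff)
  qed
  have S: "Span (elt ` hq_scalar ` K) [elt u1, elt u2] = line_extension (elt ` hq_scalar ` K) (elt
    u1) (Span (elt ` hq_scalar ` K) [elt u2])"
    by simp
  show "Span (elt ` hq_scalar ` K) [elt u1, elt u2] = elt ` {hq_scalar s * u1 + hq_scalar t * u2 |
    s t. s \<in> K \<and> t \<in> K}"
    unfolding S 1
  proof (intro equalityI subsetI)
    fix x assume "x \<in> line_extension (elt ` hq_scalar ` K) (elt u1) (elt ` {hq_scalar t * u2 | t.
      t \<in> K})"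
    then obtain s t where "s \<in> K" "t \<in> K" "x = elt (hq_scalar s) \<otimes> elt u1 \<oplus> elt (hq_scalar t * u2)"
      by (auto simp: line_extension_mem_iff)
    then have "s \<in> K" "t \<in> K" "x = elt (hq_scalar s * u1 + hq_scalar t * u2)" using assms by
      (simp_all add: mult_elt add_elt K_quats_closed)
    then show "x \<in> elt ` {hq_scalar s * u1 + hq_scalar t * u2 | s t. s \<in> K \<and> t \<in> K}" by blast
  next
    fix x assume "x \<in> elt ` {hq_scalar s * u1 + hq_scalar t * u2 | s t. s \<in> K \<and> t \<in> K}"
    then obtain s t where st: "s \<in> K" "t \<in> K" "x = elt (hq_scalar s * u1 + hq_scalar t * u2)" by
      blast
    then have "x = elt (hq_scalar s) \<otimes> elt u1 \<oplus> elt (hq_scalar t * u2)" using assms by (simp add: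
      mult_elt add_elt K_quats_closed)
    then show "x \<in> line_extension (elt ` hq_scalar ` K) (elt u1) (elt ` {hq_scalar t * u2 | t. t \<in>
      K})"
      unfolding line_extension_mem_iff using st(1,2) by blast
  qed
qed

lemma independent_two:
  assumes "u1 \<in> K_quats" "u2 \<in> K_quats" and ind: "\<And>s t. hq_scalar s * u1 + hq_scalar t * u2 = 0 \<Longrightarrow>
    s = 0 \<and> t = 0"
  shows "independent (elt ` hq_scalar ` K) [elt u1, elt u2]"
proof (intro li_Cons li_Nil)
  have "hq_scalar 0 * u1 = 0" by (simp add: hq_eq_iff hq_times_sel)
  then have "u2 \<noteq> 0" using ind [of 0 1] by auto
  then show "elt u2 \<notin> Span (elt ` hq_scalar ` K) []"
    using assms(2) by (simp add: zero_elt elt_eq_iff K_quats_closed)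
  show "elt u1 \<notin> Span (elt ` hq_scalar ` K) [elt u2]"
  proof
    assume "elt u1 \<in> Span (elt ` hq_scalar ` K) [elt u2]"
    then obtain t where t: "t \<in> K" "elt u1 = elt (hq_scalar t * u2)" unfolding Span_two(2) [OF
      assms(1,2)] by blast
    then have "u1 = hq_scalar t * u2" using assms by (simp add: elt_eq_iff K_quats_closed)
    moreover have "hq_scalar (- t) = - hq_scalar t" by (simp add: hq_eq_iff)
    ultimately have "hq_scalar 1 * u1 + hq_scalar (- t) * u2 = 0" by simp
    then show False using ind [of 1 "- t"] by simp
  qed
qed (use assms in simp_all)

theorem sylvester_kernel_model:
  assumes f: "f \<in> K_quats" "hq_vec f \<noteq> 0" and g: "g \<in> K_quats" "hq_vec g \<noteq> 0"
    and fg: "h0 f = - h0 g" "hq_norm (hq_vec f) = hq_norm (hq_vec g)"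
  shows "{x \<in> carrier R. elt f \<otimes> x \<oplus> x \<otimes> elt g = \<zero>} =
      {elt f \<otimes> h \<oplus> h \<otimes> elt (hq_conj g) | h. h \<in> carrier R}"
    and "\<exists>Us. set Us \<subseteq> Units R \<and> independent (elt ` hq_scalar ` K) Us \<and>
      Span (elt ` hq_scalar ` K) Us = {x \<in> carrier R. elt f \<otimes> x \<oplus> x \<otimes> elt g = \<zero>}"
proof -
  have ker: "{x \<in> carrier R. elt f \<otimes> x \<oplus> x \<otimes> elt g = \<zero>} = elt ` {x \<in> K_quats. f * x + x * g = 0}"
    using f(1) g(1) by (auto simp: carrier_eq mult_elt add_elt zero_elt elt_eq_iff K_quats_closed)
  have im: "{elt f \<otimes> h \<oplus> h \<otimes> elt (hq_conj g) | h. h \<in> carrier R} = elt ` {f * h + h * hq_conj g |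
    h. h \<in> K_quats}"
  proof -
    have step: "elt f \<otimes> elt h \<oplus> elt h \<otimes> elt (hq_conj g) = elt (f * h + h * hq_conj g)" if "h \<in>
      K_quats" for h
      using that f(1) g(1) by (simp add: mult_elt add_elt K_quats_closed)
    show ?thesis
      unfolding carrier_eq Setcompr_eq_image image_image by (intro image_cong refl) (rule step)
  qed
  show "{x \<in> carrier R. elt f \<otimes> x \<oplus> x \<otimes> elt g = \<zero>} =
      {elt f \<otimes> h \<oplus> h \<otimes> elt (hq_conj g) | h. h \<in> carrier R}"
    unfolding ker im sylvester_kernel(1) [OF assms] ..
  obtain u1 u2 where u: "u1 \<in> K_quats" "u2 \<in> K_quats" "hq_norm u1 \<noteq> 0" "hq_norm u2 \<noteq> 0"
    "\<And>s t. hq_scalar s * u1 + hq_scalar t * u2 = 0 \<Longrightarrow> s = 0 \<and> t = 0"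
    "{x \<in> K_quats. f * x + x * g = 0} = {hq_scalar s * u1 + hq_scalar t * u2 | s t. s \<in> K \<and> t \<in> K}"
    using sylvester_kernel(2) [OF assms] by blast
  show "\<exists>Us. set Us \<subseteq> Units R \<and> independent (elt ` hq_scalar ` K) Us \<and>
      Span (elt ` hq_scalar ` K) Us = {x \<in> carrier R. elt f \<otimes> x \<oplus> x \<otimes> elt g = \<zero>}"
  proof (intro exI [of _ "[elt u1, elt u2]"] conjI)
    show "set [elt u1, elt u2] \<subseteq> Units R" using u(1-4) elt_Units by simp
    show "independent (elt ` hq_scalar ` K) [elt u1, elt u2]" by (rule independent_two [OF
      u(1,2,5)])
    show "Span (elt ` hq_scalar ` K) [elt u1, elt u2] = {x \<in> carrier R. elt f \<otimes> x \<oplus> x \<otimes> elt g = \<zero>}"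
      unfolding ker Span_two(1) [OF u(1,2)] u(6) ..
  qed
qed

end

section \<open>Slice coordinates\<close>

definition slice_pt :: "quat \<Rightarrow> complex \<Rightarrow> quat" where
  "slice_pt I z = of_real (Re z) + I * of_real (Im z)"

lemma of_real_quat: "of_real r = Quat r 0 0 0"
  by (simp add: of_real_def quat_eq_iff)

lemma quat_of_real_sel [simp]:
  "qRe (of_real r) = r" "qIm1 (of_real r) = 0" "qIm2 (of_real r) = 0" "qIm3 (of_real r) = 0"
  by (simp_all add: of_real_quat)

lemma quat_times_sel:
  "qRe (p * q) = qRe p * qRe q - qIm1 p * qIm1 q - qIm2 p * qIm2 q - qIm3 p * qIm3 q"
  "qIm1 (p * q) = qRe p * qIm1 q + qIm1 p * qRe q + qIm2 p * qIm3 q - qIm3 p * qIm2 q"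
  "qIm2 (p * q) = qRe p * qIm2 q - qIm1 p * qIm3 q + qIm2 p * qRe q + qIm3 p * qIm1 q"
  "qIm3 (p * q) = qRe p * qIm3 q + qIm1 p * qIm2 q - qIm2 p * qIm1 q + qIm3 p * qRe q"
  by (simp_all add: times_quat_def)

lemma slice_pt_sel [simp]:
  "qRe (slice_pt I z) = Re z + qRe I * Im z" "qIm1 (slice_pt I z) = qIm1 I * Im z"
  "qIm2 (slice_pt I z) = qIm2 I * Im z" "qIm3 (slice_pt I z) = qIm3 I * Im z"
  by (simp_all add: slice_pt_def quat_times_sel)

lemma q_unit_sel [simp]:
  "qRe q_i = 0" "qIm1 q_i = 1" "qIm2 q_i = 0" "qIm3 q_i = 0"
  "qRe q_j = 0" "qIm1 q_j = 0" "qIm2 q_j = 1" "qIm3 q_j = 0"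
  "qRe q_k = 0" "qIm1 q_k = 0" "qIm2 q_k = 0" "qIm3 q_k = 1"
  by (simp_all add: q_i_def q_j_def q_k_def)

lemma imag_units_sq: "I \<in> imag_units \<Longrightarrow> I * I = -1"
  by (simp add: imag_units_def power2_eq_square)

lemma imag_units_iff:
  "I \<in> imag_units \<longleftrightarrow> qRe I = 0 \<and> (qIm1 I)\<^sup>2 + (qIm2 I)\<^sup>2 + (qIm3 I)\<^sup>2 = 1"
proof
  assume "I \<in> imag_units"
  then have "I * I = -1" by (rule imag_units_sq)
  then have *: "(qRe I)\<^sup>2 - ((qIm1 I)\<^sup>2 + (qIm2 I)\<^sup>2 + (qIm3 I)\<^sup>2) = -1"
     "qRe I * qIm1 I = 0" "qRe I * qIm2 I = 0" "qRe I * qIm3 I = 0"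
    by (simp_all add: quat_eq_iff quat_times_sel power2_eq_square algebra_simps)
  have "qRe I = 0"
  proof (rule ccontr)
    assume "qRe I \<noteq> 0"
    with * have "(qRe I)\<^sup>2 = -1" by simp
    then show False by (metis not_one_le_zero zero_le_power2 neg_0_le_iff_le)
  qed
  with * show "qRe I = 0 \<and> (qIm1 I)\<^sup>2 + (qIm2 I)\<^sup>2 + (qIm3 I)\<^sup>2 = 1" by simp
next
  assume "qRe I = 0 \<and> (qIm1 I)\<^sup>2 + (qIm2 I)\<^sup>2 + (qIm3 I)\<^sup>2 = 1"
  then show "I \<in> imag_units"
    by (simp add: imag_units_def power2_eq_square quat_eq_iff quat_times_sel)
qed

lemma imag_units_basic [simp]:
  "q_i \<in> imag_units" "q_j \<in> imag_units" "q_k \<in> imag_units" "- I \<in> imag_units \<longleftrightarrow> I \<in> imag_units"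
  by (simp_all add: imag_units_iff)

lemma slice_pt_cnj: "slice_pt I (cnj z) = slice_pt (- I) z"
  by (simp add: slice_pt_def)

lemma slice_pt_mult: "I \<in> imag_units \<Longrightarrow> slice_pt I (z * w) = slice_pt I z * slice_pt I w"
proof -
  assume "I \<in> imag_units"
  then have "qRe I = 0" "qIm1 I * qIm1 I + qIm2 I * qIm2 I + qIm3 I * qIm3 I = 1"
    by (simp_all add: imag_units_iff power2_eq_square)
  moreover have "Im z * Im w * (qIm1 I * qIm1 I + qIm2 I * qIm2 I + qIm3 I * qIm3 I) = 
     (qIm1 I * Im z) * (qIm1 I * Im w) + (qIm2 I * Im z) * (qIm2 I * Im w) + (qIm3 I * Im z) *
       (qIm3 I * Im w)"
    by (simp add: algebra_simps)
  ultimately show ?thesis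
    by (simp add: quat_eq_iff quat_times_sel algebra_simps)
qed

lemma slice_pt_add: "slice_pt I (z + w) = slice_pt I z + slice_pt I w"
  by (simp add: slice_pt_def algebra_simps)

lemma slice_pt_of_real [simp]: "slice_pt I (of_real r) = of_real r" "slice_pt I 1 = 1" "slice_pt I
  0 = 0"
  by (simp_all add: slice_pt_def)

lemma slice_pt_power: "I \<in> imag_units \<Longrightarrow> slice_pt I (z ^ n) = slice_pt I z ^ n"
  by (induction n) (simp_all add: slice_pt_mult)

text \<open>A sphere may be described from different pairs \<open>(y, I)\<close>, but \<open>y\<close> is determined up to sign,
  and the sign can be moved to \<open>I\<close>.\<close>

lemma qsphere_slice_pt:
  assumes "I \<in> imag_units"
  shows "qsphere (slice_pt I z) = {slice_pt J z | J. J \<in> imag_units}"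
proof
  show "{slice_pt J z | J. J \<in> imag_units} \<subseteq> qsphere (slice_pt I z)"
    using assms by (force simp: qsphere_def slice_pt_def)
  show "qsphere (slice_pt I z) \<subseteq> {slice_pt J z | J. J \<in> imag_units}"
  proof
    fix q assume "q \<in> qsphere (slice_pt I z)"
    then obtain x y J' J where q: "q = of_real x + J * of_real y" "J \<in> imag_units" "J' \<in> imag_units"
      "slice_pt I z = of_real x + J' * of_real y" unfolding qsphere_def by blast
    have w: "q = slice_pt J (Complex x y)" "slice_pt I z = slice_pt J' (Complex x y)" using q by
      (simp_all add: slice_pt_def)
    have x: "x = Re z" using arg_cong [OF w(2), of qRe] assms q(3) by (simp add: imag_units_iff)
    have n: "(qIm1 (slice_pt L u))\<^sup>2 + (qIm2 (slice_pt L u))\<^sup>2 + (qIm3 (slice_pt L u))\<^sup>2 = (Im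
      u)\<^sup>2" if "L \<in> imag_units" for L u
    proof -
      have "(qIm1 (slice_pt L u))\<^sup>2 + (qIm2 (slice_pt L u))\<^sup>2 + (qIm3 (slice_pt L u))\<^sup>2 =
         ((qIm1 L)\<^sup>2 + (qIm2 L)\<^sup>2 + (qIm3 L)\<^sup>2) * (Im u)\<^sup>2"
        by (simp add: power_mult_distrib algebra_simps)
      with that show ?thesis by (simp add: imag_units_iff)
    qed
    have "y\<^sup>2 = (Im z)\<^sup>2" using n [OF assms, of z] n [OF q(3), of "Complex x y"] w(2) by simp
    then have "y = Im z \<or> y = - Im z" by (simp add: power2_eq_iff)
    then show "q \<in> {slice_pt J z | J. J \<in> imag_units}"
    proof
      assume "y = Im z" then show ?thesis using x q by (auto simp: slice_pt_def)
    next
      assume "y = - Im z"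
      then have "q = slice_pt (- J) z" using x q by (simp add: slice_pt_def)
      then show ?thesis using q(2) by (metis (mono_tags, lifting) imag_units_basic(4)
        mem_Collect_eq)
    qed
  qed
qed

text \<open>Every quaternion is \<open>x + Iy\<close> with \<open>y \<ge> 0\<close>; \<open>upper_pt\<close> is \<open>x + iy\<close> and \<open>imag_dir\<close> is \<open>I\<close>.
  On the real axis, where \<open>I\<close> is not determined, \<open>q_i\<close> is used.\<close>

definition upper_pt :: "quat \<Rightarrow> complex" where
  "upper_pt q = Complex (qRe q) (sqrt ((qIm1 q)\<^sup>2 + (qIm2 q)\<^sup>2 + (qIm3 q)\<^sup>2))"

definition imag_dir :: "quat \<Rightarrow> quat" where
  "imag_dir q = (if Im (upper_pt q) = 0 then q_i else inverse (Im (upper_pt q)) *\<^sub>R (q - of_real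
    (qRe q)))"

lemma Im_upper_pt_sq: "(Im (upper_pt q))\<^sup>2 = (qIm1 q)\<^sup>2 + (qIm2 q)\<^sup>2 + (qIm3 q)\<^sup>2"
  by (simp add: upper_pt_def)

lemma slice_pt_upper_pt: "slice_pt (imag_dir q) (upper_pt q) = q" and imag_dir_imag_unit:
  "imag_dir q \<in> imag_units"
proof -
  show "slice_pt (imag_dir q) (upper_pt q) = q"
  proof (cases "Im (upper_pt q) = 0")
    case True
    then have "(qIm1 q)\<^sup>2 + (qIm2 q)\<^sup>2 + (qIm3 q)\<^sup>2 = 0" using Im_upper_pt_sq [of q] by simp
    then have "qIm1 q = 0" "qIm2 q = 0" "qIm3 q = 0" by (simp_all add: add_nonneg_eq_0_iff)
    then show ?thesis by (simp add: quat_eq_iff upper_pt_def imag_dir_def)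
  next
    case False
    then show ?thesis by (simp add: quat_eq_iff imag_dir_def) (simp add: upper_pt_def)
  qed
  show "imag_dir q \<in> imag_units"
  proof (cases "Im (upper_pt q) = 0")
    case False
    have "(inverse (Im (upper_pt q)) * qIm1 q)\<^sup>2 + (inverse (Im (upper_pt q)) * qIm2 q)\<^sup>2 +
      (inverse (Im (upper_pt q)) * qIm3 q)\<^sup>2
       = inverse ((Im (upper_pt q))\<^sup>2) * (Im (upper_pt q))\<^sup>2"
      by (simp only: Im_upper_pt_sq power_mult_distrib distrib_left power_inverse)
    then show ?thesis using False by (simp add: imag_units_iff imag_dir_def)
  qed (simp add: imag_dir_def)
qed

lemma upper_pt_slice_pt:
  assumes "I \<in> imag_units"
  shows "upper_pt (slice_pt I z) = (if Im z \<ge> 0 then z else cnj z)"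
proof -
  have "(qIm1 I * Im z)\<^sup>2 + (qIm2 I * Im z)\<^sup>2 + (qIm3 I * Im z)\<^sup>2 = ((qIm1 I)\<^sup>2 + (qIm2 I)\<^sup>2 +
    (qIm3 I)\<^sup>2) * (Im z)\<^sup>2"
    by (simp add: power_mult_distrib algebra_simps)
  then show ?thesis using assms by (auto simp: upper_pt_def complex_eq_iff imag_units_iff)
qed

lemma imag_dir_slice_pt: "I \<in> imag_units \<Longrightarrow> Im z \<noteq> 0 \<Longrightarrow> imag_dir (slice_pt I z) = (if Im z \<ge> 0 then
  I else - I)"
  by (auto simp: imag_dir_def upper_pt_slice_pt quat_eq_iff imag_units_iff)

definition planar :: "quat set \<Rightarrow> complex set" where
  "planar U = {z. slice_pt q_i z \<in> U}"

lemma circular_slice_pt_iff: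
  assumes "circular U" "I \<in> imag_units"
  shows "slice_pt I z \<in> U \<longleftrightarrow> z \<in> planar U"
  using assms qsphere_slice_pt [of I z] qsphere_slice_pt [of q_i z] imag_units_basic(1)
  unfolding circular_def planar_def by blast

lemma planar_cnj:
  assumes "circular U" shows "cnj z \<in> planar U \<longleftrightarrow> z \<in> planar U"
  using circular_slice_pt_iff [OF assms, of "- q_i" z] by (simp add: planar_def slice_pt_cnj)

lemma upper_pt_planar:
  assumes "circular U" shows "upper_pt q \<in> planar U \<longleftrightarrow> q \<in> U"
  using circular_slice_pt_iff [OF assms imag_dir_imag_unit, of q "upper_pt q"] by (simp add:
    slice_pt_upper_pt)

lemma bounded_linear_quat_sel:
  "bounded_linear qRe" "bounded_linear qIm1" "bounded_linear qIm2" "bounded_linear qIm3"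
proof -
  have "\<bar>qRe q\<bar> \<le> norm q * 1" "\<bar>qIm1 q\<bar> \<le> norm q * 1" "\<bar>qIm2 q\<bar> \<le> norm q * 1" "\<bar>qIm3 q\<bar> \<le> norm q *
    1" for q
    by (auto simp: norm_quat_def intro!: real_le_rsqrt)
  then show "bounded_linear qRe" "bounded_linear qIm1" "bounded_linear qIm2" "bounded_linear qIm3"
    by (auto intro!: bounded_linear_intro [where K = 1])
qed

lemma bounded_linear_slice_pt: "bounded_linear (slice_pt I)"
  unfolding slice_pt_def [abs_def]
  by (intro bounded_linear_add bounded_linear_compose [OF bounded_linear_mult_right]
      bounded_linear_compose [OF bounded_linear_of_real] bounded_linear_Re bounded_linear_Im)

lemma open_planar: "open U \<Longrightarrow> open (planar U)"
  unfolding planar_def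
  using open_vimage [of U "slice_pt q_i"] linear_continuous_on [OF bounded_linear_slice_pt]
  by (simp add: vimage_def)

lemma continuous_on_upper_pt: "continuous_on UNIV upper_pt"
proof -
  have "continuous_on UNIV qRe" "continuous_on UNIV qIm1" "continuous_on UNIV qIm2" "continuous_on
    UNIV qIm3"
    using bounded_linear_quat_sel by (blast intro: linear_continuous_on)+
  then show ?thesis
    unfolding upper_pt_def [abs_def] Complex_eq by (intro continuous_intros)
qed

text \<open>The circular set with planar trace \<open>A\<close>, for \<open>A\<close> symmetric under conjugation.\<close>

definition lift :: "complex set \<Rightarrow> quat set" where
  "lift A = upper_pt -` A"

lemma open_lift: "open A \<Longrightarrow> open (lift A)"
  using open_vimage continuous_on_upper_pt unfolding lift_def by blast

lemma slice_pt_in_lift_iff: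
  assumes "\<And>z. cnj z \<in> A \<longleftrightarrow> z \<in> A" "I \<in> imag_units"
  shows "slice_pt I z \<in> lift A \<longleftrightarrow> z \<in> A"
  using assms by (auto simp: lift_def upper_pt_slice_pt)

lemma circular_lift:
  assumes "\<And>z. cnj z \<in> A \<longleftrightarrow> z \<in> A"
  shows "circular (lift A)"
  unfolding circular_def
proof
  fix q assume "q \<in> lift A"
  then have "upper_pt q \<in> A" by (simp add: lift_def)
  then show "qsphere q \<subseteq> lift A"
    using qsphere_slice_pt [OF imag_dir_imag_unit, of q "upper_pt q"] slice_pt_in_lift_iff [OF
      assms] by (auto simp: slice_pt_upper_pt)
qed

lemma planar_lift:
  assumes "\<And>z. cnj z \<in> A \<longleftrightarrow> z \<in> A"
  shows "planar (lift A) = A"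
  using slice_pt_in_lift_iff [OF assms] by (auto simp: planar_def)

section \<open>Stem functions\<close>

text \<open>The value at \<open>x + Iy\<close> of the slice function whose stem function has the value \<open>h\<close> at
  \<open>x + iy\<close>.\<close>

definition slice_val :: "quat \<Rightarrow> complex hq \<Rightarrow> quat" where
  "slice_val I h = Quat (Re (h0 h)) (Re (h1 h)) (Re (h2 h)) (Re (h3 h))
     + I * Quat (Im (h0 h)) (Im (h1 h)) (Im (h2 h)) (Im (h3 h))"

text \<open>Solving \<open>f(x + Iy) = F1 + I F2\<close> for \<open>F1\<close> and \<open>F2\<close> from the values at \<open>I = q_i\<close> and
  \<open>I = - q_i\<close>. The formulas make sense for every \<open>f\<close>, and always give an even \<open>F1\<close> and an odd
  \<open>F2\<close>.\<close>

definition stem1 :: "(quat \<Rightarrow> quat) \<Rightarrow> complex \<Rightarrow> quat" where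
  "stem1 f z = (1/2) *\<^sub>R (f (slice_pt q_i z) + f (slice_pt (- q_i) z))"

definition stem2 :: "(quat \<Rightarrow> quat) \<Rightarrow> complex \<Rightarrow> quat" where
  "stem2 f z = - q_i * ((1/2) *\<^sub>R (f (slice_pt q_i z) - f (slice_pt (- q_i) z)))"

definition stem :: "(quat \<Rightarrow> quat) \<Rightarrow> complex \<Rightarrow> complex hq" where
  "stem f z = Hq (Complex (qRe (stem1 f z)) (qRe (stem2 f z))) (Complex (qIm1 (stem1 f z)) (qIm1
    (stem2 f z)))
     (Complex (qIm2 (stem1 f z)) (qIm2 (stem2 f z))) (Complex (qIm3 (stem1 f z)) (qIm3 (stem2 f
       z)))"

definition hq_cnj :: "complex hq \<Rightarrow> complex hq" where
  "hq_cnj h = Hq (cnj (h0 h)) (cnj (h1 h)) (cnj (h2 h)) (cnj (h3 h))"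

lemma hq_cnj_sel [simp]:
  "h0 (hq_cnj h) = cnj (h0 h)" "h1 (hq_cnj h) = cnj (h1 h)" "h2 (hq_cnj h) = cnj (h2 h)" "h3
    (hq_cnj h) = cnj (h3 h)"
  by (simp_all add: hq_cnj_def)

lemma slice_val_sel:
  "qRe (slice_val I h) = Re (h0 h) + (qRe I * Im (h0 h) - qIm1 I * Im (h1 h) - qIm2 I * Im (h2 h)
    - qIm3 I * Im (h3 h))"
  "qIm1 (slice_val I h) = Re (h1 h) + (qRe I * Im (h1 h) + qIm1 I * Im (h0 h) + qIm2 I * Im (h3 h)
    - qIm3 I * Im (h2 h))"
  "qIm2 (slice_val I h) = Re (h2 h) + (qRe I * Im (h2 h) - qIm1 I * Im (h3 h) + qIm2 I * Im (h0 h)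
    + qIm3 I * Im (h1 h))"
  "qIm3 (slice_val I h) = Re (h3 h) + (qRe I * Im (h3 h) + qIm1 I * Im (h2 h) - qIm2 I * Im (h1 h)
    + qIm3 I * Im (h0 h))"
  by (simp_all add: slice_val_def quat_times_sel)

lemma stem_parts_cnj: "stem1 f (cnj z) = stem1 f z" "stem2 f (cnj z) = - stem2 f z"
  by (simp_all add: stem1_def stem2_def slice_pt_cnj algebra_simps)

lemma stem_cnj: "stem f (cnj z) = hq_cnj (stem f z)"
  by (simp add: stem_def hq_cnj_def stem_parts_cnj complex_eq_iff)

lemma slice_val_hq_cnj: "slice_val I (hq_cnj h) = slice_val (- I) h"
  by (simp add: quat_eq_iff slice_val_sel)

lemma stem_eqI:
  assumes "f (slice_pt q_i z) = slice_val q_i h" "f (slice_pt (- q_i) z) = slice_val (- q_i) h"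
  shows "stem f z = h"
  by (simp add: stem_def stem1_def stem2_def assms hq_eq_iff complex_eq_iff slice_val_sel
    quat_times_sel)

lemma slice_val_add: "slice_val I (h + k) = slice_val I h + slice_val I k"
  by (simp add: quat_eq_iff slice_val_sel algebra_simps)

lemma slice_val_slice_pt_sum: "slice_val I h = slice_pt I (h0 h) + slice_pt I (h1 h) * q_i +
  slice_pt I (h2 h) * q_j + slice_pt I (h3 h) * q_k"
  by (simp add: quat_eq_iff slice_val_sel quat_times_sel)

lemma slice_val_hq_scalar_mult: "I \<in> imag_units \<Longrightarrow> slice_val I (hq_scalar c * h) = slice_pt I c *
  slice_val I h"
  by (simp add: slice_val_slice_pt_sum hq_times_sel slice_pt_mult distrib_left mult.assoc)

text \<open>The imaginary unit of the complexification is central. So in the product of \<open>F\<close> and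
  \<open>G1 + \<iota> G2\<close> the term with \<open>G2\<close> carries it in front of \<open>F\<close>, where it is evaluated as \<open>I\<close>.\<close>

lemma slice_val_mult:
  assumes "I \<in> imag_units"
  shows "slice_val I (h * k) = slice_val I h * Quat (Re (h0 k)) (Re (h1 k)) (Re (h2 k)) (Re (h3 k))
     + I * slice_val I h * Quat (Im (h0 k)) (Im (h1 k)) (Im (h2 k)) (Im (h3 k))"
proof -
  define R where "R = (\<lambda>h. Quat (Re (h0 h)) (Re (h1 h)) (Re (h2 h)) (Re (h3 h)))"
  define M where "M = (\<lambda>h. Quat (Im (h0 h)) (Im (h1 h)) (Im (h2 h)) (Im (h3 h)))"
  have v: "slice_val I h = R h + I * M h" for h by (simp add: slice_val_def R_def M_def)
  have RM: "R (h * k) = R h * R k - M h * M k" "M (h * k) = R h * M k + M h * R k"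
    by (simp_all add: R_def M_def quat_eq_iff quat_times_sel hq_times_sel algebra_simps)
  have "R h * R k - M h * M k + I * (R h * M k + M h * R k) = (R h + I * M h) * R k + I * (R h + I
    * M h) * M k"
  proof -
    have "I * (I * M h) = - M h" using imag_units_sq [OF assms] by (simp add: mult.assoc
      [symmetric])
    then have "I * (R h + I * M h) = I * R h - M h" by (simp add: distrib_left)
    show ?thesis unfolding \<open>I * (R h + I * M h) = I * R h - M h\<close> by (simp add: algebra_simps)
  qed
  then show ?thesis unfolding v RM by (simp add: R_def M_def)
qed

lemma imag_units_conjugate:
  assumes "I \<in> imag_units" "a \<noteq> 0"
  shows "inverse a * I * a \<in> imag_units"
proof -
  have "(inverse a * I * a) * (inverse a * I * a) = inverse a * I * (a * inverse a) * I * a"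
    by (simp add: mult.assoc)
  also have "\<dots> = inverse a * (I * I) * a" using assms(2) by (simp add: mult.assoc)
  also have "\<dots> = - 1" using assms by (simp add: imag_units_sq)
  finally show ?thesis by (simp add: imag_units_def power2_eq_square)
qed

text \<open>That \<open>f\<close> is a slice function on \<open>U\<close>: its values on all slices are determined by those on
  the slice of \<open>q_i\<close>.\<close>

definition slice_fun :: "quat set \<Rightarrow> (quat \<Rightarrow> quat) \<Rightarrow> bool" where
  "slice_fun U f \<longleftrightarrow> (\<forall>I\<in>imag_units. \<forall>z. slice_pt I z \<in> U \<longrightarrow> f (slice_pt I z) = slice_val I (stem f
    z))"

lemma slice_funI:
  assumes "\<And>I z. I \<in> imag_units \<Longrightarrow> slice_pt I z \<in> U \<Longrightarrow> f (slice_pt I z) = slice_val I (\<phi> z)"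
    "circular U"
  shows "slice_fun U f" "\<And>z. z \<in> planar U \<Longrightarrow> stem f z = \<phi> z"
proof -
  show *: "stem f z = \<phi> z" if "z \<in> planar U" for z
    by (rule stem_eqI) (use that assms(1) circular_slice_pt_iff [OF assms(2)] in auto)
  show "slice_fun U f"
    unfolding slice_fun_def using assms(1) * circular_slice_pt_iff [OF assms(2)] by metis
qed

text \<open>If \<open>a = f(x + Iy) \<noteq> 0\<close>, then \<open>a\<^sup>-\<^sup>1 (x + Iy) a\<close> is the point \<open>x + Jy\<close> with
  \<open>J = a\<^sup>-\<^sup>1 I a\<close>, and \<open>a (G1 + J G2) = a G1 + I a G2\<close>. The case \<open>a = 0\<close> of the definition
  agrees with this formula.\<close>

lemma star_slice_pt:
  assumes "slice_fun U f" "slice_fun V g" "I \<in> imag_units" "slice_pt I z \<in> U \<inter> V" "circular V"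
  shows "star f g (slice_pt I z) = slice_val I (stem f z * stem g z)"
proof -
  define a where "a = f (slice_pt I z)"
  have a: "a = slice_val I (stem f z)" using assms by (simp add: slice_fun_def a_def)
  show ?thesis
  proof (cases "a = 0")
    case True
    then have "star f g (slice_pt I z) = 0" by (simp add: star_def a_def)
    then show ?thesis using slice_val_mult [OF assms(3), of "stem f z" "stem g z"] True a by simp
  next
    case False
    define J where "J = inverse a * I * a"
    have J: "J \<in> imag_units" using imag_units_conjugate [OF assms(3) False] by (simp add: J_def)
    have "inverse a * slice_pt I z * a = slice_pt J z"
      using False by (simp add: slice_pt_def J_def distrib_left distrib_right mult.assoc
        of_real_def)
    moreover have "g (slice_pt J z) = slice_val J (stem g z)"
    proof -
      have "slice_pt J z \<in> V" using circular_slice_pt_iff [OF assms(5)] J assms(3,4) by blast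
      then show ?thesis using assms(2) J by (simp add: slice_fun_def)
    qed
    ultimately have "star f g (slice_pt I z) = a * slice_val J (stem g z)"
      using False by (simp add: star_def flip: a_def)
    also have "\<dots> = slice_val I (stem f z * stem g z)"
      using False unfolding slice_val_mult [OF assms(3)] a [symmetric]
      unfolding slice_val_def [of J] unfolding J_def by (simp add: distrib_left mult.assoc
        [symmetric])
    finally show ?thesis .
  qed
qed

text \<open>The slice function with stem function \<open>\<phi>\<close>, if \<open>\<phi>\<close> is symmetric under conjugation.\<close>

definition slice_ext :: "(complex \<Rightarrow> complex hq) \<Rightarrow> quat \<Rightarrow> quat" where
  "slice_ext \<phi> q = slice_val (imag_dir q) (\<phi> (upper_pt q))"

text \<open>The definition only uses \<open>\<phi>\<close> on the closed upper half plane; symmetry under conjugation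
  makes the formula hold for all \<open>z\<close>. On the real axis it forces \<open>\<phi>\<close> to have real components, so
  that the arbitrary choice of the direction there does not matter.\<close>

lemma slice_ext_slice_pt:
  assumes "\<And>z. \<phi> (cnj z) = hq_cnj (\<phi> z)" "I \<in> imag_units"
  shows "slice_ext \<phi> (slice_pt I z) = slice_val I (\<phi> z)"
proof (cases "Im z = 0")
  case True
  then have "cnj z = z" by (simp add: complex_eq_iff)
  then have "\<phi> z = hq_cnj (\<phi> z)" using assms(1) [of z] by simp
  then have "Im (h0 (\<phi> z)) = 0" "Im (h1 (\<phi> z)) = 0" "Im (h2 (\<phi> z)) = 0" "Im (h3 (\<phi> z)) = 0"
    by (simp_all add: hq_eq_iff complex_eq_iff)
  then show ?thesis using True assms(2) by (simp add: slice_ext_def upper_pt_slice_pt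
    slice_val_def flip: zero_quat_def)
next
  case False
  then show ?thesis using assms by (auto simp: slice_ext_def upper_pt_slice_pt imag_dir_slice_pt
    slice_val_hq_cnj)
qed

lemma stem_slice_ext:
  assumes "\<And>z. \<phi> (cnj z) = hq_cnj (\<phi> z)"
  shows "stem (slice_ext \<phi>) z = \<phi> z"
  by (rule stem_eqI) (simp_all add: slice_ext_slice_pt [where \<phi> = \<phi>, OF assms])

lemma slice_fun_slice_ext:
  assumes "\<And>z. \<phi> (cnj z) = hq_cnj (\<phi> z)"
  shows "slice_fun U (slice_ext \<phi>)"
  by (simp add: slice_fun_def stem_slice_ext [where \<phi> = \<phi>, OF assms] slice_ext_slice_pt [where \<phi> =
    \<phi>, OF assms])

definition hq_holo :: "(complex \<Rightarrow> complex hq) \<Rightarrow> complex set \<Rightarrow> bool" where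
  "hq_holo \<phi> A \<longleftrightarrow> (\<lambda>z. h0 (\<phi> z)) holomorphic_on A \<and> (\<lambda>z. h1 (\<phi> z)) holomorphic_on A
     \<and> (\<lambda>z. h2 (\<phi> z)) holomorphic_on A \<and> (\<lambda>z. h3 (\<phi> z)) holomorphic_on A"

text \<open>The Cauchy-Riemann equations of \<open>f\<close> along \<open>q_i\<close> and along \<open>- q_i\<close> at the same \<open>z\<close> are
  \<open>(F1\<^sub>x - F2\<^sub>y) \<plusminus> q_i (F2\<^sub>x + F1\<^sub>y) = 0\<close>. Together they are the Cauchy-Riemann equations of
  \<open>F1 + i F2\<close>, for each real component \<open>L\<close> separately.\<close>

lemma stem_component_has_derivative:
  fixes L :: "quat \<Rightarrow> real"
  assumes L: "bounded_linear L"
    and D: "((\<lambda>(s, t). f (of_real s + q_i * of_real t)) has_derivative D) (at (Re z, Im z))"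
      "D (1, 0) + q_i * D (0, 1) = 0"
    and E: "((\<lambda>(s, t). f (of_real s + - q_i * of_real t)) has_derivative E) (at (Re z, Im z))"
      "E (1, 0) + - q_i * E (0, 1) = 0"
  shows "(\<lambda>z. Complex (L (stem1 f z)) (L (stem2 f z))) field_differentiable at z"
proof -
  define P where "P = (\<lambda>a b. Complex (L ((1/2) *\<^sub>R (a + b))) (L (- q_i * ((1/2) *\<^sub>R (a - b)))))"
  define c where "c = P (D (1,0)) (E (1,0))"
  have linD: "D (s, t) = s *\<^sub>R D (1,0) + t *\<^sub>R D (0,1)" and linE: "E (s, t) = s *\<^sub>R E (1,0) + t
    *\<^sub>R E (0,1)" for s t
  proof -
    interpret D: linear D using D(1) has_derivative_linear by blast
    interpret E: linear E using E(1) has_derivative_linear by blast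
    show "D (s, t) = s *\<^sub>R D (1,0) + t *\<^sub>R D (0,1)"
      unfolding D.scaleR [symmetric] D.add [symmetric] by simp
    show "E (s, t) = s *\<^sub>R E (1,0) + t *\<^sub>R E (0,1)"
      unfolding E.scaleR [symmetric] E.add [symmetric] by simp
  qed
  have d01: "D (0,1) = q_i * D (1,0)" "E (0,1) = - q_i * E (1,0)"
  proof -
    have "q_i * (D (1, 0) + q_i * D (0, 1)) = q_i * D (1,0) - D (0,1)"
      "- q_i * (E (1, 0) + - q_i * E (0, 1)) = - q_i * E (1,0) - E (0,1)"
      by (simp_all add: quat_eq_iff quat_times_sel)
    then show "D (0,1) = q_i * D (1,0)" "E (0,1) = - q_i * E (1,0)"
      unfolding D(2) E(2) by simp_all
  qed
  interpret L: bounded_linear L by (rule L)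
  have "((\<lambda>z. (\<lambda>(s, t). f (of_real s + q_i * of_real t)) (Re z, Im z)) has_derivative (\<lambda>h. D (Re
    h, Im h))) (at z)"
    by (rule has_derivative_compose [where f = "\<lambda>z. (Re z, Im z)" and f' = "\<lambda>h. (Re h, Im h)"
        and g = "\<lambda>(s, t). f (of_real s + q_i * of_real t)" and g' = D, OF _ D(1)]) (auto intro!:
          derivative_eq_intros)
  then have D': "((\<lambda>z. f (slice_pt q_i z)) has_derivative (\<lambda>h. D (Re h, Im h))) (at z)"
    by (simp add: slice_pt_def)
  have "((\<lambda>z. (\<lambda>(s, t). f (of_real s + - q_i * of_real t)) (Re z, Im z)) has_derivative (\<lambda>h. E (Re
    h, Im h))) (at z)"
    by (rule has_derivative_compose [where f = "\<lambda>z. (Re z, Im z)" and f' = "\<lambda>h. (Re h, Im h)"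
        and g = "\<lambda>(s, t). f (of_real s + - q_i * of_real t)" and g' = E, OF _ E(1)]) (auto intro!:
          derivative_eq_intros)
  then have E': "((\<lambda>z. f (slice_pt (- q_i) z)) has_derivative (\<lambda>h. E (Re h, Im h))) (at z)"
    by (simp add: slice_pt_def)
  have S1: "((\<lambda>z. L (stem1 f z)) has_derivative (\<lambda>h. L ((1/2) *\<^sub>R (D (Re h, Im h) + E (Re h, Im
    h))))) (at z)"
    unfolding stem1_def
    by (intro L.has_derivative has_derivative_scaleR_right has_derivative_add D' E')
  have S2: "((\<lambda>z. L (stem2 f z)) has_derivative (\<lambda>h. L (- q_i * ((1/2) *\<^sub>R (D (Re h, Im h) - E (Re
    h, Im h)))))) (at z)"
    unfolding stem2_def
    by (intro L.has_derivative has_derivative_mult_right has_derivative_scaleR_right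
      has_derivative_diff D' E')
  have "((\<lambda>z. Complex (L (stem1 f z)) (L (stem2 f z))) has_derivative (\<lambda>h. P (D (Re h, Im h)) (E
    (Re h, Im h)))) (at z)"
    unfolding P_def Complex_eq
    by (intro has_derivative_add has_derivative_mult_right has_derivative_of_real S1 S2)
  moreover have "P (D (Re h, Im h)) (E (Re h, Im h)) = c * h" for h
  proof -
    define u where "u = (1/2) *\<^sub>R (D (1,0) + E (1,0))"
    define v where "v = - q_i * ((1/2) *\<^sub>R (D (1,0) - E (1,0)))"
    have "q_i * (q_i * w) = - w" for w by (simp add: quat_eq_iff quat_times_sel)
    then have e: "(1/2) *\<^sub>R (D (Re h, Im h) + E (Re h, Im h)) = Re h *\<^sub>R u - Im h *\<^sub>R v"
      "- q_i * ((1/2) *\<^sub>R (D (Re h, Im h) - E (Re h, Im h))) = Re h *\<^sub>R v + Im h *\<^sub>R u"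
      unfolding linD [of "Re h"] linE [of "Re h"] d01 u_def v_def
      by (simp_all add: algebra_simps)
    have "P (D (Re h, Im h)) (E (Re h, Im h)) = Complex (L u) (L v) * h"
      unfolding P_def e by (simp add: complex_eq_iff L.add L.diff L.scaleR)
    then show ?thesis
      unfolding c_def P_def u_def v_def .
  qed
  ultimately have "((\<lambda>z. Complex (L (stem1 f z)) (L (stem2 f z))) has_field_derivative c) (at z)"
    by (simp add: has_field_derivative_def)
  then show ?thesis using field_differentiable_def by blast
qed

text \<open>From left to right this is the preceding lemma. Conversely, on the slice of \<open>I\<close> the
  function \<open>f\<close> is \<open>\<phi>\<^sub>0 + \<phi>\<^sub>1 q_i + \<phi>\<^sub>2 q_j + \<phi>\<^sub>3 q_k\<close> with holomorphic \<open>\<phi>\<^sub>l\<close>, whose values are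
  read in the slice. Each \<open>\<phi>\<^sub>l\<close> satisfies the Cauchy-Riemann equation for \<open>I\<close>, and
  multiplication by constants from the right preserves it.\<close>

lemma slice_regular_on_iff:
  assumes "open U" "circular U"
  shows "slice_regular_on U f \<longleftrightarrow> slice_fun U f \<and> hq_holo (stem f) (planar U)"
proof
  assume sr: "slice_regular_on U f"
  obtain F1 F2 :: "real \<Rightarrow> real \<Rightarrow> quat" where
    F: "\<And>x y I. I \<in> imag_units \<Longrightarrow> of_real x + I * of_real y \<in> U \<Longrightarrow> f (of_real x + I * of_real y) =
      F1 x y + I * F2 x y"
    using sr unfolding slice_regular_on_def by blast
  define \<phi> where "\<phi> = (\<lambda>z. Hq (Complex (qRe (F1 (Re z) (Im z))) (qRe (F2 (Re z) (Im z))))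
    (Complex (qIm1 (F1 (Re z) (Im z))) (qIm1 (F2 (Re z) (Im z)))) 
    (Complex (qIm2 (F1 (Re z) (Im z))) (qIm2 (F2 (Re z) (Im z)))) 
    (Complex (qIm3 (F1 (Re z) (Im z))) (qIm3 (F2 (Re z) (Im z)))))"
  have "slice_fun U f"
  proof (rule slice_funI(1) [OF _ assms(2)])
    fix I z assume "I \<in> imag_units" "slice_pt I z \<in> U"
    then show "f (slice_pt I z) = slice_val I (\<phi> z)"
      using F [of I "Re z" "Im z"] by (simp add: slice_pt_def slice_val_def \<phi>_def)
  qed
  moreover have "hq_holo (stem f) (planar U)"
  proof -
    have "(\<lambda>z. Complex (L (stem1 f z)) (L (stem2 f z))) holomorphic_on planar U" if L:
      "bounded_linear L" for L
    proof -
      have "(\<lambda>z. Complex (L (stem1 f z)) (L (stem2 f z))) field_differentiable at z" if z: "z \<in>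
        planar U" for z
      proof -
        have ex: "\<exists>D. ((\<lambda>(s, t). f (of_real s + I * of_real t)) has_derivative D) (at (Re z, Im
          z)) \<and>
             D (1, 0) + I * D (0, 1) = 0" if "I \<in> imag_units" for I
        proof -
          have mem: "of_real (Re z) + I * of_real (Im z) \<in> U"
            using circular_slice_pt_iff [OF assms(2) that] z by (simp add: slice_pt_def)
          note conjunct2 [OF sr [unfolded slice_regular_on_def], THEN bspec, OF that, THEN spec,
            THEN spec, THEN mp, OF mem]
          then obtain D where "((\<lambda>(s, t). f (of_real s + I * of_real t)) has_derivative D) (at (Re
            z, Im z))"
             "(1/2) *\<^sub>R (D (1, 0) + I * D (0, 1)) = 0" by (elim exE conjE)
          then show ?thesis by (intro exI [of _ D]) simp
        qed
        obtain D where D: "((\<lambda>(s, t). f (of_real s + q_i * of_real t)) has_derivative D) (at (Re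
          z, Im z))"
          "D (1, 0) + q_i * D (0, 1) = 0" using ex [of q_i] by auto
        obtain E where E: "((\<lambda>(s, t). f (of_real s + - q_i * of_real t)) has_derivative E) (at (Re
          z, Im z))"
          "E (1, 0) + - q_i * E (0, 1) = 0" using ex [of "- q_i"] by auto
        show ?thesis by (rule stem_component_has_derivative [OF L D E])
      qed
      then show ?thesis
        by (simp add: holomorphic_on_def field_differentiable_at_within)
    qed
    from this [OF bounded_linear_quat_sel(1)] this [OF bounded_linear_quat_sel(2)]
      this [OF bounded_linear_quat_sel(3)] this [OF bounded_linear_quat_sel(4)]
    show ?thesis by (simp add: hq_holo_def stem_def)
  qed
  ultimately show "slice_fun U f \<and> hq_holo (stem f) (planar U)" ..
next
  assume *: "slice_fun U f \<and> hq_holo (stem f) (planar U)"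
  have 1: "\<forall>I\<in>imag_units. \<forall>x y. of_real x + I * of_real y \<in> U \<longrightarrow>
        (\<exists>D. ((\<lambda>(s, t). f (of_real s + I * of_real t)) has_derivative D) (at (x, y)) \<and>
             (1/2) *\<^sub>R (D (1, 0) + I * D (0, 1)) = 0)"
  proof (intro ballI allI impI)
    fix I x y assume I: "I \<in> imag_units" and U: "of_real x + I * of_real y \<in> U"
    define z where "z = Complex x y"
    have z: "z \<in> planar U" using circular_slice_pt_iff [OF assms(2) I, of z] U by (simp add: z_def
      slice_pt_def)
    have op: "open (planar U)" using assms(1) by (rule open_planar)
    obtain c0 c1 c2 c3 where c:
      "((\<lambda>z. h0 (stem f z)) has_field_derivative c0) (at z)" "((\<lambda>z. h1 (stem f z))
        has_field_derivative c1) (at z)"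
      "((\<lambda>z. h2 (stem f z)) has_field_derivative c2) (at z)" "((\<lambda>z. h3 (stem f z))
        has_field_derivative c3) (at z)"
      using * z op unfolding hq_holo_def holomorphic_on_open [OF op] by blast
    define D where "D = (\<lambda>(s,t). slice_pt I (c0 * Complex s t) + slice_pt I (c1 * Complex s t) *
      q_i + slice_pt I (c2 * Complex s t) * q_j + slice_pt I (c3 * Complex s t) * q_k)"
    have Cpl: "((\<lambda>(s, t). Complex s t) has_derivative (\<lambda>(s, t). Complex s t)) (at (x, y))"
      unfolding Complex_eq case_prod_unfold
      by (auto intro!: derivative_eq_intros)
    have comp: "((\<lambda>(s, t). slice_pt I (\<phi> (Complex s t))) has_derivative (\<lambda>(s, t). slice_pt I (d *
      Complex s t))) (at (x, y))"
      if "(\<phi> has_field_derivative d) (at z)" for \<phi> d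
    proof -
      have "((\<lambda>w. \<phi> (case w of (s, t) \<Rightarrow> Complex s t)) has_derivative (\<lambda>w. d * (case w of (s, t) \<Rightarrow>
        Complex s t))) (at (x, y))"
        by (rule has_derivative_compose [OF Cpl]) (use that in \<open>simp add: z_def
          has_field_derivative_def\<close>)
      from bounded_linear.has_derivative [OF bounded_linear_slice_pt [of I] this]
      show ?thesis by (simp add: case_prod_unfold)
    qed
    have "((\<lambda>(s, t). slice_val I (stem f (Complex s t))) has_derivative D) (at (x, y))"
      unfolding slice_val_slice_pt_sum D_def case_prod_unfold
      using comp [OF c(1)] comp [OF c(2)] comp [OF c(3)] comp [OF c(4)] unfolding case_prod_unfold
      by (intro has_derivative_add has_derivative_mult_left)
    then have der: "((\<lambda>(s, t). f (of_real s + I * of_real t)) has_derivative D) (at (x, y))"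
    proof (rule has_derivative_transform_within_open)
      show "open ((\<lambda>(s, t). Complex s t) -` planar U)"
        by (intro open_vimage op) (auto simp: Complex_eq case_prod_unfold intro!: continuous_intros)
      show "(x, y) \<in> (\<lambda>(s, t). Complex s t) -` planar U" using z by (simp add: z_def)
      fix w assume "w \<in> (\<lambda>(s, t). Complex s t) -` planar U"
      then have "slice_pt I (Complex (fst w) (snd w)) \<in> U"
        using circular_slice_pt_iff [OF assms(2) I] by (auto simp: case_prod_unfold)
      then have "f (slice_pt I (Complex (fst w) (snd w))) = slice_val I (stem f (Complex (fst w)
        (snd w)))"
        using * I unfolding slice_fun_def by blast
      then show "(case w of (s, t) \<Rightarrow> slice_val I (stem f (Complex s t))) = (case w of (s, t) \<Rightarrow> f
        (of_real s + I * of_real t))"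
        by (simp add: case_prod_unfold slice_pt_def)
    qed
    \<comment> \<open>In complex terms the derivative is \<open>h \<mapsto> c h\<close>, and \<open>I\<close> times its value at \<open>i\<close> cancels its
      value at \<open>1\<close>.\<close>
    have cr: "D (1, 0) + I * D (0, 1) = 0"
    proof -
      have "slice_pt I (d * Complex 0 1) = I * slice_pt I d" for d
      proof -
        have "slice_pt I (Complex 0 1) = I" by (simp add: slice_pt_def)
        then show ?thesis using slice_pt_mult [OF I, of "Complex 0 1" d] by (simp add: mult.commute)
      qed
      moreover have "Complex 1 0 = 1" by (simp add: complex_eq_iff)
      moreover have "I * (I * v) = - v" for v
        using imag_units_sq [OF I] by (simp add: mult.assoc [symmetric])
      ultimately show ?thesis by (simp add: D_def distrib_left mult.assoc)
    qed
    show "\<exists>D. ((\<lambda>(s, t). f (of_real s + I * of_real t)) has_derivative D) (at (x, y)) \<and>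
             (1/2) *\<^sub>R (D (1, 0) + I * D (0, 1)) = 0"
      using der cr by (intro exI [of _ D]) simp
  qed
  have 2: "\<exists>F1 F2 :: real \<Rightarrow> real \<Rightarrow> quat.
        (\<forall>x y. F1 x (- y) = F1 x y) \<and> (\<forall>x y. F2 x (- y) = - F2 x y) \<and>
        (\<forall>x y. \<forall>I\<in>imag_units. of_real x + I * of_real y \<in> U \<longrightarrow>
           f (of_real x + I * of_real y) = F1 x y + I * F2 x y)"
  proof (rule exI [of _ "\<lambda>x y. stem1 f (Complex x y)"], rule exI [of _ "\<lambda>x y. stem2 f (Complex x
    y)"],
      intro conjI allI ballI impI)
    fix x y :: real
    have "Complex x (- y) = cnj (Complex x y)" by (simp add: complex_eq_iff)
    then show "stem1 f (Complex x (- y)) = stem1 f (Complex x y)" "stem2 f (Complex x (- y)) = -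
      stem2 f (Complex x y)"
      by (simp_all add: stem_parts_cnj)
    fix I assume "I \<in> imag_units" "of_real x + I * of_real y \<in> U"
    then have "f (slice_pt I (Complex x y)) = slice_val I (stem f (Complex x y))"
      using *[THEN conjunct1, unfolded slice_fun_def, THEN bspec, of I, THEN spec, THEN mp, of
        "Complex x y"]
      by (simp add: slice_pt_def)
    then show "f (of_real x + I * of_real y) = stem1 f (Complex x y) + I * stem2 f (Complex x y)"
      by (simp add: slice_val_def stem_def slice_pt_def)
  qed
  show "slice_regular_on U f"
    unfolding slice_regular_on_def by (intro conjI 1 2)
qed

section \<open>Semi-regular functions have meromorphic stem functions\<close>

text \<open>Allows statements about all four components of a stem function to be proved at once.\<close>

definition hq_coords :: "('a hq \<Rightarrow> 'a) set" where
  "hq_coords = {h0, h1, h2, h3}"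

lemma hq_holo_iff: "hq_holo \<phi> A \<longleftrightarrow> (\<forall>c\<in>hq_coords. (\<lambda>z. c (\<phi> z)) holomorphic_on A)"
  by (simp add: hq_holo_def hq_coords_def)

lemma hq_coords_hq_cnj: "c \<in> hq_coords \<Longrightarrow> c (hq_cnj h) = cnj (c h)"
  by (auto simp: hq_coords_def)

lemma hq_coords_hq_scalar: "c \<in> hq_coords \<Longrightarrow> c (hq_scalar a * h) = a * c h"
  by (auto simp: hq_coords_def hq_times_sel)

lemma finite_hq_coords: "finite hq_coords"
  by (simp add: hq_coords_def)

definition hq_mero :: "(complex \<Rightarrow> complex hq) \<Rightarrow> complex set \<Rightarrow> bool" where
  "hq_mero \<phi> A \<longleftrightarrow> (\<forall>c\<in>hq_coords. (\<lambda>z. c (\<phi> z)) meromorphic_on A)"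

text \<open>The stem function of \<open>\<Delta>\<^sub>p\<close> for \<open>p\<close> on the sphere of \<open>z\<close>; it is a scalar.\<close>

definition sdelta :: "complex \<Rightarrow> complex \<Rightarrow> complex" where
  "sdelta z w = (w - z) * (w - cnj z)"

lemma sdelta_cnj: "sdelta z (cnj w) = cnj (sdelta z w)" "sdelta (cnj z) w = sdelta z w"
  by (simp_all add: sdelta_def mult.commute)

lemma sdelta_eq_0_iff: "sdelta z w = 0 \<longleftrightarrow> w = z \<or> w = cnj z"
  by (simp add: sdelta_def)

lemma qDelta_slice_pt:
  assumes "I \<in> imag_units" "J \<in> imag_units"
  shows "qDelta (slice_pt J z) (slice_pt I w) = slice_pt I (sdelta z w)"
proof -
  have "(norm (slice_pt J z))\<^sup>2 = (Re z)\<^sup>2 + ((qIm1 J)\<^sup>2 + (qIm2 J)\<^sup>2 + (qIm3 J)\<^sup>2) * (Im z)\<^sup>2"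
  proof -
    have "qRe J = 0" using assms by (simp add: imag_units_iff)
    then show ?thesis by (simp add: norm_quat_def power_mult_distrib distrib_right)
  qed
  then have n: "(norm (slice_pt J z))\<^sup>2 = (Re z)\<^sup>2 + (Im z)\<^sup>2" using assms by (simp add:
    imag_units_iff)
  have "sdelta z w = w * w + (of_real (- (2 * Re z)) * w + of_real ((Re z)\<^sup>2 + (Im z)\<^sup>2))"
    by (simp add: sdelta_def complex_eq_iff algebra_simps power2_eq_square)
  then have "slice_pt I (sdelta z w) = slice_pt I w * slice_pt I w + (of_real (- (2 * Re z)) *
    slice_pt I w + of_real ((Re z)\<^sup>2 + (Im z)\<^sup>2))"
    using assms(1) by (simp only: slice_pt_add slice_pt_mult slice_pt_of_real)
  moreover have Re: "qRe (slice_pt J z) = Re z" using assms(2) by (simp add: imag_units_iff)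
  ultimately show ?thesis unfolding qDelta_def n Re by (simp add: power2_eq_square)
qed

lemma slice_pt_in_qsphere_iff:
  assumes "I \<in> imag_units" "J \<in> imag_units"
  shows "slice_pt I w \<in> qsphere (slice_pt J z) \<longleftrightarrow> w = z \<or> w = cnj z"
proof
  assume "slice_pt I w \<in> qsphere (slice_pt J z)"
  then obtain L where L: "L \<in> imag_units" "slice_pt I w = slice_pt L z" using qsphere_slice_pt [OF
    assms(2)] by auto
  then have "upper_pt (slice_pt I w) = upper_pt (slice_pt L z)" by simp
  then show "w = z \<or> w = cnj z"
    unfolding upper_pt_slice_pt [OF L(1)] upper_pt_slice_pt [OF assms(1)] by (auto split: if_splits)
next
  assume "w = z \<or> w = cnj z"
  then show "slice_pt I w \<in> qsphere (slice_pt J z)"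
  proof
    assume "w = z" then show ?thesis using assms qsphere_slice_pt [OF assms(2)] by blast
  next
    assume "w = cnj z"
    then have "slice_pt I w = slice_pt (- I) z" by (simp add: slice_pt_cnj)
    moreover have "- I \<in> imag_units" using assms(1) by simp
    ultimately show ?thesis using qsphere_slice_pt [OF assms(2)] by blast
  qed
qed

text \<open>The characterization of semi-regularity in terms of stem functions: singular spheres
  become isolated points of the planar trace of \<open>\<Omega>\<close> outside that of \<open>U\<close>, and the condition on
  \<open>\<Delta>\<^sub>p\<^sup>m f\<close> becomes meromorphy of the components.\<close>

definition regular_on_dense :: "quat set \<Rightarrow> quat set \<Rightarrow> (quat \<Rightarrow> quat) \<Rightarrow> bool" where
  "regular_on_dense \<Omega> U f \<longleftrightarrow> U \<subseteq> \<Omega> \<and> open U \<and> circular U \<and> slice_fun U f \<and> hq_holo (stem f) (planar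
    U) \<and>
     hq_mero (stem f) (planar \<Omega>) \<and> (\<forall>z\<in>planar \<Omega>. \<forall>\<^sub>F w in at z. w \<in> planar U)"

lemma planar_mono: "U \<subseteq> V \<Longrightarrow> planar U \<subseteq> planar V"
  by (auto simp: planar_def)

text \<open>Near a singular sphere \<open>\<Delta>\<^sub>p\<^sup>m f\<close> extends to a slice regular \<open>g\<close>. Passing to stem
  functions, the components of \<open>f\<close> are quotients of holomorphic functions by a power of a
  polynomial.\<close>

lemma semireg_imp_regular_on_dense:
  assumes \<Omega>: "open \<Omega>" "circular \<Omega>" and sr: "(U, f) \<in> semireg \<Omega>"
  shows "regular_on_dense \<Omega> U f"
proof -
  have U: "U \<subseteq> \<Omega>" "open U" "circular U" "slice_regular_on U f"
    and poles: "\<And>p. p \<in> \<Omega> - U \<Longrightarrow> \<exists>W g. \<exists>m::nat.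
        p \<in> W \<and> W \<subseteq> \<Omega> \<and> open W \<and> circular W \<and> W - qsphere p \<subseteq> U \<and>
        slice_regular_on W g \<and> (\<forall>q\<in>W - qsphere p. g q = qDelta p q ^ m * f q)"
    using sr by (auto simp: semireg_def)
  have f: "slice_fun U f" "hq_holo (stem f) (planar U)"
    using U slice_regular_on_iff by blast+
  have local: "(\<forall>\<^sub>F w in at z. w \<in> planar U) \<and> (\<forall>c\<in>hq_coords. (\<lambda>z. c (stem f z)) meromorphic_on
    {z})"
    if z: "z \<in> planar \<Omega>" for z
  proof (cases "z \<in> planar U")
    case True
    have op: "open (planar U)" using U(2) by (rule open_planar)
    have "\<forall>\<^sub>F w in at z. w \<in> planar U" using eventually_at_in_open' [OF op True] .
    moreover have "(\<lambda>z. c (stem f z)) meromorphic_on {z}" if "c \<in> hq_coords" for c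
    proof -
      have "(\<lambda>z. c (stem f z)) analytic_on {z}"
        using f(2) that True op unfolding hq_holo_iff by (meson holomorphic_on_imp_analytic_at)
      then show ?thesis by (rule analytic_on_imp_meromorphic_on)
    qed
    ultimately show ?thesis by blast
  next
    case False
    define p where "p = slice_pt q_i z"
    have p: "p \<in> \<Omega> - U" using z False by (simp add: p_def planar_def)
    obtain W g and m :: nat where W: "p \<in> W" "W \<subseteq> \<Omega>" "open W" "circular W" "W - qsphere p \<subseteq> U"
        "slice_regular_on W g" and Wg: "\<forall>q\<in>W - qsphere p. g q = qDelta p q ^ m * f q"
      using poles [OF p] by (elim exE conjE) (rule that; assumption)
    have zW: "z \<in> planar W" using W(1) by (simp add: planar_def p_def)
    have opW: "open (planar W)" using W(3) by (rule open_planar)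
    have g: "slice_fun W g" "hq_holo (stem g) (planar W)"
      using W(3,4,6) slice_regular_on_iff by blast+
    have ev: "\<forall>\<^sub>F w in at z. w \<in> planar W - {cnj z} - {z}"
    proof -
      have "\<forall>\<^sub>F w in at z. w \<in> planar W" using eventually_at_in_open' [OF opW zW] .
      moreover have "\<forall>\<^sub>F w in at z. w \<noteq> z" by (rule eventually_neq_at_within)
      moreover have "\<forall>\<^sub>F w in at z. w \<noteq> cnj z"
        by (rule eventually_neq_at_within)
      ultimately show ?thesis by eventually_elim auto
    qed
    have inU: "w \<in> planar U" and st: "stem g w = hq_scalar (sdelta z w ^ m) * stem f w"
      if w: "w \<in> planar W - {cnj z} - {z}" for w
    proof -
      have *: "slice_pt I w \<in> W - qsphere p" if "I \<in> imag_units" for I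
        using w circular_slice_pt_iff [OF W(4) that, of w] slice_pt_in_qsphere_iff [OF that
          imag_units_basic(1)]
        by (auto simp: p_def)
      then have "slice_pt q_i w \<in> U" using W(5) by auto
      then show "w \<in> planar U" by (simp add: planar_def)
      have "g (slice_pt I w) = slice_val I (hq_scalar (sdelta z w ^ m) * stem f w)" if I: "I \<in>
        imag_units" for I
      proof -
        have "slice_pt I w \<in> U" using * [OF I] W(5) by auto
        then have "f (slice_pt I w) = slice_val I (stem f w)" using f(1) I by (simp add:
          slice_fun_def)
        then show ?thesis
          using bspec [OF Wg * [OF I]] I by (simp add: slice_val_hq_scalar_mult slice_pt_power
            p_def qDelta_slice_pt)
      qed
      then show "stem g w = hq_scalar (sdelta z w ^ m) * stem f w"
        by (intro stem_eqI) (simp_all only: imag_units_basic)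
    qed
    have "(\<lambda>z. c (stem f z)) meromorphic_on {z}" if c: "c \<in> hq_coords" for c
    proof -
      have "(\<lambda>z. c (stem g z)) analytic_on {z}"
        using g(2) c zW opW unfolding hq_holo_iff by (meson holomorphic_on_imp_analytic_at)
      moreover have "(\<lambda>w. sdelta z w ^ m) analytic_on {z}"
        unfolding sdelta_def by (intro analytic_intros)
      ultimately have "(\<lambda>w. c (stem g w) / sdelta z w ^ m) meromorphic_on {z}"
        by (intro meromorphic_on_divide analytic_on_imp_meromorphic_on)
      moreover have "\<forall>\<^sub>F w in at z. c (stem g w) / sdelta z w ^ m = c (stem f w)"
        using ev
      proof eventually_elim
        case (elim w)
        then have "sdelta z w \<noteq> 0" by (auto simp: sdelta_eq_0_iff)
        then show ?case using st [OF elim] c by (simp add: hq_coords_hq_scalar)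
      qed
      ultimately show ?thesis
        using meromorphic_on_cong [of "{z}" "\<lambda>w. c (stem g w) / sdelta z w ^ m" "\<lambda>w. c (stem f w)"
          "{z}"] by simp
    qed
    moreover have "\<forall>\<^sub>F w in at z. w \<in> planar U"
      using ev by eventually_elim (rule inU)
    ultimately show ?thesis by blast
  qed
  then have "hq_mero (stem f) (planar \<Omega>)"
    unfolding hq_mero_def by (subst meromorphic_on_meromorphic_at) blast
  then show ?thesis using U f local by (simp add: regular_on_dense_def)
qed

text \<open>Because \<open>d\<close> has a zero at \<open>z\<close>, the order of \<open>d\<^sup>m f\<close> there is at least \<open>m\<close> plus the order
  of \<open>f\<close>.\<close>

lemma power_times_meromorphic_not_pole:
  assumes f: "f meromorphic_on {z}" and d: "d analytic_on {z}" "d z = 0"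
  obtains n :: nat where "\<And>m. m \<ge> n \<Longrightarrow> \<exists>c. (\<lambda>w. d w ^ m * f w) \<midarrow>z\<rightarrow> c"
proof -
  obtain F where F: "(\<lambda>w. f (z + w)) has_laurent_expansion F"
    using f unfolding meromorphic_on_def by blast
  have dm: "d meromorphic_on {z}" using d(1) by (rule analytic_on_imp_meromorphic_on)
  then obtain D where D: "(\<lambda>w. d (z + w)) has_laurent_expansion D"
    unfolding meromorphic_on_def by blast
  have "isCont d z" using d(1) analytic_at_imp_isCont by blast
  then have "d \<midarrow>z\<rightarrow> 0" using d(2) by (simp add: isCont_def)
  then have sd: "D \<noteq> 0 \<Longrightarrow> fls_subdegree D > 0" using tendsto_0_subdegree_iff [OF D] by blast
  show ?thesis
  proof (rule that [of "nat (- fls_subdegree F)"])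
    fix m assume m: "m \<ge> nat (- fls_subdegree F)"
    have exp: "(\<lambda>w. d (z + w) ^ m * f (z + w)) has_laurent_expansion D ^ m * F"
      by (intro laurent_expansion_intros D F)
    have "fls_subdegree (D ^ m * F) \<ge> 0"
    proof (cases "D ^ m * F = 0")
      case False
      then have "fls_subdegree (D ^ m * F) = int m * fls_subdegree D + fls_subdegree F"
        by (simp add: fls_subdegree_pow)
      moreover have "m = 0 \<or> D \<noteq> 0" using False by (cases m) auto
      then have "int m * fls_subdegree D \<ge> int m" using sd
        by (auto simp: mult_le_cancel_left1)
      ultimately show ?thesis using m by linarith
    next
      case True
      show ?thesis unfolding True by simp
    qed
    then have "\<not> is_pole (\<lambda>w. d w ^ m * f w) z"
      using is_pole_fls_subdegree_iff [of "\<lambda>w. d w ^ m * f w" z, OF exp] by simp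
    moreover have "(\<lambda>w. d w ^ m * f w) meromorphic_on {z}"
      by (intro meromorphic_intros dm f)
    then have "not_essential (\<lambda>w. d w ^ m * f w) z" by (rule meromorphic_on_not_essential)
    ultimately show "\<exists>c. (\<lambda>w. d w ^ m * f w) \<midarrow>z\<rightarrow> c" unfolding not_essential_def by blast
  qed
qed

lemma tendsto_cnj_symmetric:
  assumes "\<And>w. f (cnj w) = cnj (f w)" "f \<midarrow>z\<rightarrow> c"
  shows "f \<midarrow>cnj z\<rightarrow> cnj c"
  unfolding LIM_def
proof (intro allI impI)
  fix r :: real assume "r > 0"
  then obtain s where s: "s > 0" "\<And>w. w \<noteq> z \<Longrightarrow> dist w z < s \<Longrightarrow> dist (f w) c < r"
    using assms(2) unfolding LIM_def by blast
  have dc: "dist u (cnj v) = dist (cnj u) v" for u v :: complex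
    by (metis complex_cnj_cnj complex_cnj_diff complex_mod_cnj dist_norm)
  have "dist (f w) (cnj c) < r" if "w \<noteq> cnj z" "dist w (cnj z) < s" for w
    using s(2) [of "cnj w"] that by (metis assms(1) complex_cnj_cnj dc)
  then show "\<exists>s>0. \<forall>w. w \<noteq> cnj z \<and> dist w (cnj z) < s \<longrightarrow> dist (f w) (cnj c) < r"
    using s(1) by blast
qed

lemma remove_sings_cnj_symmetric:
  assumes "\<And>w. f (cnj w) = cnj (f w)"
  shows "remove_sings f (cnj z) = cnj (remove_sings f z)"
proof (cases "\<exists>c. f \<midarrow>z\<rightarrow> c")
  case True
  then obtain c where c: "f \<midarrow>z\<rightarrow> c" by blast
  show ?thesis
    using remove_sings_eqI [OF c] remove_sings_eqI [OF tendsto_cnj_symmetric [where f = f, OF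
      assms c]] by simp
next
  case False
  then have "\<not> (\<exists>c. f \<midarrow>cnj z\<rightarrow> c)"
    using tendsto_cnj_symmetric [where f = f and z = "cnj z", OF assms] by auto
  then show ?thesis using False by (simp add: remove_sings_def)
qed

text \<open>Around a singular sphere, take \<open>W\<close> over a small disc around \<open>z\<close> and its mirror image. Some
  power of \<open>sdelta z\<close> cancels the poles of all four components at \<open>z\<close>, hence by symmetry at the
  conjugate of \<open>z\<close>, and the extended components are again the stem function of a slice regular
  function on \<open>W\<close>.\<close>

lemma regular_on_dense_imp_semireg:
  assumes \<Omega>: "open \<Omega>" "circular \<Omega>" and rd: "regular_on_dense \<Omega> U f"
  shows "(U, f) \<in> semireg \<Omega>"
proof -
  have U: "U \<subseteq> \<Omega>" "open U" "circular U" "slice_fun U f" "hq_holo (stem f) (planar U)" "hq_mero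
    (stem f) (planar \<Omega>)"
    and ev: "\<And>z. z \<in> planar \<Omega> \<Longrightarrow> \<forall>\<^sub>F w in at z. w \<in> planar U"
    using rd by (auto simp: regular_on_dense_def)
  have op\<Omega>: "open (planar \<Omega>)" using \<Omega>(1) by (rule open_planar)
  have opU: "open (planar U)" using U(2) by (rule open_planar)
  have "\<exists>W g. \<exists>m::nat.
        p \<in> W \<and> W \<subseteq> \<Omega> \<and> open W \<and> circular W \<and> W - qsphere p \<subseteq> U \<and>
        slice_regular_on W g \<and> (\<forall>q\<in>W - qsphere p. g q = qDelta p q ^ m * f q)" if p: "p \<in> \<Omega> - U"
          for p
  proof -
    define z where "z = upper_pt p"
    have p_eq: "p = slice_pt (imag_dir p) z" by (simp add: z_def slice_pt_upper_pt)
    note Ip = imag_dir_imag_unit [of p]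
    have z: "z \<in> planar \<Omega>" using p upper_pt_planar [OF \<Omega>(2)] by (simp add: z_def)
    obtain r where r: "r > 0" "ball z r \<subseteq> planar \<Omega>" "ball z r - {z} \<subseteq> planar U"
    proof -
      obtain r1 where r1: "r1 > 0" "ball z r1 \<subseteq> planar \<Omega>" using op\<Omega> z open_contains_ball by blast
      obtain r2 where r2: "r2 > 0" "\<And>w. w \<noteq> z \<Longrightarrow> dist w z < r2 \<Longrightarrow> w \<in> planar U"
        using ev [OF z] unfolding eventually_at by blast
      show ?thesis
      proof (rule that [of "min r1 r2"])
        show "ball z (min r1 r2) - {z} \<subseteq> planar U"
        proof
          fix x assume "x \<in> ball z (min r1 r2) - {z}"
          then show "x \<in> planar U" using r2(2) [of x] by (simp add: dist_commute)
        qed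
      qed (use r1 r2(1) in auto)
    qed
    define B where "B = ball z r \<union> cnj ` ball z r"
    have Bsym: "cnj w \<in> B \<longleftrightarrow> w \<in> B" for w
      unfolding B_def by (metis Un_iff complex_cnj_cnj image_iff)
    have "cnj ` ball z r = ball (cnj z) r"
    proof -
      have "dist (cnj z) (cnj u) = dist z u" for u
        by (metis complex_cnj_diff complex_mod_cnj dist_norm)
      note dist_cnj = this
      show ?thesis
      proof (intro equalityI subsetI)
        fix x assume "x \<in> ball (cnj z) r"
        then have "cnj x \<in> ball z r" using dist_cnj [of "cnj x"] by simp
        then show "x \<in> cnj ` ball z r" by (rule rev_image_eqI) simp
      qed (auto simp: dist_cnj)
    qed
    then have opB: "open B" by (simp add: B_def open_Un)
    have B\<Omega>: "B \<subseteq> planar \<Omega>" using r(2) planar_cnj [OF \<Omega>(2)] by (auto simp: B_def)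
    have BU: "w \<in> planar U" if "w \<in> B" "w \<noteq> z" "w \<noteq> cnj z" for w
      using that r(3) planar_cnj [OF U(3)] by (auto simp: B_def)
    have zB: "z \<in> B" using r(1) by (simp add: B_def)
    have "\<exists>n. \<forall>m\<ge>n. \<exists>l. (\<lambda>w. sdelta z w ^ m * c (stem f w)) \<midarrow>z\<rightarrow> l" if "c \<in> hq_coords" for c
    proof -
      have "(\<lambda>w. c (stem f w)) meromorphic_on {z}"
        using U(6) that z unfolding hq_mero_def by (meson meromorphic_on_subset empty_subsetI
          insert_subset)
      moreover have "sdelta z analytic_on {z}"
        unfolding sdelta_def [abs_def] by (intro analytic_intros)
      moreover have "sdelta z z = 0" by (simp add: sdelta_eq_0_iff)
      ultimately show ?thesis by (rule power_times_meromorphic_not_pole) blast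
    qed
    then obtain n where n: "\<And>c m. c \<in> hq_coords \<Longrightarrow> m \<ge> n c \<Longrightarrow> \<exists>l. (\<lambda>w. sdelta z w ^ m * c (stem f
      w)) \<midarrow>z\<rightarrow> l"
      by metis
    define m where "m = Max (n ` hq_coords)"
    have lim_z: "\<exists>l. (\<lambda>w. sdelta z w ^ m * c (stem f w)) \<midarrow>z\<rightarrow> l" if "c \<in> hq_coords" for c
    proof (rule n [OF that])
      show "n c \<le> m" unfolding m_def by (rule Max_ge) (use that finite_hq_coords in auto)
    qed
    have sym: "sdelta z (cnj w) ^ m * c (stem f (cnj w)) = cnj (sdelta z w ^ m * c (stem f w))" if
      "c \<in> hq_coords" for c w
      using that by (simp add: sdelta_cnj stem_cnj hq_coords_hq_cnj)
    have lim: "\<exists>l. (\<lambda>w. sdelta z w ^ m * c (stem f w)) \<midarrow>u\<rightarrow> l" if c: "c \<in> hq_coords" and u: "u = z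
      \<or> u = cnj z" for c u
      using u
    proof
      assume "u = z" then show ?thesis using lim_z [OF c] by simp
    next
      assume u: "u = cnj z"
      obtain l where "(\<lambda>w. sdelta z w ^ m * c (stem f w)) \<midarrow>z\<rightarrow> l" using lim_z [OF c] by blast
      from tendsto_cnj_symmetric [where f = "\<lambda>w. sdelta z w ^ m * c (stem f w)", OF sym [OF c]
        this] u show ?thesis by blast
    qed
    define \<gamma>c where "\<gamma>c = (\<lambda>c :: complex hq \<Rightarrow> complex. remove_sings (\<lambda>w. sdelta z w ^ m * c (stem
      f w)))"
    have \<gamma>c_sym: "\<gamma>c c (cnj w) = cnj (\<gamma>c c w)" if "c \<in> hq_coords" for c w
      unfolding \<gamma>c_def by (rule remove_sings_cnj_symmetric [where f = "\<lambda>w. sdelta z w ^ m * c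
        (stem f w)", OF sym [OF that]])
    have an: "(\<lambda>w. sdelta z w ^ m * c (stem f w)) analytic_on {u}" if "c \<in> hq_coords" "u \<in> planar
      U" for c u
    proof -
      have "(\<lambda>w. c (stem f w)) analytic_on {u}"
        using U(5) that opU unfolding hq_holo_iff by (meson holomorphic_on_imp_analytic_at)
      moreover have "(\<lambda>w. sdelta z w ^ m) analytic_on {u}"
        unfolding sdelta_def by (intro analytic_intros)
      ultimately show ?thesis by (intro analytic_on_mult)
    qed
    have \<gamma>c_eq: "\<gamma>c c u = sdelta z u ^ m * c (stem f u)" if "c \<in> hq_coords" "u \<in> planar U" for c u
      unfolding \<gamma>c_def by (rule remove_sings_at_analytic [OF an [OF that]])
    have \<gamma>c_an: "\<gamma>c c analytic_on {u}" if c: "c \<in> hq_coords" and u: "u \<in> B" for c u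
    proof (cases "u = z \<or> u = cnj z")
      case False
      then have "u \<in> planar U" using BU u by blast
      from remove_sings_analytic_on [OF an [OF c this]] show ?thesis by (simp add: \<gamma>c_def)
    next
      case True
      obtain l where l: "(\<lambda>w. sdelta z w ^ m * c (stem f w)) \<midarrow>u\<rightarrow> l" using lim [OF c True] by blast
      have "u \<in> planar \<Omega>" using B\<Omega> u by blast
      then have "(\<lambda>w. c (stem f w)) meromorphic_on {u}"
        using U(6) c unfolding hq_mero_def by (meson meromorphic_on_subset empty_subsetI
          insert_subset)
      moreover have "(\<lambda>w. sdelta z w ^ m) meromorphic_on {u}"
        unfolding sdelta_def by (intro analytic_on_imp_meromorphic_on analytic_intros)
      ultimately have "(\<lambda>w. sdelta z w ^ m * c (stem f w)) meromorphic_on {u}"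
        by (intro meromorphic_on_mult)
      then have "isolated_singularity_at (\<lambda>w. sdelta z w ^ m * c (stem f w)) u"
        by (rule meromorphic_on_isolated_singularity)
      then show ?thesis unfolding \<gamma>c_def by (rule remove_sings_analytic_at [OF _ l])
    qed
    define \<gamma> where "\<gamma> = (\<lambda>w. Hq (\<gamma>c h0 w) (\<gamma>c h1 w) (\<gamma>c h2 w) (\<gamma>c h3 w))"
    have h: "h0 \<in> hq_coords" "h1 \<in> hq_coords" "h2 \<in> hq_coords" "h3 \<in> hq_coords" by (simp_all add:
      hq_coords_def)
    have \<gamma>_sym: "\<gamma> (cnj w) = hq_cnj (\<gamma> w)" for w
      by (simp add: \<gamma>_def hq_cnj_def \<gamma>c_sym h)
    have \<gamma>_eq: "\<gamma> w = hq_scalar (sdelta z w ^ m) * stem f w" if "w \<in> planar U" for w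
      using that by (simp add: \<gamma>_def hq_eq_iff \<gamma>c_eq h hq_coords_hq_scalar)
    have "hq_holo \<gamma> B"
      unfolding hq_holo_def \<gamma>_def hq.sel
      using \<gamma>c_an h by (auto intro!: analytic_imp_holomorphic simp: analytic_on_analytic_at [of _
        B])
    define W where "W = lift B"
    have plW: "planar W = B" unfolding W_def by (rule planar_lift [OF Bsym])
    have circW: "circular W" unfolding W_def by (rule circular_lift [OF Bsym])
    have opW: "open W" unfolding W_def by (rule open_lift [OF opB])
    have "stem (slice_ext \<gamma>) = \<gamma>" using stem_slice_ext [where \<phi> = \<gamma>, OF \<gamma>_sym] by blast
    then have "slice_regular_on W (slice_ext \<gamma>)"
      using \<open>hq_holo \<gamma> B\<close> slice_fun_slice_ext [where \<phi> = \<gamma>, OF \<gamma>_sym]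
      by (simp add: slice_regular_on_iff [OF opW circW] plW)
    moreover have "p \<in> W" using zB upper_pt_planar [OF circW, of p] by (simp add: plW z_def)
    moreover have "W \<subseteq> \<Omega>"
    proof
      fix q assume "q \<in> W"
      then have "upper_pt q \<in> planar \<Omega>" using upper_pt_planar [OF circW, of q] plW B\<Omega> by blast
      then show "q \<in> \<Omega>" using upper_pt_planar [OF \<Omega>(2)] by blast
    qed
    moreover have away: "upper_pt q \<in> planar U" if "q \<in> W - qsphere p" for q
    proof (rule BU)
      show "upper_pt q \<in> B" using upper_pt_planar [OF circW, of q] plW that by blast
      have "\<not> (upper_pt q = z \<or> upper_pt q = cnj z)"
        using that slice_pt_in_qsphere_iff [OF imag_dir_imag_unit Ip, of q "upper_pt q" z]
          unfolding p_eq [symmetric] by (simp add: slice_pt_upper_pt)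
      then show "upper_pt q \<noteq> z" "upper_pt q \<noteq> cnj z" by blast+
    qed
    moreover have "W - qsphere p \<subseteq> U" using away upper_pt_planar [OF U(3)] by blast
    moreover have "slice_ext \<gamma> q = qDelta p q ^ m * f q" if q: "q \<in> W - qsphere p" for q
    proof -
      have "q \<in> U" using away [OF q] upper_pt_planar [OF U(3)] by blast
      then have "f (slice_pt (imag_dir q) (upper_pt q)) = slice_val (imag_dir q) (stem f (upper_pt
        q))"
        using U(4) imag_dir_imag_unit unfolding slice_fun_def by (metis slice_pt_upper_pt)
      then have "f q = slice_val (imag_dir q) (stem f (upper_pt q))" by (simp add:
        slice_pt_upper_pt)
      moreover have "qDelta p q = slice_pt (imag_dir q) (sdelta z (upper_pt q))"
        using qDelta_slice_pt [OF imag_dir_imag_unit Ip, of z q "upper_pt q"] unfolding p_eq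
          [symmetric] by (simp add: slice_pt_upper_pt)
      ultimately show ?thesis
        using \<gamma>_eq [OF away [OF q]] by (simp add: slice_ext_def slice_val_hq_scalar_mult
          imag_dir_imag_unit slice_pt_power)
    qed
    ultimately show ?thesis using opW circW by blast
  qed
  moreover have "slice_regular_on U f" using U slice_regular_on_iff by blast
  ultimately show ?thesis using U by (simp add: semireg_def)
qed

section \<open>Germs of semi-regular functions at a base point\<close>

lemma slice_fun_upper_pt:
  assumes "slice_fun U f" "q \<in> U"
  shows "f q = slice_val (imag_dir q) (stem f (upper_pt q))"
  using assms(1) [unfolded slice_fun_def, THEN bspec, OF imag_dir_imag_unit [of q], THEN spec, of
    "upper_pt q"] assms(2)
  by (simp add: slice_pt_upper_pt)

lemma open_eventually_at: "open {z::complex. \<forall>\<^sub>F w in at z. P w}"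
proof (subst open_subopen, rule ballI)
  fix z :: complex assume "z \<in> {z. \<forall>\<^sub>F w in at z. P w}"
  then obtain S where S: "open S" "z \<in> S" "\<And>w. w \<in> S \<Longrightarrow> w \<noteq> z \<Longrightarrow> P w"
    by (auto simp: eventually_at_topological)
  have "S \<subseteq> {z. \<forall>\<^sub>F w in at z. P w}"
  proof
    fix w assume w: "w \<in> S"
    show "w \<in> {z. \<forall>\<^sub>F w in at z. P w}"
    proof (cases "w = z")
      case True then show ?thesis using S by (auto simp: eventually_at_topological)
    next
      case False
      then have "open (S - {z})" "w \<in> S - {z}" using S w by (auto intro: open_delete)
      then have "\<forall>\<^sub>F u in at w. u \<in> S - {z}" by (rule eventually_at_in_open')
      then have "\<forall>\<^sub>F u in at w. P u" by eventually_elim (use S(3) in blast)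
      then show ?thesis by simp
    qed
  qed
  then show "\<exists>T. open T \<and> z \<in> T \<and> T \<subseteq> {z. \<forall>\<^sub>F w in at z. P w}" using S by blast
qed

lemma eventually_at_cnj:
  assumes "\<forall>\<^sub>F w in at z. P w"
  shows "\<forall>\<^sub>F w in at (cnj z). P (cnj w)"
proof -
  obtain r where r: "r > 0" "\<And>w. w \<noteq> z \<Longrightarrow> dist w z < r \<Longrightarrow> P w"
    using assms unfolding eventually_at by blast
  have dc: "dist (cnj u) z = dist u (cnj z)" for u
    by (metis complex_cnj_cnj complex_cnj_diff complex_mod_cnj dist_norm)
  have "P (cnj w)" if "w \<noteq> cnj z" "dist w (cnj z) < r" for w
    using r(2) [of "cnj w"] that by (simp add: dc complex_cnj_cancel_iff [symmetric, of _ "cnj z"])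
  then show ?thesis using r(1) unfolding eventually_at by blast
qed

lemma open_analytic_points: "open {z. f analytic_on {z}}"
proof (subst open_subopen, rule ballI)
  fix z assume "z \<in> {z. f analytic_on {z}}"
  then obtain S where "open S" "z \<in> S" "f holomorphic_on S" by (auto simp: analytic_at)
  then have "S \<subseteq> {z. f analytic_on {z}}" by (auto intro: holomorphic_on_imp_analytic_at)
  then show "\<exists>T. open T \<and> z \<in> T \<and> T \<subseteq> {z. f analytic_on {z}}" using \<open>open S\<close> \<open>z \<in> S\<close> by blast
qed

lemma hq_mero_iff: "hq_mero \<phi> A \<longleftrightarrow> (\<lambda>z. h0 (\<phi> z)) meromorphic_on A \<and> (\<lambda>z. h1 (\<phi> z)) meromorphic_on A
     \<and> (\<lambda>z. h2 (\<phi> z)) meromorphic_on A \<and> (\<lambda>z. h3 (\<phi> z)) meromorphic_on A"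
  by (simp add: hq_mero_def hq_coords_def)

lemma hq_mero_cong:
  assumes "\<And>z. z \<in> A \<Longrightarrow> \<forall>\<^sub>F w in at z. \<phi> w = \<psi> w" "hq_mero \<phi> A"
  shows "hq_mero \<psi> A"
  unfolding hq_mero_def
proof
  fix c :: "complex hq \<Rightarrow> complex" assume c: "c \<in> hq_coords"
  have "(\<lambda>z. c (\<phi> z)) meromorphic_on A" using assms(2) c by (simp add: hq_mero_def)
  moreover have "\<forall>\<^sub>F w in at z. c (\<phi> w) = c (\<psi> w)" if "z \<in> A" for z
    using assms(1) [OF that] by eventually_elim simp
  ultimately show "(\<lambda>z. c (\<psi> z)) meromorphic_on A"
    using meromorphic_on_cong [of A "\<lambda>z. c (\<phi> z)" "\<lambda>z. c (\<psi> z)" A] by simp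
qed

text \<open>Laurent expansions ignore the value at the point itself, so a base point at which \<open>\<phi>\<close> is
  not regular does no harm.\<close>

definition hq_germ :: "complex \<Rightarrow> (complex \<Rightarrow> complex hq) \<Rightarrow> complex fls hq" where
  "hq_germ z0 \<phi> = Hq (laurent_expansion (\<lambda>z. h0 (\<phi> z)) z0) (laurent_expansion (\<lambda>z. h1 (\<phi> z)) z0)
     (laurent_expansion (\<lambda>z. h2 (\<phi> z)) z0) (laurent_expansion (\<lambda>z. h3 (\<phi> z)) z0)"

lemma hq_germ_cong:
  assumes "\<forall>\<^sub>F w in at z0. \<phi> w = \<psi> w"
  shows "hq_germ z0 \<phi> = hq_germ z0 \<psi>"
proof -
  have "\<forall>\<^sub>F w in at z0. c (\<phi> w) = c (\<psi> w)" for c :: "complex hq \<Rightarrow> complex"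
    using assms by eventually_elim simp
  then show ?thesis by (simp add: hq_germ_def laurent_expansion_cong)
qed

lemma hq_mero_laurent:
  assumes "hq_mero \<phi> A" "z0 \<in> A"
  shows "(\<lambda>w. h0 (\<phi> (z0 + w))) has_laurent_expansion h0 (hq_germ z0 \<phi>)"
    "(\<lambda>w. h1 (\<phi> (z0 + w))) has_laurent_expansion h1 (hq_germ z0 \<phi>)"
    "(\<lambda>w. h2 (\<phi> (z0 + w))) has_laurent_expansion h2 (hq_germ z0 \<phi>)"
    "(\<lambda>w. h3 (\<phi> (z0 + w))) has_laurent_expansion h3 (hq_germ z0 \<phi>)"
  using assms meromorphic_on_imp_has_laurent_expansion [OF _ assms(2)]
  unfolding hq_mero_iff hq_germ_def hq.sel by blast+

lemma hq_mero_mult: "hq_mero \<phi> A \<Longrightarrow> hq_mero \<psi> A \<Longrightarrow> hq_mero (\<lambda>z. \<phi> z * \<psi> z) A"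
  unfolding hq_mero_iff hq_times_sel by (intro conjI meromorphic_intros) blast+

lemma hq_mero_add: "hq_mero \<phi> A \<Longrightarrow> hq_mero \<psi> A \<Longrightarrow> hq_mero (\<lambda>z. \<phi> z + \<psi> z) A"
  unfolding hq_mero_iff hq_sel_simps by (intro conjI meromorphic_intros) blast+

lemma hq_holo_mult: "hq_holo \<phi> A \<Longrightarrow> hq_holo \<psi> A \<Longrightarrow> hq_holo (\<lambda>z. \<phi> z * \<psi> z) A"
  unfolding hq_holo_def hq_times_sel by (intro conjI holomorphic_intros) blast+

lemma hq_holo_add: "hq_holo \<phi> A \<Longrightarrow> hq_holo \<psi> A \<Longrightarrow> hq_holo (\<lambda>z. \<phi> z + \<psi> z) A"
  unfolding hq_holo_def hq_sel_simps by (intro conjI holomorphic_intros) blast+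

lemma hq_holo_subset: "hq_holo \<phi> A \<Longrightarrow> B \<subseteq> A \<Longrightarrow> hq_holo \<phi> B"
  unfolding hq_holo_def using holomorphic_on_subset by blast

lemma hq_germ_mult:
  assumes "hq_mero \<phi> A" "hq_mero \<psi> A" "z0 \<in> A"
  shows "hq_germ z0 (\<lambda>z. \<phi> z * \<psi> z) = hq_germ z0 \<phi> * hq_germ z0 \<psi>"
proof -
  note L = hq_mero_laurent [OF assms(1,3)] hq_mero_laurent [OF assms(2,3)]
  show ?thesis
    unfolding hq_eq_iff hq_germ_def [of z0 "\<lambda>z. \<phi> z * \<psi> z"] hq.sel hq_times_sel
    by (intro conjI laurent_expansion_eqI laurent_expansion_intros L)
qed

lemma hq_germ_add:
  assumes "hq_mero \<phi> A" "hq_mero \<psi> A" "z0 \<in> A"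
  shows "hq_germ z0 (\<lambda>z. \<phi> z + \<psi> z) = hq_germ z0 \<phi> + hq_germ z0 \<psi>"
proof -
  note L = hq_mero_laurent [OF assms(1,3)] hq_mero_laurent [OF assms(2,3)]
  show ?thesis
    unfolding hq_eq_iff hq_germ_def [of z0 "\<lambda>z. \<phi> z + \<psi> z"] hq.sel hq_sel_simps
    by (intro conjI laurent_expansion_eqI laurent_expansion_intros L)
qed

text \<open>The base point \<open>z0\<close> is an arbitrary point of the planar trace at which germs are taken.\<close>

locale based_circular_domain =
  fixes \<Omega> :: "quat set" and z0 :: complex
  assumes domain: "circular_domain \<Omega>" and base: "z0 \<in> planar \<Omega>"
begin

lemma open_\<Omega>: "open \<Omega>" and circular_\<Omega>: "circular \<Omega>" and connected_\<Omega>: "connected \<Omega>"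
  using domain by (simp_all add: circular_domain_def)

text \<open>Near each point \<open>\<phi>\<close> either vanishes or has no zeros, up to the point itself. The planar
  trace need not be connected: if \<open>\<Omega>\<close> does not meet the real axis, it has two halves. But both
  alternatives define open sets that are symmetric under conjugation, hence disjoint open sets
  covering \<open>\<Omega>\<close> itself, which is connected.\<close>

lemma germ_zero_imp_zero_near:
  assumes mero: "\<phi> meromorphic_on planar \<Omega>" and sym: "\<And>z. \<phi> (cnj z) = cnj (\<phi> z)"
    and zero: "laurent_expansion \<phi> z0 = 0" and z: "z \<in> planar \<Omega>"
  shows "\<forall>\<^sub>F w in at z. \<phi> w = 0"
proof -
  define A where "A = {z. \<forall>\<^sub>F w in at z. \<phi> w = 0}"
  define B where "B = {z. \<forall>\<^sub>F w in at z. \<phi> w \<noteq> 0}"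
  have op: "open (lift A)" "open (lift B)"
    unfolding A_def B_def by (intro open_lift open_eventually_at)+
  have disj: "A \<inter> B = {}"
  proof -
    have False if "\<forall>\<^sub>F w in at z. \<phi> w = 0" "\<forall>\<^sub>F w in at z. \<phi> w \<noteq> 0" for z
    proof -
      have "\<forall>\<^sub>F w in at z. False" using that by eventually_elim simp
      then show False by simp
    qed
    then show ?thesis by (auto simp: A_def B_def)
  qed
  have cover: "u \<in> A \<union> B" if "u \<in> planar \<Omega>" for u
  proof -
    have L: "(\<lambda>w. \<phi> (u + w)) has_laurent_expansion laurent_expansion \<phi> u"
      using meromorphic_on_imp_has_laurent_expansion [OF mero that] .
    show ?thesis
      using has_laurent_expansion_eventually_zero_iff [OF L]
        has_laurent_expansion_eventually_nonzero_iff [OF L]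
      by (auto simp: A_def B_def)
  qed
  have symA: "cnj u \<in> A \<longleftrightarrow> u \<in> A" for u
    using eventually_at_cnj [of "\<lambda>w. \<phi> w = 0" u] eventually_at_cnj [of "\<lambda>w. \<phi> w = 0" "cnj u"]
    by (auto simp: A_def sym)
  have "z0 \<in> A"
    using has_laurent_expansion_eventually_zero_iff [OF meromorphic_on_imp_has_laurent_expansion
      [OF mero base]] zero
    by (simp add: A_def)
  then have "slice_pt q_i z0 \<in> lift A \<inter> \<Omega>"
    using base slice_pt_in_lift_iff [OF symA imag_units_basic(1)] by (simp add: planar_def)
  moreover have "lift A \<inter> lift B \<inter> \<Omega> = {}" using disj by (auto simp: lift_def)
  moreover have "\<Omega> \<subseteq> lift A \<union> lift B"
    using cover upper_pt_planar [OF circular_\<Omega>] by (auto simp: lift_def)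
  ultimately have "lift B \<inter> \<Omega> = {}"
    using connectedD [OF connected_\<Omega> op] by blast
  then have "\<Omega> \<subseteq> lift A" using \<open>\<Omega> \<subseteq> lift A \<union> lift B\<close> by blast
  then have "slice_pt q_i z \<in> lift A" using z by (auto simp: planar_def)
  then have "z \<in> A" using slice_pt_in_lift_iff [OF symA imag_units_basic(1)] by blast
  then show ?thesis by (simp add: A_def)
qed

text \<open>These are the germs of the slice preserving semi-regular functions.\<close>

definition germ_field :: "complex fls set" where
  "germ_field = {laurent_expansion \<phi> z0 | \<phi>. \<phi> meromorphic_on planar \<Omega> \<and> (\<forall>z. \<phi> (cnj z) = cnj (\<phi>
    z))}"

lemma in_germ_fieldI:
  assumes "\<phi> meromorphic_on planar \<Omega>" "\<And>z. \<phi> (cnj z) = cnj (\<phi> z)" "(\<lambda>w. \<phi> (z0 + w))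
    has_laurent_expansion F"
  shows "F \<in> germ_field"
  using assms laurent_expansion_eqI [OF assms(3)] by (auto simp: germ_field_def)

lemma in_germ_fieldE:
  assumes "F \<in> germ_field"
  obtains \<phi> where "\<phi> meromorphic_on planar \<Omega>" "\<And>z. \<phi> (cnj z) = cnj (\<phi> z)" "(\<lambda>w. \<phi> (z0 + w))
    has_laurent_expansion F"
  using assms meromorphic_on_imp_has_laurent_expansion [OF _ base] unfolding germ_field_def by blast

sublocale subfield_set germ_field
proof
  show "0 \<in> germ_field" by (rule in_germ_fieldI [of "\<lambda>_. 0"]) (auto intro: meromorphic_intros)
  show "1 \<in> germ_field" by (rule in_germ_fieldI [of "\<lambda>_. 1"]) (auto intro: meromorphic_intros)
  fix F assume "F \<in> germ_field"
  then obtain \<phi> where \<phi>: "\<phi> meromorphic_on planar \<Omega>" "\<And>z. \<phi> (cnj z) = cnj (\<phi> z)" "(\<lambda>w. \<phi> (z0 + w))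
    has_laurent_expansion F"
    by (rule in_germ_fieldE) blast
  show "- F \<in> germ_field"
    by (rule in_germ_fieldI [of "\<lambda>z. - \<phi> z"]) (use \<phi> in \<open>auto intro: meromorphic_intros
      laurent_expansion_intros\<close>)
  show "inverse F \<in> germ_field"
    by (rule in_germ_fieldI [of "\<lambda>z. inverse (\<phi> z)"]) (use \<phi> in \<open>auto intro: meromorphic_intros
      laurent_expansion_intros\<close>)
  fix G assume "G \<in> germ_field"
  then obtain \<psi> where \<psi>: "\<psi> meromorphic_on planar \<Omega>" "\<And>z. \<psi> (cnj z) = cnj (\<psi> z)" "(\<lambda>w. \<psi> (z0 + w))
    has_laurent_expansion G"
    by (rule in_germ_fieldE) blast
  show "F + G \<in> germ_field"
    by (rule in_germ_fieldI [of "\<lambda>z. \<phi> z + \<psi> z"]) (use \<phi> \<psi> in \<open>auto intro: meromorphic_intros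
      laurent_expansion_intros\<close>)
  show "F * G \<in> germ_field"
    by (rule in_germ_fieldI [of "\<lambda>z. \<phi> z * \<psi> z"]) (use \<phi> \<psi> in \<open>auto intro: meromorphic_intros
      laurent_expansion_intros\<close>)
qed

definition germ :: "(quat \<Rightarrow> quat) \<Rightarrow> complex fls hq" where
  "germ f = hq_germ z0 (stem f)"

lemma semireg_iff: "(U, f) \<in> semireg \<Omega> \<longleftrightarrow> regular_on_dense \<Omega> U f"
  using semireg_imp_regular_on_dense regular_on_dense_imp_semireg open_\<Omega> circular_\<Omega> by blast

lemma semiregI:
  assumes "U \<subseteq> \<Omega>" "open U" "circular U"
    and val: "\<And>I z. I \<in> imag_units \<Longrightarrow> slice_pt I z \<in> U \<Longrightarrow> f (slice_pt I z) = slice_val I (\<phi> z)"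
    and "hq_holo \<phi> (planar U)" "hq_mero \<phi> (planar \<Omega>)" "\<And>z. z \<in> planar \<Omega> \<Longrightarrow> \<forall>\<^sub>F w in at z. w \<in>
      planar U"
  shows "(U, f) \<in> semireg \<Omega>" "germ f = hq_germ z0 \<phi>"
proof -
  have st: "stem f z = \<phi> z" if "z \<in> planar U" for z
    using slice_funI(2) [OF val assms(3) that] .
  have ev: "\<forall>\<^sub>F w in at z. \<phi> w = stem f w" if "z \<in> planar \<Omega>" for z
    using assms(7) [OF that] by eventually_elim (simp add: st)
  have "hq_holo (stem f) (planar U)"
    using assms(5) st unfolding hq_holo_def by (auto cong: holomorphic_cong)
  moreover have "hq_mero (stem f) (planar \<Omega>)" using hq_mero_cong [OF ev assms(6)] .
  moreover have "slice_fun U f" using slice_funI(1) [OF val assms(3)] .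
  ultimately show "(U, f) \<in> semireg \<Omega>"
    using assms unfolding semireg_iff regular_on_dense_def by blast
  show "germ f = hq_germ z0 \<phi>"
    unfolding germ_def using hq_germ_cong [OF ev [OF base]] by simp
qed

lemma semireg_const: "(\<Omega>, \<lambda>_. c) \<in> semireg \<Omega>"
  "germ (\<lambda>_. c) = Hq (fls_const (of_real (qRe c))) (fls_const (of_real (qIm1 c))) (fls_const
    (of_real (qIm2 c))) (fls_const (of_real (qIm3 c)))"
proof -
  define \<phi> where "\<phi> = (\<lambda>z::complex. Hq (of_real (qRe c)) (of_real (qIm1 c)) (of_real (qIm2 c))
    (of_real (qIm3 c)) :: complex hq)"
  have 1: "slice_val I (\<phi> z) = c" for I z by (simp add: slice_val_def \<phi>_def quat_eq_iff
    quat_times_sel)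
  have 2: "hq_holo \<phi> (planar \<Omega>)" unfolding hq_holo_def \<phi>_def by simp
  have 3: "hq_mero \<phi> (planar \<Omega>)" unfolding hq_mero_iff \<phi>_def by (auto intro: meromorphic_intros)
  have 4: "\<forall>\<^sub>F w in at z. w \<in> planar \<Omega>" if "z \<in> planar \<Omega>" for z
    using eventually_at_in_open' [OF open_planar [OF open_\<Omega>] that] .
  show "(\<Omega>, \<lambda>_. c) \<in> semireg \<Omega>"
    by (rule semiregI [where \<phi> = \<phi>]) (use 1 2 3 4 open_\<Omega> circular_\<Omega> in auto)
  have "germ (\<lambda>_. c) = hq_germ z0 \<phi>"
    by (rule semiregI [where \<phi> = \<phi> and U = \<Omega>]) (use 1 2 3 4 open_\<Omega> circular_\<Omega> in auto)
  also have "\<dots> = Hq (fls_const (of_real (qRe c))) (fls_const (of_real (qIm1 c))) (fls_const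
    (of_real (qIm2 c))) (fls_const (of_real (qIm3 c)))"
    unfolding hq_germ_def \<phi>_def hq.sel by (simp add: laurent_expansion_eqI)
  finally show "germ (\<lambda>_. c) = \<dots>" .
qed

lemma circular_Int: "circular U \<Longrightarrow> circular V \<Longrightarrow> circular (U \<inter> V)"
  by (auto simp: circular_def)

lemma planar_Int: "planar (U \<inter> V) = planar U \<inter> planar V"
  by (auto simp: planar_def)

lemma semireg_star_add:
  assumes f: "(U, f) \<in> semireg \<Omega>" and g: "(V, g) \<in> semireg \<Omega>"
  shows "(U \<inter> V, star f g) \<in> semireg \<Omega>" "germ (star f g) = germ f * germ g"
    "(U \<inter> V, \<lambda>q. f q + g q) \<in> semireg \<Omega>" "germ (\<lambda>q. f q + g q) = germ f + germ g"
proof -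
  note F = f [unfolded semireg_iff regular_on_dense_def] and G = g [unfolded semireg_iff
    regular_on_dense_def]
  have UV: "U \<inter> V \<subseteq> \<Omega>" "open (U \<inter> V)" "circular (U \<inter> V)"
    using F G by (auto intro: circular_Int)
  have ev: "\<forall>\<^sub>F w in at z. w \<in> planar (U \<inter> V)" if "z \<in> planar \<Omega>" for z
  proof -
    have "\<forall>\<^sub>F w in at z. w \<in> planar U" "\<forall>\<^sub>F w in at z. w \<in> planar V" using F G that by blast+
    then show ?thesis by eventually_elim (simp add: planar_Int)
  qed
  have m: "hq_mero (stem f) (planar \<Omega>)" "hq_mero (stem g) (planar \<Omega>)" using F G by blast+
  have h: "hq_holo (stem f) (planar (U \<inter> V))" "hq_holo (stem g) (planar (U \<inter> V))"
    using F G hq_holo_subset unfolding planar_Int by blast+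
  have 1: "star f g (slice_pt I z) = slice_val I (stem f z * stem g z)" if "I \<in> imag_units"
    "slice_pt I z \<in> U \<inter> V" for I z
    using star_slice_pt that F G by blast
  have 2: "f (slice_pt I z) + g (slice_pt I z) = slice_val I (stem f z + stem g z)" if "I \<in>
    imag_units" "slice_pt I z \<in> U \<inter> V" for I z
    using that F G by (simp add: slice_val_add slice_fun_def)
  note s1 = semiregI [OF UV 1 hq_holo_mult [OF h] hq_mero_mult [OF m] ev]
  show "(U \<inter> V, star f g) \<in> semireg \<Omega>" by (rule s1)
  show "germ (star f g) = germ f * germ g" using s1(2) hq_germ_mult [OF m base] by (simp add:
    germ_def)
  note s2 = semiregI [where f = "\<lambda>q. f q + g q", OF UV 2 hq_holo_add [OF h] hq_mero_add [OF m] ev]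
  show "(U \<inter> V, \<lambda>q. f q + g q) \<in> semireg \<Omega>" by (rule s2)
  show "germ (\<lambda>q. f q + g q) = germ f + germ g" using s2(2) hq_germ_add [OF m base] by (simp add:
    germ_def)
qed

lemma germ_in_K_quats: "(U, f) \<in> semireg \<Omega> \<Longrightarrow> germ f \<in> K_quats"
  unfolding semireg_iff regular_on_dense_def
  using hq_mero_laurent [OF _ base, of "stem f"] in_germ_fieldI [of "\<lambda>z. h0 (stem f z)"]
    in_germ_fieldI [of "\<lambda>z. h1 (stem f z)"]
    in_germ_fieldI [of "\<lambda>z. h2 (stem f z)"] in_germ_fieldI [of "\<lambda>z. h3 (stem f z)"]
  by (simp add: K_quats_def germ_def hq_mero_iff stem_cnj)

text \<open>Choose meromorphic functions with the given expansions and let \<open>U\<close> be the set where all of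
  them are holomorphic.\<close>

lemma semireg_of_germ:
  assumes "h \<in> K_quats"
  obtains U f where "(U, f) \<in> semireg \<Omega>" "germ f = h"
proof -
  have hK: "h0 h \<in> germ_field" "h1 h \<in> germ_field" "h2 h \<in> germ_field" "h3 h \<in> germ_field" using
    assms by (simp_all add: K_quats_def)
  from in_germ_fieldE [OF hK(1)] obtain p0 where p0: "p0 meromorphic_on planar \<Omega>" "\<And>z. p0 (cnj z)
    = cnj (p0 z)" "(\<lambda>w. p0 (z0 + w)) has_laurent_expansion h0 h" by blast
  from in_germ_fieldE [OF hK(2)] obtain p1 where p1: "p1 meromorphic_on planar \<Omega>" "\<And>z. p1 (cnj z)
    = cnj (p1 z)" "(\<lambda>w. p1 (z0 + w)) has_laurent_expansion h1 h" by blast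
  from in_germ_fieldE [OF hK(3)] obtain p2 where p2: "p2 meromorphic_on planar \<Omega>" "\<And>z. p2 (cnj z)
    = cnj (p2 z)" "(\<lambda>w. p2 (z0 + w)) has_laurent_expansion h2 h" by blast
  from in_germ_fieldE [OF hK(4)] obtain p3 where p3: "p3 meromorphic_on planar \<Omega>" "\<And>z. p3 (cnj z)
    = cnj (p3 z)" "(\<lambda>w. p3 (z0 + w)) has_laurent_expansion h3 h" by blast
  define \<phi> where "\<phi> = (\<lambda>z. Hq (p0 z) (p1 z) (p2 z) (p3 z))"
  have sym: "\<phi> (cnj z) = hq_cnj (\<phi> z)" for z by (simp add: \<phi>_def hq_cnj_def p0 p1 p2 p3)
  have mero: "hq_mero \<phi> (planar \<Omega>)" by (simp add: hq_mero_iff \<phi>_def p0 p1 p2 p3)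
  have gm: "hq_germ z0 \<phi> = h" using p0 p1 p2 p3 by (simp add: hq_germ_def \<phi>_def
    laurent_expansion_eqI hq_eq_iff)
  define R where "R = {z. p0 analytic_on {z}} \<inter> {z. p1 analytic_on {z}} \<inter> {z. p2 analytic_on {z}}
    \<inter> {z. p3 analytic_on {z}}"
  \<comment> \<open>Holomorphy is required at \<open>z\<close> and at its conjugate, which makes \<open>A\<close> symmetric by
    definition.\<close>
  define A where "A = planar \<Omega> \<inter> R \<inter> cnj -` R"
  have opR: "open R" unfolding R_def by (intro open_Int open_analytic_points)
  have opA: "open A" unfolding A_def
    by (intro open_Int open_planar open_\<Omega> opR open_vimage continuous_intros)
  have symA: "cnj z \<in> A \<longleftrightarrow> z \<in> A" for z
    using planar_cnj [OF circular_\<Omega>] by (auto simp: A_def)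
  have evR: "\<forall>\<^sub>F w in at z. w \<in> R" if "z \<in> planar \<Omega>" for z
  proof -
    have *: "\<forall>\<^sub>F w in at z. p analytic_on {w}" if "p meromorphic_on planar \<Omega>" for p
      using eventually_cosparse_imp_eventually_at [OF meromorphic_on_imp_analytic_cosparse [OF
        that] \<open>z \<in> planar \<Omega>\<close>] by simp
    show ?thesis
      using * [OF p0(1)] * [OF p1(1)] * [OF p2(1)] * [OF p3(1)] by eventually_elim (simp add: R_def)
  qed
  have evA: "\<forall>\<^sub>F w in at z. w \<in> A" if z: "z \<in> planar \<Omega>" for z
  proof -
    have "\<forall>\<^sub>F w in at z. w \<in> planar \<Omega>"
      using eventually_at_in_open' [OF open_planar [OF open_\<Omega>] z] .
    moreover have "\<forall>\<^sub>F w in at z. w \<in> R" using evR [OF z] .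
    moreover have "\<forall>\<^sub>F w in at z. cnj w \<in> R"
      using eventually_at_cnj [OF evR [of "cnj z"]] planar_cnj [OF circular_\<Omega>] z by simp
    ultimately show ?thesis by eventually_elim (simp add: A_def)
  qed
  have pl: "planar (lift A) = A" by (rule planar_lift [OF symA])
  have circ: "circular (lift A)" by (rule circular_lift [OF symA])
  have sub: "lift A \<subseteq> \<Omega>"
    using upper_pt_planar [OF circular_\<Omega>] by (auto simp: lift_def A_def)
  have hol: "hq_holo \<phi> A"
  proof -
    have "p holomorphic_on A" if "\<And>z. z \<in> A \<Longrightarrow> p analytic_on {z}" for p
      using that analytic_imp_holomorphic analytic_on_analytic_at by blast
    then show ?thesis by (auto simp: hq_holo_def \<phi>_def A_def R_def)
  qed
  note s = semiregI [OF sub open_lift [OF opA] circ slice_ext_slice_pt [where \<phi> = \<phi>, OF sym],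
    unfolded pl, OF _ hol mero evA]
  show ?thesis
    by (rule that [of "lift A" "slice_ext \<phi>"]) (use s gm in auto)
qed

text \<open>Equal germs give components that agree near each point, hence by continuity at each common
  regular point.\<close>

lemma germ_eq_iff:
  assumes f: "(U, f) \<in> semireg \<Omega>" and g: "(V, g) \<in> semireg \<Omega>"
  shows "germ f = germ g \<longleftrightarrow> (\<forall>q\<in>U \<inter> V. f q = g q)"
proof
  note F = f [unfolded semireg_iff regular_on_dense_def] and G = g [unfolded semireg_iff
    regular_on_dense_def]
  have m: "hq_mero (stem f) (planar \<Omega>)" "hq_mero (stem g) (planar \<Omega>)" using F G by blast+
  {
    assume eq: "germ f = germ g"
    have st: "stem f z = stem g z" if z: "z \<in> planar U" "z \<in> planar V" for z
    proof -
      have "z \<in> planar \<Omega>" using z F planar_mono by blast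
      have "c (stem f z) = c (stem g z)"
        if c: "c \<in> hq_coords" and e: "laurent_expansion (\<lambda>z. c (stem f z)) z0 = laurent_expansion
          (\<lambda>z. c (stem g z)) z0" for c
      proof -
        define \<delta> where "\<delta> = (\<lambda>z. c (stem f z) - c (stem g z))"
        have mm: "(\<lambda>z. c (stem f z)) meromorphic_on planar \<Omega>" "(\<lambda>z. c (stem g z)) meromorphic_on
          planar \<Omega>"
          using m c by (simp_all add: hq_mero_def)
        then have "\<delta> meromorphic_on planar \<Omega>" unfolding \<delta>_def by (intro meromorphic_intros)
        moreover have "\<delta> (cnj z) = cnj (\<delta> z)" for z
          using c by (simp add: \<delta>_def stem_cnj hq_coords_hq_cnj)
        moreover have "laurent_expansion \<delta> z0 = 0"
        proof -
          note meromorphic_on_imp_has_laurent_expansion [OF mm(1) base]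
            meromorphic_on_imp_has_laurent_expansion [OF mm(2) base]
          from has_laurent_expansion_diff [OF this] show ?thesis
            unfolding e \<delta>_def by (intro laurent_expansion_eqI) simp
        qed
        ultimately have ev: "\<forall>\<^sub>F w in at z. \<delta> w = 0"
          using germ_zero_imp_zero_near \<open>z \<in> planar \<Omega>\<close> by blast
        have "\<delta> holomorphic_on planar U \<inter> planar V"
          unfolding \<delta>_def using F G c unfolding hq_holo_iff
          by (intro holomorphic_on_diff) (auto intro: holomorphic_on_subset)
        then have "isCont \<delta> z"
          using z F G by (intro holomorphic_on_imp_continuous_on [THEN continuous_on_interior])
            (auto simp: interior_open open_planar)
        then have "\<delta> \<midarrow>z\<rightarrow> \<delta> z" by (simp add: isCont_def)
        moreover have "\<delta> \<midarrow>z\<rightarrow> 0" using ev by (rule tendsto_eventually)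
        ultimately have "\<delta> z = 0" using LIM_unique by blast
        then show ?thesis by (simp add: \<delta>_def)
      qed
      then show ?thesis
        using eq by (simp add: hq_eq_iff germ_def hq_germ_def hq_coords_def)
    qed
    show "\<forall>q\<in>U \<inter> V. f q = g q"
    proof
      fix q assume q: "q \<in> U \<inter> V"
      have c: "circular U" "circular V" using F G by blast+
      then have "upper_pt q \<in> planar U" "upper_pt q \<in> planar V" using q upper_pt_planar by blast+
      then have "stem f (upper_pt q) = stem g (upper_pt q)" by (rule st)
      moreover have "f q = slice_val (imag_dir q) (stem f (upper_pt q))" "g q = slice_val
        (imag_dir q) (stem g (upper_pt q))"
        using F G q slice_fun_upper_pt by blast+
      ultimately show "f q = g q" by simp
    qed
  next
    assume eq: "\<forall>q\<in>U \<inter> V. f q = g q"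
    have "\<forall>\<^sub>F w in at z0. w \<in> planar U" "\<forall>\<^sub>F w in at z0. w \<in> planar V" using F G base by blast+
    then have "\<forall>\<^sub>F w in at z0. stem f w = stem g w"
    proof eventually_elim
      case (elim w)
      have c: "circular U" "circular V" using F G by blast+
      have "slice_pt q_i w \<in> U \<inter> V" "slice_pt (- q_i) w \<in> U \<inter> V"
        using elim circular_slice_pt_iff [OF c(1)] circular_slice_pt_iff [OF c(2)] by simp_all
      then show ?case using eq by (simp add: stem_def stem1_def stem2_def)
    qed
    then show "germ f = germ g" unfolding germ_def by (rule hq_germ_cong)
  }
qed

end

section \<open>The ring of semi-regular functions as a quaternion algebra\<close>

context based_circular_domain
begin

text \<open>Two representatives are identified iff they have the same germ, so the classes are the
  fibres of the germ map.\<close>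

definition germ_class :: "complex fls hq \<Rightarrow> sem" where
  "germ_class h = {x \<in> semireg \<Omega>. germ (snd x) = h}"

lemma sem_rel_iff: "(x, y) \<in> sem_rel \<Omega> \<longleftrightarrow> x \<in> semireg \<Omega> \<and> y \<in> semireg \<Omega> \<and> germ (snd x) = germ (snd
  y)"
  by (cases x; cases y) (auto simp: sem_rel_def germ_eq_iff)

lemma sem_rel_class: "x \<in> semireg \<Omega> \<Longrightarrow> sem_rel \<Omega> `` {x} = germ_class (germ (snd x))"
  by (auto simp: sem_rel_iff germ_class_def)

lemma germ_class_nonempty:
  assumes "h \<in> K_quats" obtains U f where "(U, f) \<in> germ_class h"
proof -
  obtain U f where "(U, f) \<in> semireg \<Omega>" "germ f = h" using semireg_of_germ [OF assms] .
  then show ?thesis by (intro that [of U f]) (simp add: germ_class_def)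
qed

lemma UN_germ_class_const:
  assumes "h \<in> K_quats" "\<And>U f. (U, f) \<in> germ_class h \<Longrightarrow> P U f = C"
  shows "(\<Union>(U, f)\<in>germ_class h. P U f) = C"
proof (rule SUP_eq_const)
  show "germ_class h \<noteq> {}" using germ_class_nonempty [OF assms(1)] by blast
  show "(case x of (U, f) \<Rightarrow> P U f) = C" if "x \<in> germ_class h" for x
    using assms(2) that by (cases x) simp
qed

text \<open>A product or sum of classes is defined as a union over all pairs of representatives. The
  germ of the result depends on the germs of the representatives only, so all sets in the union
  are the same class.\<close>

sublocale M: hq_model germ_field "SEM \<Omega>" germ_class
proof
  show "carrier (SEM \<Omega>) = germ_class ` K_quats"
  proof -
    have "semireg \<Omega> // sem_rel \<Omega> = (\<lambda>x. germ_class (germ (snd x))) ` semireg \<Omega>"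
      by (auto simp: quotient_def sem_rel_class)
    also have "\<dots> = germ_class ` (\<lambda>x. germ (snd x)) ` semireg \<Omega>" by (simp add: image_image)
    also have "(\<lambda>x. germ (snd x)) ` semireg \<Omega> = K_quats"
    proof (intro equalityI subsetI)
      fix h assume "h \<in> K_quats"
      then obtain U f where "(U, f) \<in> semireg \<Omega>" "germ f = h" by (rule semireg_of_germ)
      then show "h \<in> (\<lambda>x. germ (snd x)) ` semireg \<Omega>" by (intro rev_image_eqI [of "(U, f)"]) simp_all
    qed (use germ_in_K_quats in auto)
    finally show ?thesis by (simp add: SEM_def)
  qed
  show "inj_on germ_class K_quats"
  proof (rule inj_onI)
    fix a b assume "a \<in> K_quats" and eq: "germ_class a = germ_class b"
    then obtain U f where "(U, f) \<in> germ_class a" using germ_class_nonempty by blast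
    moreover from this have "(U, f) \<in> germ_class b" using eq by simp
    ultimately show "a = b" by (simp add: germ_class_def)
  qed
  show "\<one>\<^bsub>SEM \<Omega>\<^esub> = germ_class 1" "\<zero>\<^bsub>SEM \<Omega>\<^esub> = germ_class 0"
    using semireg_const [of 1] semireg_const [of 0]
    by (simp_all add: SEM_def sem_const_def sem_rel_class zero_hq_def one_hq_def)
  fix a b assume ab: "a \<in> K_quats" "b \<in> K_quats"
  show "germ_class a \<otimes>\<^bsub>SEM \<Omega>\<^esub> germ_class b = germ_class (a * b)"
    unfolding SEM_def monoid.simps
    by (intro UN_germ_class_const ab) (use semireg_star_add in \<open>auto simp: germ_class_def
      sem_rel_class\<close>)
  show "germ_class a \<oplus>\<^bsub>SEM \<Omega>\<^esub> germ_class b = germ_class (a + b)"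
    unfolding SEM_def ring_record_simps
    by (intro UN_germ_class_const ab) (use semireg_star_add in \<open>auto simp: germ_class_def
      sem_rel_class\<close>)
qed

lemma sem_const_germ_class: "sem_const \<Omega> c = germ_class (Hq (fls_const (of_real (qRe c)))
  (fls_const (of_real (qIm1 c)))
   (fls_const (of_real (qIm2 c))) (fls_const (of_real (qIm3 c))))"
  using semireg_const [of c] by (simp add: sem_const_def sem_rel_class)

lemma slice_slice_pt: "slice I = range (slice_pt I)"
proof (intro equalityI subsetI)
  fix q assume "q \<in> slice I"
  then obtain x y where "q = of_real x + I * of_real y" unfolding slice_def by blast
  then have "q = slice_pt I (Complex x y)" by (simp add: slice_pt_def)
  then show "q \<in> range (slice_pt I)" by blast
qed (auto simp: slice_def slice_pt_def)

text \<open>If \<open>F1 + I F2\<close> lies in the slice of \<open>I\<close> for \<open>I = \<plusminus> q_i\<close> and \<open>I = \<plusminus> q_j\<close>, then \<open>F1\<close> and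
  \<open>F2\<close> lie in the intersection of two slices, which is the real line.\<close>

lemma slice_preserving_imp_germ:
  assumes f: "(U, f) \<in> semireg \<Omega>" and "slice_preserving_on U f"
  shows "germ f = hq_scalar (h0 (germ f))"
proof -
  note F = f [unfolded semireg_iff regular_on_dense_def]
  have st: "h1 (stem f z) = 0 \<and> h2 (stem f z) = 0 \<and> h3 (stem f z) = 0" if z: "z \<in> planar U" for z
  proof -
    have *: "slice_val I (stem f z) \<in> range (slice_pt I)" if I: "I \<in> imag_units" for I
    proof -
      have U: "slice_pt I z \<in> U" using circular_slice_pt_iff [of U I z] F I z by blast
      then have "f (slice_pt I z) = slice_val I (stem f z)" using F I unfolding slice_fun_def by
        blast
      moreover have "f (slice_pt I z) \<in> slice I"
        using assms(2) I U unfolding slice_preserving_on_def slice_slice_pt by blast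
      ultimately show ?thesis by (simp add: slice_slice_pt)
    qed
    have i: "qIm2 (slice_val q_i (stem f z)) = 0" "qIm3 (slice_val q_i (stem f z)) = 0"
      using * [OF imag_units_basic(1)] by auto
    have i': "qIm2 (slice_val (- q_i) (stem f z)) = 0" "qIm3 (slice_val (- q_i) (stem f z)) = 0"
      using * [of "- q_i"] by auto
    have j: "qIm1 (slice_val q_j (stem f z)) = 0" "qIm3 (slice_val q_j (stem f z)) = 0"
      using * [OF imag_units_basic(2)] by auto
    have j': "qIm1 (slice_val (- q_j) (stem f z)) = 0" "qIm3 (slice_val (- q_j) (stem f z)) = 0"
      using * [of "- q_j"] by auto
    show ?thesis
      using i i' j j' by (auto simp: slice_val_sel complex_eq_iff)
  qed
  have ev: "\<forall>\<^sub>F w in at z0. w \<in> planar U" using F base by blast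
  have "\<forall>\<^sub>F w in at z0. h1 (stem f w) = 0" "\<forall>\<^sub>F w in at z0. h2 (stem f w) = 0" "\<forall>\<^sub>F w in at z0. h3
    (stem f w) = 0"
    using ev by (eventually_elim, use st in blast)+
  then show ?thesis by (simp add: germ_def hq_germ_def hq_eq_iff laurent_expansion_def)
qed

text \<open>The first component of the stem function alone defines a slice preserving function with
  the same germ, so \<open>f\<close> agrees with it.\<close>

lemma germ_imp_slice_preserving:
  assumes f: "(U, f) \<in> semireg \<Omega>" and g: "germ f = hq_scalar c"
  shows "slice_preserving_on U f"
proof -
  note F = f [unfolded semireg_iff regular_on_dense_def]
  define \<phi> where "\<phi> = (\<lambda>z. hq_scalar (h0 (stem f z)))"
  have sym: "\<phi> (cnj z) = hq_cnj (\<phi> z)" for z by (simp add: \<phi>_def stem_cnj hq_eq_iff)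
  have p: "(U, slice_ext \<phi>) \<in> semireg \<Omega>" "germ (slice_ext \<phi>) = hq_germ z0 \<phi>"
  proof -
    have UV: "U \<subseteq> \<Omega>" "open U" "circular U" using F by blast+
    have h: "hq_holo \<phi> (planar U)" using F by (simp add: hq_holo_def \<phi>_def)
    have m: "hq_mero \<phi> (planar \<Omega>)" using F by (auto simp: hq_mero_iff \<phi>_def intro:
      meromorphic_intros)
    have ev: "\<forall>\<^sub>F w in at z. w \<in> planar U" if "z \<in> planar \<Omega>" for z using F that by blast
    show "(U, slice_ext \<phi>) \<in> semireg \<Omega>" "germ (slice_ext \<phi>) = hq_germ z0 \<phi>"
      by (rule semiregI [OF UV slice_ext_slice_pt [where \<phi> = \<phi>, OF sym] h m ev]; assumption)+
  qed
  have "laurent_expansion (\<lambda>_. 0) z0 = 0" by (simp add: laurent_expansion_def)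
  then have "hq_germ z0 \<phi> = hq_scalar (h0 (germ f))"
    by (simp add: hq_germ_def \<phi>_def germ_def hq_eq_iff)
  then have "germ f = germ (slice_ext \<phi>)" using g p(2) by simp
  then have eq: "f q = slice_ext \<phi> q" if "q \<in> U" for q using germ_eq_iff [OF f p(1)] that by blast
  show ?thesis
    unfolding slice_preserving_on_def slice_slice_pt
  proof (intro ballI image_subsetI)
    fix I q assume I: "I \<in> imag_units" and "q \<in> U \<inter> range (slice_pt I)"
    then obtain z where z: "q = slice_pt I z" "q \<in> U" by blast
    have "f q = slice_val I (\<phi> z)" using eq [OF z(2)] slice_ext_slice_pt [where \<phi> = \<phi>, OF sym I]
      z(1) by simp
    also have "\<dots> = slice_pt I (h0 (stem f z))" by (simp add: \<phi>_def slice_val_slice_pt_sum)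
    finally show "f q \<in> range (slice_pt I)" by blast
  qed
qed

lemma SEM_real_eq: "SEM_real \<Omega> = germ_class ` hq_scalar ` germ_field"
proof (intro equalityI subsetI)
  fix X assume "X \<in> SEM_real \<Omega>"
  then obtain a U f where a: "X = germ_class a" "a \<in> K_quats" "(U, f) \<in> X" "slice_preserving_on U f"
    by (auto simp: SEM_real_def M.carrier_eq)
  then have f: "(U, f) \<in> semireg \<Omega>" "germ f = a" by (auto simp: germ_class_def)
  then have "a = hq_scalar (h0 a)" using slice_preserving_imp_germ a(4) by blast
  moreover have "h0 a \<in> germ_field" using a(2) by (simp add: K_quats_def)
  ultimately show "X \<in> germ_class ` hq_scalar ` germ_field" using a(1) by blast
next
  fix X assume "X \<in> germ_class ` hq_scalar ` germ_field"
  then obtain c where c: "c \<in> germ_field" "X = germ_class (hq_scalar c)" by blast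
  have q: "hq_scalar c \<in> K_quats" using c(1) by (simp add: K_quats_closed)
  obtain U f where Uf: "(U, f) \<in> germ_class (hq_scalar c)" using germ_class_nonempty [OF q] .
  then have "slice_preserving_on U f" using germ_imp_slice_preserving by (auto simp: germ_class_def)
  then show "X \<in> SEM_real \<Omega>" using Uf c(2) q by (auto simp: SEM_real_def)
qed

lemma vec_comb_germ_class:
  assumes "c1 \<in> germ_field" "c2 \<in> germ_field" "c3 \<in> germ_field"
  shows "sem_vec_comb \<Omega> (germ_class (hq_scalar c1)) (germ_class (hq_scalar c2)) (germ_class
    (hq_scalar c3)) = germ_class (Hq 0 c1 c2 c3)"
proof -
  have ijk: "sem_const \<Omega> q_i = germ_class (Hq 0 1 0 0)" "sem_const \<Omega> q_j = germ_class (Hq 0 0 1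
    0)" "sem_const \<Omega> q_k = germ_class (Hq 0 0 0 1)"
    by (simp_all add: sem_const_germ_class)
  have Q: "Hq 0 1 0 0 \<in> K_quats" "Hq 0 0 1 0 \<in> K_quats" "Hq 0 0 0 1 \<in> K_quats" by (simp_all add:
    K_quats_def K_closed)
  have "hq_scalar c1 * Hq 0 1 0 0 + hq_scalar c2 * Hq 0 0 1 0 + hq_scalar c3 * Hq 0 0 0 1 = Hq 0
    c1 c2 c3"
    by (simp add: hq_eq_iff hq_times_sel)
  then show ?thesis
    unfolding sem_vec_comb_def ijk using assms Q by (simp add: M.mult_elt M.add_elt K_quats_closed)
qed

text \<open>The decomposition of an element into slice preserving components is that of its germ into
  coordinates, which is unique.\<close>

lemma sem_conj_germ_class:
  assumes "a \<in> K_quats"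
  shows "sem_conj \<Omega> (germ_class a) = germ_class (hq_conj a)"
proof -
  have step: "germ_class (hq_scalar c0) \<oplus>\<^bsub>SEM \<Omega>\<^esub> germ_class (Hq 0 c1 c2 c3) = germ_class (Hq c0 c1
    c2 c3)"
    "germ_class (hq_scalar c0) \<ominus>\<^bsub>SEM \<Omega>\<^esub> germ_class (Hq 0 c1 c2 c3) = germ_class (hq_conj (Hq c0 c1
      c2 c3))"
    if "c0 \<in> germ_field" "c1 \<in> germ_field" "c2 \<in> germ_field" "c3 \<in> germ_field" for c0 c1 c2 c3
  proof -
    have Q: "hq_scalar c0 \<in> K_quats" "Hq 0 c1 c2 c3 \<in> K_quats" using that by (simp_all add:
      K_quats_def K_closed)
    have "hq_scalar c0 + Hq 0 c1 c2 c3 = Hq c0 c1 c2 c3" "hq_scalar c0 - Hq 0 c1 c2 c3 = hq_conj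
      (Hq c0 c1 c2 c3)"
      by (simp_all add: hq_eq_iff)
    then show "germ_class (hq_scalar c0) \<oplus>\<^bsub>SEM \<Omega>\<^esub> germ_class (Hq 0 c1 c2 c3) = germ_class (Hq c0
      c1 c2 c3)"
      "germ_class (hq_scalar c0) \<ominus>\<^bsub>SEM \<Omega>\<^esub> germ_class (Hq 0 c1 c2 c3) = germ_class (hq_conj (Hq c0
        c1 c2 c3))"
      using Q by (simp_all add: M.add_elt M.minus_elt)
  qed
  show ?thesis
    unfolding sem_conj_def SEM_real_eq
  proof (rule the_equality)
    have c: "h0 a \<in> germ_field" "h1 a \<in> germ_field" "h2 a \<in> germ_field" "h3 a \<in> germ_field" using
      assms by (simp_all add: K_quats_def)
    have "germ_class a = germ_class (hq_scalar (h0 a)) \<oplus>\<^bsub>SEM \<Omega>\<^esub> sem_vec_comb \<Omega> (germ_class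
      (hq_scalar (h1 a))) (germ_class (hq_scalar (h2 a))) (germ_class (hq_scalar (h3 a)))"
      "germ_class (hq_conj a) = germ_class (hq_scalar (h0 a)) \<ominus>\<^bsub>SEM \<Omega>\<^esub> sem_vec_comb \<Omega> (germ_class
        (hq_scalar (h1 a))) (germ_class (hq_scalar (h2 a))) (germ_class (hq_scalar (h3 a)))"
      using c by (simp_all add: vec_comb_germ_class step)
    then show "\<exists>F0\<in>germ_class ` hq_scalar ` germ_field. \<exists>F1\<in>germ_class ` hq_scalar ` germ_field.
      \<exists>F2\<in>germ_class ` hq_scalar ` germ_field. \<exists>F3\<in>germ_class ` hq_scalar ` germ_field.
      germ_class a = F0 \<oplus>\<^bsub>SEM \<Omega>\<^esub> sem_vec_comb \<Omega> F1 F2 F3 \<and> germ_class (hq_conj a) = F0 \<ominus>\<^bsub>SEM \<Omega>\<^esub>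
        sem_vec_comb \<Omega> F1 F2 F3"
      using c by blast
  next
    fix G assume "\<exists>F0\<in>germ_class ` hq_scalar ` germ_field. \<exists>F1\<in>germ_class ` hq_scalar `
      germ_field. \<exists>F2\<in>germ_class ` hq_scalar ` germ_field. \<exists>F3\<in>germ_class ` hq_scalar ` germ_field.
      germ_class a = F0 \<oplus>\<^bsub>SEM \<Omega>\<^esub> sem_vec_comb \<Omega> F1 F2 F3 \<and> G = F0 \<ominus>\<^bsub>SEM \<Omega>\<^esub> sem_vec_comb \<Omega> F1 F2 F3"
    then obtain c0 c1 c2 c3 where c: "c0 \<in> germ_field" "c1 \<in> germ_field" "c2 \<in> germ_field" "c3 \<in>
      germ_field"
      "germ_class a = germ_class (hq_scalar c0) \<oplus>\<^bsub>SEM \<Omega>\<^esub> sem_vec_comb \<Omega> (germ_class (hq_scalar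
        c1)) (germ_class (hq_scalar c2)) (germ_class (hq_scalar c3))"
      "G = germ_class (hq_scalar c0) \<ominus>\<^bsub>SEM \<Omega>\<^esub> sem_vec_comb \<Omega> (germ_class (hq_scalar c1))
        (germ_class (hq_scalar c2)) (germ_class (hq_scalar c3))"
      by blast
    then have "germ_class a = germ_class (Hq c0 c1 c2 c3)" "G = germ_class (hq_conj (Hq c0 c1 c2
      c3))"
      by (simp_all add: vec_comb_germ_class step)
    moreover have "Hq c0 c1 c2 c3 \<in> K_quats" using c by (simp add: K_quats_def)
    ultimately show "G = germ_class (hq_conj a)" using M.elt_eq_iff assms by simp
  qed
qed

lemma sem_real_part_germ_class:
  assumes "a \<in> K_quats"
  shows "sem_real_part \<Omega> (germ_class a) = germ_class (hq_scalar (h0 a))"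
proof -
  define t :: "complex fls" where "t = fls_const (1/2)"
  have half: "qRe (1/2) = 1/2" "qIm1 (1/2) = 0" "qIm2 (1/2) = 0" "qIm3 (1/2) = 0"
  proof -
    have "(1/2 :: quat) * 2 = 1"
      by (simp only: divide_inverse mult.assoc left_inverse [OF zero_neq_numeral [symmetric]]
        mult_1_right)
    then have "(1/2 :: quat) + 1/2 = 1" by (simp only: mult_2_right)
    then show "qRe (1/2) = 1/2" "qIm1 (1/2) = 0" "qIm2 (1/2) = 0" "qIm3 (1/2) = 0"
      unfolding quat_eq_iff by simp_all
  qed
  have "sem_const \<Omega> (1/2) = germ_class (hq_scalar t)"
    by (simp add: sem_const_germ_class half t_def hq_scalar_def)
  moreover have tt: "t + t = 1" by (simp add: t_def fls_plus_const)
  moreover have "hq_scalar t \<in> K_quats"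
  proof -
    have "t = 1 / (1 + 1)" using tt by (simp add: eq_divide_eq mult_2_right)
    moreover have "1 / (1 + 1) \<in> germ_field" by (intro divide_K add_K one_K)
    ultimately show ?thesis by (simp only: K_quats_closed)
  qed
  moreover have "hq_scalar t * (a + hq_conj a) = hq_scalar (h0 a)"
  proof -
    have "t * (h0 a + h0 a) = (t + t) * h0 a" by (simp add: algebra_simps)
    then show ?thesis using tt by (simp add: hq_eq_iff hq_times_sel)
  qed
  ultimately show ?thesis
    using assms unfolding sem_real_part_def sem_conj_germ_class [OF assms]
    by (simp add: M.add_elt M.mult_elt K_quats_closed)
qed

lemma sem_vec_part_germ_class:
  assumes "a \<in> K_quats"
  shows "sem_vec_part \<Omega> (germ_class a) = germ_class (hq_vec a)"
proof -
  have "hq_scalar (h0 a) \<in> K_quats" using assms by (simp add: K_quats_def zero_K)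
  moreover have "a - hq_scalar (h0 a) = hq_vec a" by (simp add: hq_eq_iff)
  ultimately show ?thesis
    using assms unfolding sem_vec_part_def sem_real_part_germ_class [OF assms] by (simp add:
      M.minus_elt)
qed

lemma sem_symm_germ_class:
  assumes "a \<in> K_quats"
  shows "sem_symm \<Omega> (germ_class a) = germ_class (hq_scalar (hq_norm a))"
  using assms unfolding sem_symm_def sem_conj_germ_class [OF assms]
  by (simp add: M.mult_elt K_quats_closed hq_times_hq_conj)

end

section \<open>The kernel of the Sylvester operator\<close>

theorem theorem7p1:
  fixes \<Omega> :: "quat set" and f g :: sem
  assumes "circular_domain \<Omega>"
    and "f \<in> carrier (SEM \<Omega>) - SEM_real \<Omega>"
    and "g \<in> carrier (SEM \<Omega>) - SEM_real \<Omega>"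
    and "sem_real_part \<Omega> f = \<ominus>\<^bsub>SEM \<Omega>\<^esub> sem_real_part \<Omega> g"
    and "sem_symm \<Omega> (sem_vec_part \<Omega> f) = sem_symm \<Omega> (sem_vec_part \<Omega> g)"
  shows "a_kernel (SEM \<Omega>) (SEM \<Omega>) (sylvester \<Omega> f g) =
           {f \<otimes>\<^bsub>SEM \<Omega>\<^esub> h \<oplus>\<^bsub>SEM \<Omega>\<^esub> h \<otimes>\<^bsub>SEM \<Omega>\<^esub> sem_conj \<Omega> g | h. h \<in> carrier (SEM \<Omega>)} \<and>
         (\<exists>Us. set Us \<subseteq> Units (SEM \<Omega>) \<and>
           ring.independent (SEM \<Omega>) (SEM_real \<Omega>) Us \<and>
           ring.Span (SEM \<Omega>) (SEM_real \<Omega>) Us = a_kernel (SEM \<Omega>) (SEM \<Omega>) (sylvester \<Omega> f g))"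
proof -
  \<comment> \<open>Over the empty set every function is slice preserving, so a base point exists.\<close>
  have "\<Omega> \<noteq> {}"
  proof
    assume e: "\<Omega> = {}"
    obtain U \<phi> where U: "(U, \<phi>) \<in> f" "U \<subseteq> \<Omega>"
    proof -
      obtain x where x: "x \<in> semireg \<Omega>" "f = sem_rel \<Omega> `` {x}"
        using assms(2) by (auto simp: SEM_def quotient_def)
      obtain U \<phi> where xx: "x = (U, \<phi>)" by (cases x)
      have "U \<subseteq> \<Omega>" using x xx by (auto simp: semireg_def)
      moreover have "(U, \<phi>) \<in> f" using x xx by (auto simp: sem_rel_def)
      ultimately show ?thesis using that by blast
    qed
    have "slice_preserving_on U \<phi>" using U(2) e by (simp add: slice_preserving_on_def)
    then have "f \<in> SEM_real \<Omega>" using assms(2) U(1) by (auto simp: SEM_real_def)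
    then show False using assms(2) by blast
  qed
  then obtain q where q: "q \<in> \<Omega>" by blast
  interpret based_circular_domain \<Omega> "upper_pt q"
    using assms(1) q upper_pt_planar [of \<Omega> q] by unfold_locales (auto simp: circular_domain_def)
  obtain a where a: "f = germ_class a" "a \<in> K_quats" using assms(2) by (auto simp: M.carrier_eq)
  obtain b where b: "g = germ_class b" "b \<in> K_quats" using assms(3) by (auto simp: M.carrier_eq)
  have nonreal: "hq_vec c \<noteq> 0" if "germ_class c \<notin> SEM_real \<Omega>" "c \<in> K_quats" for c
  proof
    assume "hq_vec c = 0"
    then have "c = hq_scalar (h0 c)" by (simp add: hq_eq_iff)
    moreover have "h0 c \<in> germ_field" using that(2) by (simp add: K_quats_def)
    ultimately show False using that(1) unfolding SEM_real_eq by blast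
  qed
  have va: "hq_vec a \<noteq> 0" and vb: "hq_vec b \<noteq> 0" using nonreal assms(2,3) a b by blast+
  have sQ: "hq_scalar (h0 a) \<in> K_quats" "hq_scalar (h0 b) \<in> K_quats" using a b by (simp_all add:
    K_quats_def zero_K)
  have vQ: "hq_vec a \<in> K_quats" "hq_vec b \<in> K_quats" using a b by (simp_all add: K_quats_closed)
  have h0: "h0 a = - h0 b"
  proof -
    have "germ_class (hq_scalar (h0 a)) = germ_class (- hq_scalar (h0 b))"
      using assms(4) a b sQ by (simp add: sem_real_part_germ_class M.uminus_elt)
    then have "hq_scalar (h0 a) = - hq_scalar (h0 b)" using sQ by (simp add: M.elt_eq_iff
      K_quats_closed)
    then show ?thesis by (simp add: hq_eq_iff)
  qed
  have hn: "hq_norm (hq_vec a) = hq_norm (hq_vec b)"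
  proof -
    have "germ_class (hq_scalar (hq_norm (hq_vec a))) = germ_class (hq_scalar (hq_norm (hq_vec b)))"
      using assms(5) a b vQ by (simp add: sem_vec_part_germ_class sem_symm_germ_class)
    then have "hq_scalar (hq_norm (hq_vec a)) = hq_scalar (hq_norm (hq_vec b))"
      using vQ by (simp add: M.elt_eq_iff K_quats_closed hq_norm_K)
    then show ?thesis by (simp add: hq_eq_iff)
  qed
  have ker: "a_kernel (SEM \<Omega>) (SEM \<Omega>) (sylvester \<Omega> f g) =
      {x \<in> carrier (SEM \<Omega>). germ_class a \<otimes>\<^bsub>SEM \<Omega>\<^esub> x \<oplus>\<^bsub>SEM \<Omega>\<^esub> x \<otimes>\<^bsub>SEM \<Omega>\<^esub> germ_class b = \<zero>\<^bsub>SEM \<Omega>\<^esub>}"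
    unfolding a_kernel_def' sylvester_def a(1) b(1) ..
  show ?thesis
    unfolding ker unfolding SEM_real_eq a(1) b(1) sem_conj_germ_class [OF b(2)]
    by (rule conjI, (rule M.sylvester_kernel_model [OF a(2) va b(2) vb h0 hn])+)
qed

end
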